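(* Let $\beta,\gamma>0$ and let $R^g=(R^g_\lambda,\lambda>0)$ be the resolvent of the general Brownian motion $B^g$ on $\mathbb{R}_+$ with parameters $\beta,\gamma$. For $\lambda>0$ put $\rho(\lambda)=(\beta+\sqrt{2\lambda}+\gamma\lambda)^{-1}$, $e_\lambda(x)=e^{-\sqrt{2\lambda}\,x}$, $(e_\lambda,f)=\int_0^\infty e_\lambda(y)f(y)\,dy$, $r^D_\lambda(x,y)=\frac{1}{\sqrt{2\lambda}}\bigl(e^{-\sqrt{2\lambda}|x-y|}-e^{-\sqrt{2\lambda}(x+y)}\bigr)$ and $R^D_\lambda f(x)=\int_0^\infty r^D_\lambda(x,y)f(y)\,dy$. Then for all $\lambda>0$, $f\in C_0(\mathbb{R}_+)$, $$R^g_\lambda f(x)=R^D_\lambda f(x)+\rho(\lambda)\bigl(2(e_\lambda,f)+\gamma f(0)\bigr)e_\lambda(x),\qquad x\in\mathbb{R}_+,$$ and in particular $R^g_\lambda$ has the integral kernel $$r^g_\lambda(x,dy)=r^D_\lambda(x,y)\,dy+2\rho(\lambda)\,e_\lambda(x+y)\,dy+\gamma\rho(\lambda)\,e_\lambda(x)\,\varepsilon_0(dy),\qquad x,y\in\mathbb{R}_+,$$ where $\varepsilon_0$ is the Dirac measure at $0$.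
   Context: Setting. $(\Omega,\mathcal{A})$ is a measurable space with probability measures $(P_x,\,x\in\mathbb{R})$ and a right continuous filtration $\mathcal{F}=(\mathcal{F}_t,\,t\ge0)$, complete with respect to $(P_x)$; $B=(B_t,\,t\ge0)$ is a standard one-dimensional Brownian motion relative to $\mathcal{F}$ with $P_x(B_0=x)=1$, equipped with shift operators $\theta_t:\Omega\to\Omega$ with $B_s\circ\theta_t=B_{s+t}$. $L=(L_t,\,t\ge0)$ is the local time of $B$ at $0$, normalized so that Tanaka's formula reads $d|B_t|=\operatorname{sign}(B_t)\,dB_t+dL_t$. All paths of $B$ and $L$ are continuous. Let $\tau^{-1}(t)=t+\gamma L_t$, $t\ge0$ (a strictly increasing continuous bijection of $\mathbb{R}_+=[0,+\infty)$), with inverse $\tau$; put $B^s_t=|B_{\tau(t)}|$ and $L^s_t=L_{\tau(t)}$, $t\ge0$. General Brownian motion. Let $P_\beta$ be the exponential law of rate $\beta$ on $\mathbb{R}_+$, $S(s)=s$ the identity random variable on $\mathbb{R}_+$, and $\hat\Omega=\Omega\times\mathbb{R}_+$ with product $\sigma$-algebra and measures $\hat P_x=P_x\otimes P_\beta$; random variables are extended trivially to $\hat\Omega$. Put $\zeta_{\beta,\gamma}=\inf\{t\ge0:\,L^s_t>S\}$, and $B^g_t=B^s_t$ if $t<\zeta_{\beta,\gamma}$, $B^g_t=\Delta$ if $t\ge\zeta_{\beta,\gamma}$, where $\Delta$ is a cemetery point. Functions $f$ on $\mathbb{R}_+$ are extended by $f(\Delta)=0$. The resolvent is $R^g_\lambda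 f(x)=\hat E_x\bigl(\int_0^\infty e^{-\lambda t}f(B^g_t)\,dt\bigr)$. $C_0(\mathbb{R}_+)$ is the space of real continuous functions on $[0,+\infty)$ vanishing at infinity. *)

theory Defs
  imports "HOL-Probability.Probability"
begin

section \<open>Stochastic integrals with respect to a Brownian motion\<close>

text \<open>
  A list of triples \<open>(a, b, h)\<close> stands for the simple integrand \<open>\<Sum> h 1_{]a,b]}\<close>, where
  each \<open>h\<close> is bounded and \<open>F a\<close>-measurable; the intervals need not be disjoint.
\<close>

type_synonym 'a simple_proc = "(real \<times> real \<times> ('a \<Rightarrow> real)) list"

definition simple_integrand :: "(real \<Rightarrow> 'a measure) \<Rightarrow> 'a simple_proc \<Rightarrow> bool" where
  "simple_integrand F H \<longleftrightarrow>
     (\<forall>(a, b, h)\<in>set H. 0 \<le> a \<and> a \<le> b \<and> h \<in> borel_measurable (F a) \<and>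
        (\<exists>C. \<forall>\<omega>\<in>space (F a). \<bar>h \<omega>\<bar> \<le> C))"

definition simple_val :: "'a simple_proc \<Rightarrow> real \<Rightarrow> 'a \<Rightarrow> real" where
  "simple_val H s \<omega> = (\<Sum>(a, b, h)\<leftarrow>H. h \<omega> * indicator {a<..b} s)"

definition simple_int :: "(real \<Rightarrow> 'a \<Rightarrow> real) \<Rightarrow> 'a simple_proc \<Rightarrow> real \<Rightarrow> 'a \<Rightarrow> real" where
  "simple_int W H t \<omega> = (\<Sum>(a, b, h)\<leftarrow>H. h \<omega> * (W (min b t) \<omega> - W (min a t) \<omega>))"

text \<open>
  \<open>I\<close> is a version of the Ito integral \<open>\<integral>_0^t K_s dW_s\<close> under the probability measure \<open>Q\<close>:
  \<open>K\<close> is progressively measurable on \<open>[0,t]\<close>, and some simple integrands converge to \<open>K\<close> in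
  \<open>L^2(ds \<otimes> Q)\<close> while their elementary integrals converge to \<open>I\<close> in \<open>L^2(Q)\<close>.
\<close>

definition has_ito_integral ::
  "'a measure \<Rightarrow> (real \<Rightarrow> 'a measure) \<Rightarrow> (real \<Rightarrow> 'a \<Rightarrow> real) \<Rightarrow> (real \<Rightarrow> 'a \<Rightarrow> real) \<Rightarrow> real
    \<Rightarrow> ('a \<Rightarrow> real) \<Rightarrow> bool" where
  "has_ito_integral Q F W K t I \<longleftrightarrow>
     (\<lambda>(s, \<omega>). K s \<omega>) \<in> borel_measurable (restrict_space borel {0..t} \<Otimes>\<^sub>M F t) \<and>
     I \<in> borel_measurable Q \<and>
     (\<exists>H. (\<forall>k::nat. simple_integrand F (H k)) \<and>
        (\<lambda>k. \<integral>\<^sup>+\<omega>. (\<integral>\<^sup>+s\<in>{0..t}. ennreal ((simple_val (H k) s \<omega> - K s \<omega>)\<^sup>2) \<partial>lborel) \<partial>Q)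
          \<longlonglongrightarrow> 0 \<and>
        (\<lambda>k. \<integral>\<^sup>+\<omega>. ennreal ((simple_int W (H k) t \<omega> - I \<omega>)\<^sup>2) \<partial>Q) \<longlonglongrightarrow> 0)"


section \<open>Brownian motion and its local time at 0\<close>

text \<open>
  \<open>M\<close> only provides the measurable space \<open>(\<Omega>, \<A>)\<close>. Time is \<open>[0,\<infinity>)\<close>, embedded in \<open>real\<close>; nothing
  is assumed at negative times. Completeness is relative to the whole family: sets that are
  negligible under every \<open>P x\<close> belong to \<open>F 0\<close>. (Requiring this for each single \<open>P x\<close> would
  be inconsistent, as the laws \<open>P x\<close> are mutually singular on \<open>F 0\<close>.)
\<close>

locale brownian_family =
  fixes M :: "'a measure" and P :: "real \<Rightarrow> 'a measure" and F :: "real \<Rightarrow> 'a measure"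
    and B :: "real \<Rightarrow> 'a \<Rightarrow> real" and \<theta> :: "real \<Rightarrow> 'a \<Rightarrow> 'a"
  assumes prob_space_P: "\<And>x. prob_space (P x)"
    and sets_P: "\<And>x. sets (P x) = sets M"
    and subalgebra_F: "\<And>t. 0 \<le> t \<Longrightarrow> subalgebra M (F t)"
    and F_mono: "\<And>s t. 0 \<le> s \<Longrightarrow> s \<le> t \<Longrightarrow> sets (F s) \<subseteq> sets (F t)"
    and F_right_continuous: "\<And>t. 0 \<le> t \<Longrightarrow> sets (F t) = (\<Inter>u\<in>{t<..}. sets (F u))"
    and F_complete: "\<And>N. (\<And>x. N \<in> null_sets (completion (P x))) \<Longrightarrow> N \<in> sets (F 0)"
    and B_adapted: "\<And>t. 0 \<le> t \<Longrightarrow> B t \<in> borel_measurable (F t)"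
    and B_continuous: "\<And>\<omega>. \<omega> \<in> space M \<Longrightarrow> continuous_on {0..} (\<lambda>t. B t \<omega>)"
    and B_start: "\<And>x. measure (P x) {\<omega> \<in> space (P x). B 0 \<omega> = x} = 1"
    and B_indep: "\<And>x s t. 0 \<le> s \<Longrightarrow> s < t \<Longrightarrow>
          prob_space.indep_set (P x) (sets (F s))
            (sets (vimage_algebra (space M) (\<lambda>\<omega>. B t \<omega> - B s \<omega>) borel))"
    and B_normal: "\<And>x s t. 0 \<le> s \<Longrightarrow> s < t \<Longrightarrow>
          distributed (P x) lborel (\<lambda>\<omega>. B t \<omega> - B s \<omega>) (normal_density 0 (sqrt (t - s)))"
    and shift_space: "\<And>t. 0 \<le> t \<Longrightarrow> \<theta> t \<in> space M \<rightarrow> space M"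
    and shift: "\<And>s t \<omega>. 0 \<le> s \<Longrightarrow> 0 \<le> t \<Longrightarrow> \<omega> \<in> space M \<Longrightarrow> B s (\<theta> t \<omega>) = B (s + t) \<omega>"

text \<open>
  The local time is the process defined by Tanaka's formula
  \<open>|B_t| = |B_0| + \<integral>_0^t sign(B_s) dB_s + L_t\<close>, \<open>P x\<close>-almost surely for every \<open>x\<close>. The convention
  \<open>sgn 0 = 0\<close> is immaterial, since \<open>{s. B_s = 0}\<close> is almost surely a Lebesgue null set.
\<close>

locale brownian_local_time = brownian_family +
  fixes L :: "real \<Rightarrow> 'a \<Rightarrow> real"
  assumes L_adapted: "\<And>t. 0 \<le> t \<Longrightarrow> L t \<in> borel_measurable (F t)"
    and L_continuous: "\<And>\<omega>. \<omega> \<in> space M \<Longrightarrow> continuous_on {0..} (\<lambda>t. L t \<omega>)"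
    and L_mono: "\<And>\<omega>. \<omega> \<in> space M \<Longrightarrow> mono_on {0..} (\<lambda>t. L t \<omega>)"
    and L_zero: "\<And>\<omega>. \<omega> \<in> space M \<Longrightarrow> L 0 \<omega> = 0"
    and tanaka: "\<And>x t. 0 \<le> t \<Longrightarrow>
          has_ito_integral (P x) F B (\<lambda>s \<omega>. sgn (B s \<omega>)) t (\<lambda>\<omega>. \<bar>B t \<omega>\<bar> - \<bar>B 0 \<omega>\<bar> - L t \<omega>)"


section \<open>The general Brownian motion on the half line\<close>

definition clock :: "real \<Rightarrow> (real \<Rightarrow> 'a \<Rightarrow> real) \<Rightarrow> 'a \<Rightarrow> real \<Rightarrow> real" where
  "clock \<gamma> L \<omega> t = t + \<gamma> * L t \<omega>"

definition time_change :: "real \<Rightarrow> (real \<Rightarrow> 'a \<Rightarrow> real) \<Rightarrow> 'a \<Rightarrow> real \<Rightarrow> real" where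
  "time_change \<gamma> L \<omega> = the_inv_into {0..} (clock \<gamma> L \<omega>)"

lemma (in brownian_local_time) bij_betw_clock:
  assumes \<gamma>: "0 < \<gamma>" and \<omega>: "\<omega> \<in> space M"
  shows "bij_betw (clock \<gamma> L \<omega>) {0..} {0..}"
proof (rule bij_betw_imageI)
  have mono: "L s \<omega> \<le> L t \<omega>" if "0 \<le> s" "s \<le> t" for s t
    using L_mono[OF \<omega>] that by (auto simp: mono_on_def)
  have less: "clock \<gamma> L \<omega> s < clock \<gamma> L \<omega> t" if "0 \<le> s" "s < t" for s t
    using mult_left_mono[OF mono[of s t], of \<gamma>] that \<gamma>
    by (auto simp: clock_def intro: add_less_le_mono)
  have ge: "t \<le> clock \<gamma> L \<omega> t" if "0 \<le> t" for t
    using mono[of 0 t] L_zero[OF \<omega>] that \<gamma> by (simp add: clock_def)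
  show "inj_on (clock \<gamma> L \<omega>) {0..}"
    by (rule linorder_inj_onI') (use less in force)
  show "clock \<gamma> L \<omega> ` {0..} = {0..}"
  proof (intro equalityI subsetI)
    fix y :: real assume "y \<in> {0..}"
    then have y: "0 \<le> y" by simp
    have "continuous_on {0..} (clock \<gamma> L \<omega>)"
      unfolding clock_def by (intro continuous_intros L_continuous \<omega>)
    then have "continuous_on {0..y} (clock \<gamma> L \<omega>)"
      by (rule continuous_on_subset) auto
    moreover have "clock \<gamma> L \<omega> 0 \<le> y"
      using y L_zero[OF \<omega>] by (simp add: clock_def)
    ultimately show "y \<in> clock \<gamma> L \<omega> ` {0..}"
      using IVT'[of "clock \<gamma> L \<omega>" 0 y y] ge[OF y] y by force
  qed (use ge in \<open>force\<close>)
qed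

definition Bs :: "real \<Rightarrow> (real \<Rightarrow> 'a \<Rightarrow> real) \<Rightarrow> (real \<Rightarrow> 'a \<Rightarrow> real) \<Rightarrow> real \<Rightarrow> 'a \<Rightarrow> real" where
  "Bs \<gamma> B L t \<omega> = \<bar>B (time_change \<gamma> L \<omega> t) \<omega>\<bar>"

definition Ls :: "real \<Rightarrow> (real \<Rightarrow> 'a \<Rightarrow> real) \<Rightarrow> real \<Rightarrow> 'a \<Rightarrow> real" where
  "Ls \<gamma> L t \<omega> = L (time_change \<gamma> L \<omega> t) \<omega>"

definition exp_law :: "real \<Rightarrow> real measure" where
  "exp_law \<beta> = restrict_space (density lborel (exponential_density \<beta>)) {0..}"

text \<open>
  Elements of the extended sample space are pairs \<open>(\<omega>, s)\<close>, and the random variable \<open>S\<close> is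
  the second coordinate. The parameter \<open>\<beta>\<close> enters only through the law of \<open>S\<close>. The cemetery
  point is \<open>None\<close>.
\<close>

definition lifetime :: "real \<Rightarrow> (real \<Rightarrow> 'a \<Rightarrow> real) \<Rightarrow> 'a \<times> real \<Rightarrow> ereal" where
  "lifetime \<gamma> L = (\<lambda>(\<omega>, s). Inf {ereal t |t. 0 \<le> t \<and> Ls \<gamma> L t \<omega> > s})"

definition Bg :: "real \<Rightarrow> (real \<Rightarrow> 'a \<Rightarrow> real) \<Rightarrow> (real \<Rightarrow> 'a \<Rightarrow> real) \<Rightarrow> real \<Rightarrow> 'a \<times> real
    \<Rightarrow> real option" where
  "Bg \<gamma> B L t = (\<lambda>(\<omega>, s). if ereal t < lifetime \<gamma> L (\<omega>, s) then Some (Bs \<gamma> B L t \<omega>) else None)"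

definition ext_cemetery :: "(real \<Rightarrow> real) \<Rightarrow> real option \<Rightarrow> real" where
  "ext_cemetery f = case_option 0 f"

definition Rg :: "(real \<Rightarrow> 'a measure) \<Rightarrow> (real \<Rightarrow> 'a \<Rightarrow> real) \<Rightarrow> (real \<Rightarrow> 'a \<Rightarrow> real) \<Rightarrow> real \<Rightarrow> real
    \<Rightarrow> real \<Rightarrow> (real \<Rightarrow> real) \<Rightarrow> real \<Rightarrow> real" where
  "Rg P B L \<beta> \<gamma> l f x =
     (\<integral>w. (LBINT t:{0..}. exp (- l * t) * ext_cemetery f (Bg \<gamma> B L t w)) \<partial>(P x \<Otimes>\<^sub>M exp_law \<beta>))"


section \<open>Resolvent kernels\<close>

text \<open>Functions on the half line are represented by functions on \<open>real\<close>, whose values at negative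
  arguments play no role.\<close>

definition C0_half :: "(real \<Rightarrow> real) set" where
  "C0_half = {f. continuous_on {0..} f \<and> (f \<longlongrightarrow> 0) at_top}"

definition rho :: "real \<Rightarrow> real \<Rightarrow> real \<Rightarrow> real" where
  "rho \<beta> \<gamma> l = inverse (\<beta> + sqrt (2 * l) + \<gamma> * l)"

definition e_fun :: "real \<Rightarrow> real \<Rightarrow> real" where
  "e_fun l x = exp (- sqrt (2 * l) * x)"

definition pairing :: "(real \<Rightarrow> real) \<Rightarrow> (real \<Rightarrow> real) \<Rightarrow> real" where
  "pairing g f = (LBINT y:{0..}. g y * f y)"

definition rD :: "real \<Rightarrow> real \<Rightarrow> real \<Rightarrow> real" where
  "rD l x y = 1 / sqrt (2 * l) * (exp (- sqrt (2 * l) * \<bar>x - y\<bar>) - exp (- sqrt (2 * l) * (x + y)))"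

definition RD :: "real \<Rightarrow> (real \<Rightarrow> real) \<Rightarrow> real \<Rightarrow> real" where
  "RD l f x = (LBINT y:{0..}. rD l x y * f y)"

definition add_measure :: "'b measure \<Rightarrow> 'b measure \<Rightarrow> 'b measure" where
  "add_measure M N = measure_of (space M) (sets M) (\<lambda>A. emeasure M A + emeasure N A)"

lemma space_add_measure [simp]: "space (add_measure M N) = space M"
  and sets_add_measure [simp, measurable_cong]: "sets (add_measure M N) = sets M"
  by (simp_all add: add_measure_def)

lemma emeasure_add_measure:
  assumes N: "sets N = sets M" and A: "A \<in> sets M"
  shows "emeasure (add_measure M N) A = emeasure M A + emeasure N A"
proof (rule emeasure_measure_of_sigma[OF sets.sigma_algebra_axioms _ _ A,
      of "\<lambda>A. emeasure M A + emeasure N A", folded add_measure_def])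
  show "positive (sets M) (\<lambda>A. emeasure M A + emeasure N A)"
    by (simp add: positive_def)
  show "countably_additive (sets M) (\<lambda>A. emeasure M A + emeasure N A)"
    unfolding countably_additive_def
    by (auto simp: suminf_add[symmetric] suminf_emeasure N image_subset_iff)
qed

definition rg_kernel :: "real \<Rightarrow> real \<Rightarrow> real \<Rightarrow> real \<Rightarrow> real measure" where
  "rg_kernel \<beta> \<gamma> l x =
     add_measure
       (add_measure
         (density (restrict_space lborel {0..}) (\<lambda>y. ennreal (rD l x y)))
         (density (restrict_space lborel {0..}) (\<lambda>y. ennreal (2 * rho \<beta> \<gamma> l * e_fun l (x + y)))))
       (scale_measure (ennreal (\<gamma> * rho \<beta> \<gamma> l * e_fun l x)) (return (restrict_space borel {0..}) 0))"

end

theory Submission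
  imports Defs
begin

text \<open>
  Let \<open>k = \<beta> + \<gamma> l\<close> and let \<open>g\<close> be the right-hand side of the resolvent formula. It is the bounded
  solution of \<open>g''/2 = l g - f\<close> on the half line with \<open>g'(0) = k g(0) - \<gamma> f(0)\<close>. By Tanaka's formula
  the process \<open>exp (- l t - k L_t) g(|B_t|)\<close> therefore has drift
  \<open>- exp (- l t - k L_t) f(|B_t|) d(t + \<gamma> L_t)\<close>, because \<open>dL\<close> is carried by the zeros of \<open>B\<close>. Hence
  \<open>g(x)\<close> is the expectation of the integral of \<open>exp (- l t - k L_t) f(|B_t|)\<close> against the clock
  \<open>t + \<gamma> L_t\<close>, and the substitution that inverts the clock turns the weight into
  \<open>exp (- l t - \<beta> L^s_t)\<close>, whose second factor is the probability that \<open>S\<close> exceeds \<open>L^s_t\<close>.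

  No stochastic calculus beyond the isometry is needed: the drift is computed along uniform
  partitions. The stochastic integral in Tanaka's formula has orthogonal increments, the second
  order Taylor terms use that \<open>(|B_t| - |B_s|)^2\<close> and \<open>(B_t - B_s)^2\<close> differ only when \<open>B\<close> changes
  sign, and the same comparison shows that sums of \<open>|B_s| (L_t - L_s)\<close> vanish in the limit.
\<close>

section \<open>Increments of Brownian motion\<close>

text \<open>The hypotheses give Tanaka's formula only at fixed times, as an \<open>L^2\<close> limit
  along some simple integrands. That integrals at two times are consistent, that they are
  martingales, and that \<open>L\<close> grows only on the zeros of \<open>B\<close> all have to be
  derived. Every argument is therefore an expectation against a variable known at the left endpoint
  of a time step, where independence of increments and the isometry are enough. For the discounted
  process this leaves sums of five kinds: \<open>(B t - B s)^2\<close> and \<open>L t - L s\<close>,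
  which stay bounded in mean and carry a small factor, and \<open>(B t - B s)^4\<close>, the gap
  between the squared increments of \<open>B\<close> and of \<open>|B|\<close>, and
  \<open>|B s| * (L t - L s)\<close>, which vanish in mean even with a large factor. The Taylor and
  boundary estimates for \<open>g\<close> are shaped to produce exactly these. The constant
  \<open>rho\<close> comes from the boundary condition: the Dirichlet part has slope
  \<open>2 * (e, f)\<close> at 0, and adding \<open>c * exp (- a * x)\<close> with
  \<open>a = sqrt (2 * l)\<close> requires
  \<open>2 * (e, f) - a * c = k * c - \<gamma> * f 0\<close>, so that
  \<open>rho = 1 / (k + a)\<close>.\<close>

context brownian_family
begin

sublocale prob: prob_space "P x" for x
  by (rule prob_space_P)

lemma space_P: "space (P x) = space M"
  by (rule sets_eq_imp_space_eq[OF sets_P])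

lemma space_F: "0 \<le> t \<Longrightarrow> space (F t) = space M"
  using subalgebra_F by (auto simp: subalgebra_def)

lemma measurable_F_P: "0 \<le> s \<Longrightarrow> Y \<in> borel_measurable (F s) \<Longrightarrow> Y \<in> borel_measurable (P x)"
  using measurable_from_subalg[OF subalgebra_F] measurable_cong_sets[OF sets_P refl] by blast

lemma measurable_F_mono:
  assumes "0 \<le> s" "s \<le> t" "Y \<in> borel_measurable (F s)"
  shows "Y \<in> borel_measurable (F t)"
proof (rule measurable_from_subalg[OF _ assms(3)])
  show "subalgebra (F t) (F s)"
    using assms F_mono[of s t] space_F[of s] space_F[of t] by (simp add: subalgebra_def)
qed

lemma B_measurable_P: "0 \<le> t \<Longrightarrow> B t \<in> borel_measurable (P x)"
  by (rule measurable_F_P[OF _ B_adapted])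

lemma indep_increment:
  assumes st: "0 \<le> s" "s < t" and Y: "Y \<in> borel_measurable (F s)"
  shows "prob.indep_var x borel Y borel (\<lambda>\<omega>. B t \<omega> - B s \<omega>)"
proof -
  have D: "(\<lambda>\<omega>. B t \<omega> - B s \<omega>) \<in> borel_measurable (P x)"
    using st by (intro borel_measurable_diff B_measurable_P) auto
  have ind: "prob.indep_sets x (case_bool (sets (F s))
            (sets (vimage_algebra (space M) (\<lambda>\<omega>. B t \<omega> - B s \<omega>) borel))) UNIV"
    using B_indep[OF st, of x] by (simp add: prob.indep_set_def)
  show ?thesis
    unfolding prob.indep_var_def prob.indep_vars_def2
  proof (intro conjI ballI)
    fix i :: bool
    show "(case i of True \<Rightarrow> Y | False \<Rightarrow> \<lambda>\<omega>. B t \<omega> - B s \<omega>)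
        \<in> measurable (P x) (case i of True \<Rightarrow> borel | False \<Rightarrow> borel)"
      using D measurable_F_P[OF st(1) Y] by (cases i) auto
  next
    show "prob.indep_sets x (\<lambda>i. {(case i of True \<Rightarrow> Y | False \<Rightarrow> \<lambda>\<omega>. B t \<omega> - B s \<omega>) -` A \<inter> space (P x) |A.
        A \<in> sets (case i of True \<Rightarrow> borel | False \<Rightarrow> borel)}) UNIV"
    proof (rule prob.indep_sets_mono_sets[OF ind])
      fix i :: bool
      have "Y -` A \<inter> space M \<in> sets (F s)" if "A \<in> sets borel" for A
        using measurable_sets[OF Y that] space_F[OF st(1)] by simp
      then show "{(case i of True \<Rightarrow> Y | False \<Rightarrow> \<lambda>\<omega>. B t \<omega> - B s \<omega>) -` A \<inter> space (P x) |A.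
          A \<in> sets (case i of True \<Rightarrow> borel | False \<Rightarrow> borel)}
        \<subseteq> (case i of True \<Rightarrow> sets (F s)
             | False \<Rightarrow> sets (vimage_algebra (space M) (\<lambda>\<omega>. B t \<omega> - B s \<omega>) borel))"
        by (cases i) (auto simp: space_P sets_vimage_algebra2)
    qed
  qed
qed

text \<open>Gaussian moments of variance \<open>t - s\<close>. The case \<open>s = t\<close> is
  split off because the assumed density only describes increments over intervals of positive
  length.\<close>

lemma increment_power:
  assumes "0 \<le> s" "s \<le> t"
  shows integrable_increment_power: "integrable (P x) (\<lambda>\<omega>. (B t \<omega> - B s \<omega>) ^ n)"
    and integral_increment_even:
      "(\<integral>\<omega>. (B t \<omega> - B s \<omega>) ^ (2 * k) \<partial>P x) = fact (2 * k) / (2 ^ k * fact k) * (t - s) ^ k"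
    and integral_increment_odd: "(\<integral>\<omega>. (B t \<omega> - B s \<omega>) ^ (2 * k + 1) \<partial>P x) = 0"
proof -
  consider "s = t" | "s < t" using assms by linarith
  then have "integrable (P x) (\<lambda>\<omega>. (B t \<omega> - B s \<omega>) ^ n) \<and>
    (\<integral>\<omega>. (B t \<omega> - B s \<omega>) ^ (2 * k) \<partial>P x) = fact (2 * k) / (2 ^ k * fact k) * (t - s) ^ k \<and>
    (\<integral>\<omega>. (B t \<omega> - B s \<omega>) ^ (2 * k + 1) \<partial>P x) = 0"
  proof cases
    case 1
    then show ?thesis by (cases k) (auto simp: power_0_left prob.prob_space)
  next
    case 2
    note D = B_normal[OF assms(1) 2, of x]
    let ?\<phi> = "normal_density 0 (sqrt (t - s))"
    have 1: "integrable (P x) (\<lambda>\<omega>. (B t \<omega> - B s \<omega>) ^ n)"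
      using distributed_integrable[OF D, of "\<lambda>y. y ^ n"] integrable_normal_moment[where \<mu> = 0 and \<sigma> = "sqrt (t - s)" and k = n] 2
      by simp
    have eq: "(\<integral>\<omega>. (B t \<omega> - B s \<omega>) ^ m \<partial>P x) = (\<integral>y. ?\<phi> y * (y - 0) ^ m \<partial>lborel)" for m
      using distributed_integral[OF D, of "\<lambda>y. y ^ m"] by (simp add: normal_density_nonneg)
    show ?thesis
      unfolding eq using 1 2 integral_normal_moment_even[of "sqrt (t - s)" 0 k]
        integral_normal_moment_odd[of "sqrt (t - s)" 0 k]
      by (simp add: field_simps power_divide)
  qed
  then show "integrable (P x) (\<lambda>\<omega>. (B t \<omega> - B s \<omega>) ^ n)"
    "(\<integral>\<omega>. (B t \<omega> - B s \<omega>) ^ (2 * k) \<partial>P x) = fact (2 * k) / (2 ^ k * fact k) * (t - s) ^ k"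
    "(\<integral>\<omega>. (B t \<omega> - B s \<omega>) ^ (2 * k + 1) \<partial>P x) = 0" by auto
qed

text \<open>Independence lets the expectation factor. For exponents 1 and 2 this takes the place of
  the martingale property and of the conditional variance, without conditional expectations.\<close>

lemma increment_product:
  assumes "0 \<le> s" "s \<le> t" "Y \<in> borel_measurable (F s)" "integrable (P x) Y"
  shows integrable_mult_increment: "integrable (P x) (\<lambda>\<omega>. Y \<omega> * (B t \<omega> - B s \<omega>) ^ n)"
    and integral_mult_increment:
      "(\<integral>\<omega>. Y \<omega> * (B t \<omega> - B s \<omega>) ^ n \<partial>P x) = (\<integral>\<omega>. Y \<omega> \<partial>P x) * (\<integral>\<omega>. (B t \<omega> - B s \<omega>) ^ n \<partial>P x)"
proof -
  consider "s = t" | "s < t" using assms by linarith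
  then have "integrable (P x) (\<lambda>\<omega>. Y \<omega> * (B t \<omega> - B s \<omega>) ^ n) \<and>
    (\<integral>\<omega>. Y \<omega> * (B t \<omega> - B s \<omega>) ^ n \<partial>P x) = (\<integral>\<omega>. Y \<omega> \<partial>P x) * (\<integral>\<omega>. (B t \<omega> - B s \<omega>) ^ n \<partial>P x)"
  proof cases
    case 1
    then show ?thesis using assms(4) by (cases n) (auto simp: prob.prob_space)
  next
    case 2
    have "prob.indep_var x borel (id \<circ> Y) borel ((\<lambda>y. y ^ n) \<circ> (\<lambda>\<omega>. B t \<omega> - B s \<omega>))"
      by (rule prob.indep_var_compose[OF indep_increment[OF assms(1) 2 assms(3)]]) auto
    then have i: "prob.indep_var x borel Y borel (\<lambda>\<omega>. (B t \<omega> - B s \<omega>) ^ n)"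
      by (simp add: comp_def)
    show ?thesis
      using prob.indep_var_integrable[OF i assms(4) integrable_increment_power[OF assms(1,2)]]
        prob.indep_var_lebesgue_integral[OF i assms(4) integrable_increment_power[OF assms(1,2)]]
      by simp
  qed
  then show "integrable (P x) (\<lambda>\<omega>. Y \<omega> * (B t \<omega> - B s \<omega>) ^ n)"
    "(\<integral>\<omega>. Y \<omega> * (B t \<omega> - B s \<omega>) ^ n \<partial>P x) = (\<integral>\<omega>. Y \<omega> \<partial>P x) * (\<integral>\<omega>. (B t \<omega> - B s \<omega>) ^ n \<partial>P x)"
    by auto
qed

lemma integral_increment_2:
  "0 \<le> s \<Longrightarrow> s \<le> t \<Longrightarrow> (\<integral>\<omega>. (B t \<omega> - B s \<omega>)\<^sup>2 \<partial>P x) = t - s"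
  using integral_increment_even[of s t x 1] by simp

lemma integral_increment_4:
  "0 \<le> s \<Longrightarrow> s \<le> t \<Longrightarrow> (\<integral>\<omega>. (B t \<omega> - B s \<omega>) ^ 4 \<partial>P x) = 3 * (t - s)\<^sup>2"
  using integral_increment_even[of s t x 2] by (simp add: fact_numeral)

lemma integral_mult_increment_1:
  assumes "0 \<le> s" "s \<le> t" "Y \<in> borel_measurable (F s)" "integrable (P x) Y"
  shows "integrable (P x) (\<lambda>\<omega>. Y \<omega> * (B t \<omega> - B s \<omega>))"
    and "(\<integral>\<omega>. Y \<omega> * (B t \<omega> - B s \<omega>) \<partial>P x) = 0"
  using integrable_mult_increment[OF assms, of 1] integral_mult_increment[OF assms, of 1]
    integral_increment_odd[OF assms(1,2), of x 0] by auto

lemma integral_mult_increment_2: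
  assumes "0 \<le> s" "s \<le> t" "Y \<in> borel_measurable (F s)" "integrable (P x) Y"
  shows "integrable (P x) (\<lambda>\<omega>. Y \<omega> * (B t \<omega> - B s \<omega>)\<^sup>2)"
    and "(\<integral>\<omega>. Y \<omega> * (B t \<omega> - B s \<omega>)\<^sup>2 \<partial>P x) = (\<integral>\<omega>. Y \<omega> \<partial>P x) * (t - s)"
  using integrable_mult_increment[OF assms, of 2] integral_mult_increment[OF assms, of 2]
    integral_increment_2[OF assms(1,2), of x] by auto

lemma B_start_AE: "AE \<omega> in P x. B 0 \<omega> = x"
  using prob.AE_prob_1[OF B_start[of x]] by simp

lemma integrable_B_square:
  assumes "0 \<le> t"
  shows "integrable (P x) (\<lambda>\<omega>. (B t \<omega>)\<^sup>2)"
proof -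
  have "integrable (P x) (\<lambda>\<omega>. (B t \<omega> - B 0 \<omega>)\<^sup>2 + 2 * x * (B t \<omega> - B 0 \<omega>) + x\<^sup>2)"
    using integrable_increment_power[OF _ assms, of x 2] integrable_increment_power[OF _ assms, of x 1]
    by (intro Bochner_Integration.integrable_add integrable_mult_right) auto
  moreover have "AE \<omega> in P x. (B t \<omega> - B 0 \<omega>)\<^sup>2 + 2 * x * (B t \<omega> - B 0 \<omega>) + x\<^sup>2 = (B t \<omega>)\<^sup>2"
    using B_start_AE by eventually_elim (simp add: power2_eq_square algebra_simps)
  moreover have [measurable]: "B t \<in> borel_measurable (P x)" "B 0 \<in> borel_measurable (P x)"
    using assms by (auto intro: B_measurable_P)
  ultimately show ?thesis
    by (subst (asm) integrable_cong_AE) auto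
qed

lemma integrable_abs_B:
  assumes "0 \<le> t" shows "integrable (P x) (\<lambda>\<omega>. \<bar>B t \<omega>\<bar>)"
proof -
  have "integrable (P x) (\<lambda>\<omega>. (B t \<omega>)\<^sup>2 + 1)"
    using integrable_B_square[OF assms] by simp
  then show ?thesis
  proof (rule Bochner_Integration.integrable_bound)
    show "(\<lambda>\<omega>. \<bar>B t \<omega>\<bar>) \<in> borel_measurable (P x)"
      using B_measurable_P[OF assms] by simp
    have "\<bar>y\<bar> \<le> y\<^sup>2 + 1" for y :: real
      using sum_power2_ge_zero[of "\<bar>y\<bar> - 1" 0] by (simp add: power2_eq_square algebra_simps)
    then show "AE \<omega> in P x. norm \<bar>B t \<omega>\<bar> \<le> norm ((B t \<omega>)\<^sup>2 + 1)" by auto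
  qed
qed

text \<open>Under \<open>P x\<close> the density of \<open>B t - x\<close> is at most
  \<open>1 / sqrt (2 * pi * t)\<close>, hence at most \<open>1 / (2 * sqrt t)\<close>, and the
  interval has length \<open>2 * r\<close>. The bound is uniform in the starting point and
  integrable in \<open>t\<close> at 0, which is what the sums over partitions rely on.\<close>

lemma small_ball:
  assumes t: "0 < t" and r: "0 \<le> r"
  shows "(\<integral>\<omega>. indicator {-r..r} (B t \<omega>) \<partial>P x) \<le> r / sqrt t"
proof -
  note D = B_normal[OF order_refl t, of x]
  let ?A = "{-r - x..r - x}"
  let ?\<phi> = "normal_density 0 (sqrt (t - 0))"
  have [measurable]: "B t \<in> borel_measurable (P x)" "B 0 \<in> borel_measurable (P x)"
    using t by (auto intro: B_measurable_P)
  have "(\<integral>\<omega>. indicator {-r..r} (B t \<omega>) \<partial>P x) = (\<integral>\<omega>. indicat_real ?A (B t \<omega> - B 0 \<omega>) \<partial>P x)"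
    by (intro integral_cong_AE) (use B_start_AE[of x] in \<open>auto simp: indicator_def elim!: eventually_mono\<close>)
  also have "\<dots> = (\<integral>y. ?\<phi> y * indicator ?A y \<partial>lborel)"
    using distributed_integral[OF D, of "indicator ?A"] by (simp add: normal_density_nonneg)
  also have "\<dots> \<le> (\<integral>y. 1 / (2 * sqrt t) * indicator ?A y \<partial>lborel)"
  proof (rule integral_mono)
    show "integrable lborel (\<lambda>y. ?\<phi> y * indicator ?A y)"
      using integrable_mult_indicator[of ?A lborel ?\<phi>] t by (simp add: mult.commute)
    show "integrable lborel (\<lambda>y. 1 / (2 * sqrt t) * indicator ?A y)"
      using r by (intro integrable_mult_right integrable_real_indicator) auto
    fix y :: real
    have "2 * sqrt t \<le> sqrt (2 * pi * t)"
      using t pi_gt3 by (intro real_le_rsqrt) (auto simp: power_mult_distrib)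
    then have "?\<phi> y \<le> 1 / (2 * sqrt t)"
      using t frac_le[of 1 1 "2 * sqrt t" "sqrt (2 * pi * t)"]
        mult_mono[of "1 / sqrt (2 * pi * t)" "1 / (2 * sqrt t)" "exp (- y\<^sup>2 / (2 * t))" 1]
      by (auto simp: normal_density_def)
    then show "?\<phi> y * indicator ?A y \<le> 1 / (2 * sqrt t) * indicator ?A y"
      by (auto simp: indicator_def)
  qed
  also have "\<dots> = r / sqrt t"
    using r t by (simp add: field_simps)
  finally show ?thesis .
qed

end

section \<open>The Ito isometry and orthogonality of Ito integrals\<close>

lemma square_add_le: "(a + b)\<^sup>2 \<le> 2 * a\<^sup>2 + 2 * (b::real)\<^sup>2"
  using sum_squares_ge_zero[of "a - b" 0] by (simp add: power2_eq_square algebra_simps)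

text \<open>A weighted arithmetic-geometric inequality, used instead of Cauchy-Schwarz: for a fixed
  weight the error term \<open>z\<close> can be sent to 0 in \<open>L^2\<close> first, and the
  weight afterwards.\<close>

lemma abs_mult_le_squares:
  assumes "0 < \<epsilon>"
  shows "\<bar>w * z\<bar> \<le> \<epsilon> * w\<^sup>2 + z\<^sup>2 / (\<epsilon>::real)"
proof -
  have "0 \<le> (\<epsilon> * \<bar>w\<bar> - \<bar>z\<bar>)\<^sup>2 / \<epsilon>"
    using assms by simp
  also have "\<dots> = \<epsilon> * w\<^sup>2 + z\<^sup>2 / \<epsilon> - 2 * \<bar>w * z\<bar>"
    using assms by (simp add: power2_diff power_mult_distrib abs_mult field_simps power2_eq_square)
  finally show ?thesis by linarith
qed

lemma integrable_mult_squares: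
  fixes w z :: "'a \<Rightarrow> real"
  assumes [measurable]: "w \<in> borel_measurable M" "z \<in> borel_measurable M"
    and w: "integrable M (\<lambda>\<omega>. (w \<omega>)\<^sup>2)" and z: "integrable M (\<lambda>\<omega>. (z \<omega>)\<^sup>2)"
  shows "integrable M (\<lambda>\<omega>. w \<omega> * z \<omega>)"
    and "0 < \<epsilon> \<Longrightarrow> \<bar>\<integral>\<omega>. w \<omega> * z \<omega> \<partial>M\<bar> \<le> \<epsilon> * (\<integral>\<omega>. (w \<omega>)\<^sup>2 \<partial>M) + (\<integral>\<omega>. (z \<omega>)\<^sup>2 \<partial>M) / \<epsilon>"
proof -
  have le: "\<bar>w \<omega> * z \<omega>\<bar> \<le> \<epsilon> * (w \<omega>)\<^sup>2 + (z \<omega>)\<^sup>2 / \<epsilon>" if "0 < \<epsilon>" for \<omega> \<epsilon>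
    using abs_mult_le_squares[OF that] by simp
  show int: "integrable M (\<lambda>\<omega>. w \<omega> * z \<omega>)"
  proof (rule Bochner_Integration.integrable_bound)
    show "integrable M (\<lambda>\<omega>. (w \<omega>)\<^sup>2 + (z \<omega>)\<^sup>2)" using w z by simp
    show "AE \<omega> in M. norm (w \<omega> * z \<omega>) \<le> norm ((w \<omega>)\<^sup>2 + (z \<omega>)\<^sup>2)"
      using le[of 1] by (auto simp del: abs_mult)
  qed simp
  assume \<epsilon>: "0 < \<epsilon>"
  have "\<bar>\<integral>\<omega>. w \<omega> * z \<omega> \<partial>M\<bar> \<le> (\<integral>\<omega>. \<bar>w \<omega> * z \<omega>\<bar> \<partial>M)"
    by (rule integral_abs_bound)
  also have "\<dots> \<le> (\<integral>\<omega>. \<epsilon> * (w \<omega>)\<^sup>2 + (z \<omega>)\<^sup>2 / \<epsilon> \<partial>M)"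
    using int w z le[OF \<epsilon>] by (intro integral_mono) auto
  also have "\<dots> = \<epsilon> * (\<integral>\<omega>. (w \<omega>)\<^sup>2 \<partial>M) + (\<integral>\<omega>. (z \<omega>)\<^sup>2 \<partial>M) / \<epsilon>"
    using w z by simp
  finally show "\<bar>\<integral>\<omega>. w \<omega> * z \<omega> \<partial>M\<bar> \<le> \<epsilon> * (\<integral>\<omega>. (w \<omega>)\<^sup>2 \<partial>M) + (\<integral>\<omega>. (z \<omega>)\<^sup>2 \<partial>M) / \<epsilon>" .
qed

lemma integrable_square_add:
  fixes w z :: "'a \<Rightarrow> real"
  assumes "w \<in> borel_measurable M" "z \<in> borel_measurable M"
    and "integrable M (\<lambda>\<omega>. (w \<omega>)\<^sup>2)" and "integrable M (\<lambda>\<omega>. (z \<omega>)\<^sup>2)"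
  shows "integrable M (\<lambda>\<omega>. (w \<omega> + z \<omega>)\<^sup>2)" "integrable M (\<lambda>\<omega>. (w \<omega> - z \<omega>)\<^sup>2)"
  using integrable_mult_squares(1)[OF assms] assms(3,4)
  by (simp_all add: power2_sum power2_diff mult.assoc)

lemma integral_double_sum:
  fixes f :: "'i \<Rightarrow> 'j \<Rightarrow> 'a \<Rightarrow> real"
  assumes "\<And>i j. i \<in> I \<Longrightarrow> j \<in> J \<Longrightarrow> integrable N (f i j)"
  shows "integrable N (\<lambda>\<omega>. \<Sum>i\<in>I. \<Sum>j\<in>J. f i j \<omega>)"
    and "(\<integral>\<omega>. (\<Sum>i\<in>I. \<Sum>j\<in>J. f i j \<omega>) \<partial>N) = (\<Sum>i\<in>I. \<Sum>j\<in>J. \<integral>\<omega>. f i j \<omega> \<partial>N)"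
proof -
  have "integrable N (\<lambda>\<omega>. \<Sum>j\<in>J. f i j \<omega>)" "(\<integral>\<omega>. (\<Sum>j\<in>J. f i j \<omega>) \<partial>N) = (\<Sum>j\<in>J. \<integral>\<omega>. f i j \<omega> \<partial>N)"
    if "i \<in> I" for i
    using assms[OF that] by (auto intro!: Bochner_Integration.integrable_sum Bochner_Integration.integral_sum)
  then show "integrable N (\<lambda>\<omega>. \<Sum>i\<in>I. \<Sum>j\<in>J. f i j \<omega>)"
    "(\<integral>\<omega>. (\<Sum>i\<in>I. \<Sum>j\<in>J. f i j \<omega>) \<partial>N) = (\<Sum>i\<in>I. \<Sum>j\<in>J. \<integral>\<omega>. f i j \<omega> \<partial>N)"
    by (simp_all add: Bochner_Integration.integral_sum cong: sum.cong)
qed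

section \<open>Simple integrands and their isometry\<close>

lemma simple_val_sum:
  "simple_val H s \<omega> = (\<Sum>i<length H. snd (snd (H ! i)) \<omega> * indicator {fst (H ! i)<..fst (snd (H ! i))} s)"
  by (simp add: simple_val_def sum_list_sum_nth lessThan_atLeast0 case_prod_beta)

lemma simple_int_sum:
  "simple_int W H t \<omega> =
    (\<Sum>i<length H. snd (snd (H ! i)) \<omega> * (W (min (fst (snd (H ! i))) t) \<omega> - W (min (fst (H ! i)) t) \<omega>))"
  by (simp add: simple_int_def sum_list_sum_nth lessThan_atLeast0 case_prod_beta)

text \<open>Since the intervals of a \<open>simple_proc\<close> may overlap, concatenation is
  addition, and a difference involves no common refinement of two partitions.\<close>

definition simple_diff :: "'a simple_proc \<Rightarrow> 'a simple_proc \<Rightarrow> 'a simple_proc" where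
  "simple_diff H H' = H @ map (\<lambda>(a, b, h). (a, b, \<lambda>\<omega>. - h \<omega>)) H'"

lemma simple_val_diff: "simple_val (simple_diff H H') s \<omega> = simple_val H s \<omega> - simple_val H' s \<omega>"
proof -
  have "simple_val (map (\<lambda>(a, b, h). (a, b, \<lambda>\<omega>. - h \<omega>)) H') s \<omega> = - simple_val H' s \<omega>"
    by (induction H') (auto simp: simple_val_def)
  then show ?thesis by (simp add: simple_val_def simple_diff_def)
qed

lemma simple_int_diff: "simple_int W (simple_diff H H') t \<omega> = simple_int W H t \<omega> - simple_int W H' t \<omega>"
proof -
  have "simple_int W (map (\<lambda>(a, b, h). (a, b, \<lambda>\<omega>. - h \<omega>)) H') t \<omega> = - simple_int W H' t \<omega>"
    by (induction H') (auto simp: simple_int_def algebra_simps)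
  then show ?thesis by (simp add: simple_int_def simple_diff_def)
qed

lemma simple_integrand_diff:
  assumes "simple_integrand F H" "simple_integrand F H'"
  shows "simple_integrand F (simple_diff H H')"
  using assms by (fastforce simp: simple_integrand_def simple_diff_def)

lemma simple_integrand_nth:
  assumes "simple_integrand F H" "i < length H"
  shows "0 \<le> fst (H ! i)" "fst (H ! i) \<le> fst (snd (H ! i))"
    "snd (snd (H ! i)) \<in> borel_measurable (F (fst (H ! i)))"
    "\<exists>C. \<forall>\<omega>\<in>space (F (fst (H ! i))). \<bar>snd (snd (H ! i)) \<omega>\<bar> \<le> C"
  using assms nth_mem[OF assms(2)] unfolding simple_integrand_def by (auto simp: case_prod_beta)

context brownian_family
begin

lemma integrable_bounded_mult:
  assumes "h \<in> borel_measurable (P x)" "\<And>\<omega>. \<omega> \<in> space M \<Longrightarrow> \<bar>h \<omega>\<bar> \<le> C" "integrable (P x) Y"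
  shows "integrable (P x) (\<lambda>\<omega>. h \<omega> * Y \<omega> :: real)"
proof (rule Bochner_Integration.integrable_bound)
  show "integrable (P x) (\<lambda>\<omega>. C * Y \<omega>)" using assms by simp
  have "\<bar>h \<omega>\<bar> * \<bar>Y \<omega>\<bar> \<le> \<bar>C\<bar> * \<bar>Y \<omega>\<bar>" if "\<omega> \<in> space M" for \<omega>
    using assms(2)[OF that] by (intro mult_right_mono) auto
  then show "AE \<omega> in P x. norm (h \<omega> * Y \<omega>) \<le> norm (C * Y \<omega>)"
    by (intro AE_I2) (simp add: space_P abs_mult)
qed (use assms in auto)

lemma integrable_bounded:
  assumes "h \<in> borel_measurable (P x)" "\<And>\<omega>. \<omega> \<in> space M \<Longrightarrow> \<bar>h \<omega>\<bar> \<le> C"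
  shows "integrable (P x) (h :: _ \<Rightarrow> real)"
  using integrable_bounded_mult[OF assms, of "\<lambda>_. 1"] by simp

text \<open>Cutting the first increment at \<open>c\<close> leaves two parts. The one before
  \<open>c\<close> is known at time \<open>c\<close> and thus uncorrelated with the second
  increment; only the common stretch from \<open>c\<close> to \<open>min b d\<close> contributes,
  through its variance.\<close>

lemma isometry_pair_ordered:
  assumes ab: "0 \<le> a" "a \<le> b" "c \<le> d" "a \<le> c"
    and h: "h \<in> borel_measurable (F a)" "\<And>\<omega>. \<omega> \<in> space M \<Longrightarrow> \<bar>h \<omega>\<bar> \<le> C"
    and k: "k \<in> borel_measurable (F c)" "\<And>\<omega>. \<omega> \<in> space M \<Longrightarrow> \<bar>k \<omega>\<bar> \<le> D"
  shows "integrable (P x) (\<lambda>\<omega>. (h \<omega> * (B b \<omega> - B a \<omega>)) * (k \<omega> * (B d \<omega> - B c \<omega>))) \<and>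
    (\<integral>\<omega>. (h \<omega> * (B b \<omega> - B a \<omega>)) * (k \<omega> * (B d \<omega> - B c \<omega>)) \<partial>P x)
      = (\<integral>\<omega>. h \<omega> * k \<omega> \<partial>P x) * max 0 (min b d - c)"
proof -
  have c: "0 \<le> c" using ab by simp
  note hc = measurable_F_mono[OF ab(1,4) h(1)]
  have [measurable]: "h \<in> borel_measurable (P x)" "k \<in> borel_measurable (P x)"
    using measurable_F_P[OF _ h(1)] measurable_F_P[OF _ k(1)] ab by auto
  have hk: "integrable (P x) (\<lambda>\<omega>. h \<omega> * k \<omega>)"
    by (rule integrable_bounded_mult[OF _ h(2) integrable_bounded[OF _ k(2)]]) auto
  have hkF: "(\<lambda>\<omega>. h \<omega> * k \<omega>) \<in> borel_measurable (F c)"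
    using hc k(1) by simp
  \<comment> \<open>the part of the first increment before time \<open>c\<close> is orthogonal to the second increment\<close>
  have past: "integrable (P x) (\<lambda>\<omega>. (h \<omega> * (B e \<omega> - B a \<omega>)) * (k \<omega> * (B d \<omega> - B c \<omega>))) \<and>
    (\<integral>\<omega>. (h \<omega> * (B e \<omega> - B a \<omega>)) * (k \<omega> * (B d \<omega> - B c \<omega>)) \<partial>P x) = 0"
    if e: "a \<le> e" "e \<le> c" for e
  proof -
    let ?Y = "\<lambda>\<omega>. (h \<omega> * k \<omega>) * (B e \<omega> - B a \<omega>) ^ 1"
    have Be: "B e \<in> borel_measurable (F c)" "B a \<in> borel_measurable (F c)"
      using e ab measurable_F_mono[of e c "B e"] measurable_F_mono[of a c "B a"] B_adapted by auto
    have YF: "?Y \<in> borel_measurable (F c)"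
      by (intro borel_measurable_times[OF hkF] borel_measurable_power borel_measurable_diff Be)
    have "integrable (P x) (\<lambda>\<omega>. h \<omega> * (k \<omega> * (B e \<omega> - B a \<omega>) ^ 1))"
      using integrable_increment_power[OF ab(1) e(1), of x 1]
      by (intro integrable_bounded_mult[OF _ h(2)] integrable_bounded_mult[OF _ k(2)]) auto
    then have Yi: "integrable (P x) ?Y" by (simp add: mult.assoc)
    show ?thesis
      using integral_mult_increment_1[OF c ab(3) YF Yi] by (simp add: mult_ac)
  qed
  have future: "integrable (P x) (\<lambda>\<omega>. (h \<omega> * (B b \<omega> - B c \<omega>)) * (k \<omega> * (B d \<omega> - B c \<omega>))) \<and>
    (\<integral>\<omega>. (h \<omega> * (B b \<omega> - B c \<omega>)) * (k \<omega> * (B d \<omega> - B c \<omega>)) \<partial>P x)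
      = (\<integral>\<omega>. h \<omega> * k \<omega> \<partial>P x) * (min b d - c)" if b: "c \<le> b"
  proof -
    \<comment> \<open>Both increments start at \<open>c\<close>. The shorter one ends at
      \<open>m\<close>, and the longer one exceeds it by \<open>B n - B m\<close>, which is
      orthogonal to everything known at time \<open>m\<close>. Naming the endpoints this way treats
      \<open>b \<le> d\<close> and \<open>d \<le> b\<close> together.\<close>
    define m n where mn: "m = min b d" "n = max b d"
    have le: "c \<le> m" "m \<le> n" "0 \<le> m" using b ab mn by auto
    have eq: "(h \<omega> * (B b \<omega> - B c \<omega>)) * (k \<omega> * (B d \<omega> - B c \<omega>)) =
      (h \<omega> * k \<omega>) * (B m \<omega> - B c \<omega>)\<^sup>2 + ((h \<omega> * k \<omega>) * (B m \<omega> - B c \<omega>)) * (B n \<omega> - B m \<omega>)" for \<omega>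
      by (cases "b \<le> d") (auto simp: mn power2_eq_square algebra_simps)
    note i2 = integral_mult_increment_2[OF c le(1) hkF hk]
    note i1 = integral_mult_increment_1(1)[OF c le(1) hkF hk]
    have "(\<lambda>\<omega>. (h \<omega> * k \<omega>) * (B m \<omega> - B c \<omega>)) \<in> borel_measurable (F m)"
      using measurable_F_mono[OF c le(1) hkF] measurable_F_mono[OF c le(1) B_adapted[OF c]]
        B_adapted[OF le(3)] by simp
    note i3 = integral_mult_increment_1[OF le(3,2) this i1]
    show ?thesis unfolding eq using i2 i3 by (simp add: mn)
  qed
  show ?thesis
  proof (cases "b \<le> c")
    case True
    then show ?thesis using past[OF ab(2) True] by (auto simp: max_def)
  next
    case False
    have eq: "(h \<omega> * (B b \<omega> - B a \<omega>)) * (k \<omega> * (B d \<omega> - B c \<omega>)) =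
      (h \<omega> * (B c \<omega> - B a \<omega>)) * (k \<omega> * (B d \<omega> - B c \<omega>)) +
      (h \<omega> * (B b \<omega> - B c \<omega>)) * (k \<omega> * (B d \<omega> - B c \<omega>))" for \<omega>
      by (simp add: algebra_simps)
    show ?thesis
      unfolding eq using past[OF ab(4) order_refl] future False ab by (simp add: max_def)
  qed
qed

lemma isometry_pair:
  assumes ab: "0 \<le> a" "a \<le> b" "0 \<le> c" "c \<le> d" and t: "0 \<le> t"
    and h: "h \<in> borel_measurable (F a)" "\<And>\<omega>. \<omega> \<in> space M \<Longrightarrow> \<bar>h \<omega>\<bar> \<le> C"
    and k: "k \<in> borel_measurable (F c)" "\<And>\<omega>. \<omega> \<in> space M \<Longrightarrow> \<bar>k \<omega>\<bar> \<le> D"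
  shows "integrable (P x) (\<lambda>\<omega>. (h \<omega> * (B (min b t) \<omega> - B (min a t) \<omega>)) * (k \<omega> * (B (min d t) \<omega> - B (min c t) \<omega>))) \<and>
    (\<integral>\<omega>. (h \<omega> * (B (min b t) \<omega> - B (min a t) \<omega>)) * (k \<omega> * (B (min d t) \<omega> - B (min c t) \<omega>)) \<partial>P x)
      = (\<integral>\<omega>. h \<omega> * k \<omega> \<partial>P x) * measure lborel ({a<..b} \<inter> {c<..d} \<inter> {0..t})"
proof (cases "a < t \<and> c < t")
  \<comment> \<open>An interval starting at or after \<open>t\<close> contributes nothing on either
    side: its truncated increment vanishes, and being open on the left it misses
    \<open>{0..t}\<close> even when it starts exactly at \<open>t\<close>.\<close>
  case False
  then have "{a<..b} \<inter> {c<..d} \<inter> {0..t} = {}" by auto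
  moreover have "min b t = min a t \<or> min d t = min c t" using False ab by auto
  ultimately show ?thesis by auto
next
  case True
  have I: "measure lborel ({a<..b} \<inter> {c<..d} \<inter> {0..t}) = max 0 (min (min b t) (min d t) - max a c)"
  proof -
    have "{a<..b} \<inter> {c<..d} \<inter> {0..t} = {max a c<..min (min b t) (min d t)}" using ab by auto
    then show ?thesis by (auto simp: measure_lborel_Ioc max_def)
  qed
  show ?thesis
  proof (cases "a \<le> c")
    case True': True
    have "integrable (P x) (\<lambda>\<omega>. (h \<omega> * (B (min b t) \<omega> - B a \<omega>)) * (k \<omega> * (B (min d t) \<omega> - B c \<omega>))) \<and>
    (\<integral>\<omega>. (h \<omega> * (B (min b t) \<omega> - B a \<omega>)) * (k \<omega> * (B (min d t) \<omega> - B c \<omega>)) \<partial>P x)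
      = (\<integral>\<omega>. h \<omega> * k \<omega> \<partial>P x) * max 0 (min (min b t) (min d t) - c)"
      by (rule isometry_pair_ordered[OF _ _ _ _ h k]) (use True True' ab in auto)
    then show ?thesis using True True' unfolding I by (simp only: max_absorb2 min_absorb1 less_imp_le)
  next
    case False
    have "integrable (P x) (\<lambda>\<omega>. (k \<omega> * (B (min d t) \<omega> - B c \<omega>)) * (h \<omega> * (B (min b t) \<omega> - B a \<omega>))) \<and>
    (\<integral>\<omega>. (k \<omega> * (B (min d t) \<omega> - B c \<omega>)) * (h \<omega> * (B (min b t) \<omega> - B a \<omega>)) \<partial>P x)
      = (\<integral>\<omega>. k \<omega> * h \<omega> \<partial>P x) * max 0 (min (min d t) (min b t) - a)"
      by (rule isometry_pair_ordered[OF _ _ _ _ k h]) (use True False ab in auto)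
    then show ?thesis using True False unfolding I
      by (simp only: max_absorb1 min_absorb1 less_imp_le not_le mult.commute min.commute)
  qed
qed

lemma simple_integrand_bound:
  assumes "simple_integrand F H" "i < length H"
  shows "\<exists>C. \<forall>\<omega>\<in>space M. \<bar>snd (snd (H ! i)) \<omega>\<bar> \<le> C"
  using simple_integrand_nth[OF assms] space_F by auto

lemma simple_integrand_measurable:
  assumes "simple_integrand F H" "i < length H"
  shows "snd (snd (H ! i)) \<in> borel_measurable (P x)"
  using simple_integrand_nth[OF assms] measurable_F_P by auto

lemma simple_int_measurable:
  assumes "simple_integrand F H" "0 \<le> t"
  shows "simple_int B H t \<in> borel_measurable (P x)"
proof -
  have [measurable]: "B (min (fst (snd (H ! i))) t) \<in> borel_measurable (P x)"
    "B (min (fst (H ! i)) t) \<in> borel_measurable (P x)" "snd (snd (H ! i)) \<in> borel_measurable (P x)"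
    if "i < length H" for i
    using assms simple_integrand_nth[OF assms(1) that] simple_integrand_measurable[OF assms(1) that]
    by (auto intro!: B_measurable_P)
  show ?thesis
    unfolding simple_int_sum[abs_def] by (intro borel_measurable_sum borel_measurable_times borel_measurable_diff) auto
qed

text \<open>With overlapping intervals the squares do not reduce to diagonal terms. Both sides are
  expanded into double sums, which agree term by term: each is the mean of \<open>h i * h j\<close>
  times the length of the common part of the two intervals within \<open>{0..t}\<close>.\<close>

lemma isometry:
  assumes H: "simple_integrand F H" and t: "0 \<le> t"
  shows isometry_integrable: "integrable (P x) (\<lambda>\<omega>. (simple_int B H t \<omega>)\<^sup>2)"
    and isometry_eq: "(\<integral>\<^sup>+\<omega>. (\<integral>\<^sup>+s\<in>{0..t}. ennreal ((simple_val H s \<omega>)\<^sup>2) \<partial>lborel) \<partial>P x) =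
       ennreal (\<integral>\<omega>. (simple_int B H t \<omega>)\<^sup>2 \<partial>P x)"
proof -
  define a b h where "a i = fst (H ! i)" and "b i = fst (snd (H ! i))" and "h i = snd (snd (H ! i))" for i
  let ?J = "{..<length H}"
  define X where "X i \<omega> = h i \<omega> * (B (min (b i) t) \<omega> - B (min (a i) t) \<omega>)" for i \<omega>
  define m where "m i j = measure lborel ({a i<..b i} \<inter> {a j<..b j} \<inter> {0..t})" for i j
  have pair: "integrable (P x) (\<lambda>\<omega>. X i \<omega> * X j \<omega>) \<and>
      (\<integral>\<omega>. X i \<omega> * X j \<omega> \<partial>P x) = (\<integral>\<omega>. h i \<omega> * h j \<omega> \<partial>P x) * m i j"
    and hh: "integrable (P x) (\<lambda>\<omega>. h i \<omega> * h j \<omega>)" if ij: "i \<in> ?J" "j \<in> ?J" for i j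
  proof -
    obtain C where C: "\<And>\<omega>. \<omega> \<in> space M \<Longrightarrow> \<bar>h i \<omega>\<bar> \<le> C"
      using simple_integrand_bound[OF H, of i] ij unfolding h_def by auto
    obtain D where D: "\<And>\<omega>. \<omega> \<in> space M \<Longrightarrow> \<bar>h j \<omega>\<bar> \<le> D"
      using simple_integrand_bound[OF H, of j] ij unfolding h_def by auto
    show "integrable (P x) (\<lambda>\<omega>. X i \<omega> * X j \<omega>) \<and>
      (\<integral>\<omega>. X i \<omega> * X j \<omega> \<partial>P x) = (\<integral>\<omega>. h i \<omega> * h j \<omega> \<partial>P x) * m i j"
      unfolding X_def m_def
      using simple_integrand_nth[OF H, of i] simple_integrand_nth[OF H, of j] that t C D
      by (intro isometry_pair) (auto simp: a_def b_def h_def)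
    show "integrable (P x) (\<lambda>\<omega>. h i \<omega> * h j \<omega>)"
      using simple_integrand_measurable[OF H, of i] simple_integrand_measurable[OF H, of j] that
      by (intro integrable_bounded_mult[OF _ C] integrable_bounded[OF _ D]) (auto simp: h_def)
  qed
  have int2: "(simple_int B H t \<omega>)\<^sup>2 = (\<Sum>i\<in>?J. \<Sum>j\<in>?J. X i \<omega> * X j \<omega>)" for \<omega>
    by (simp add: simple_int_sum X_def a_def b_def h_def power2_eq_square sum_product)
  have val2: "(simple_val H s \<omega>)\<^sup>2 * indicator {0..t} s =
      (\<Sum>i\<in>?J. \<Sum>j\<in>?J. (h i \<omega> * h j \<omega>) * indicator ({a i<..b i} \<inter> {a j<..b j} \<inter> {0..t}) s)" for s \<omega>
    unfolding simple_val_sum a_def b_def h_def power2_eq_square sum_distrib_right sum_distrib_left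
    by (intro sum.cong refl) (simp only: indicator_inter_arith mult_ac)
  show "integrable (P x) (\<lambda>\<omega>. (simple_int B H t \<omega>)\<^sup>2)"
    unfolding int2 using pair by (intro integral_double_sum(1)) auto
  have E: "(\<integral>\<omega>. (simple_int B H t \<omega>)\<^sup>2 \<partial>P x) = (\<Sum>i\<in>?J. \<Sum>j\<in>?J. (\<integral>\<omega>. h i \<omega> * h j \<omega> \<partial>P x) * m i j)"
    unfolding int2 using pair
    by (subst integral_double_sum(2)) (auto intro!: sum.cong simp del: sum_mult_indicator)
  let ?G = "\<lambda>\<omega>. \<Sum>i\<in>?J. \<Sum>j\<in>?J. (h i \<omega> * h j \<omega>) * m i j"
  have fin: "emeasure lborel ({a i<..b i} \<inter> {a j<..b j} \<inter> {0..t}) < \<infinity>" for i j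
    by (rule le_less_trans[OF emeasure_mono[of _ "{0..t}"]]) (use t in auto)
  have has: "has_bochner_integral lborel (\<lambda>s. (simple_val H s \<omega>)\<^sup>2 * indicator {0..t} s) (?G \<omega>)" for \<omega>
    unfolding val2 m_def
    by (intro has_bochner_integral_sum has_bochner_integral_mult_right has_bochner_integral_real_indicator fin) auto
  \<comment> \<open>Off-diagonal terms may be negative, so the sign cannot be read off the double
    sum; it comes from the sum being the time integral of a square.\<close>
  have G0: "0 \<le> ?G \<omega>" for \<omega>
    unfolding has_bochner_integral_integral_eq[OF has, symmetric] by (rule Bochner_Integration.integral_nonneg) simp
  have inner: "(\<integral>\<^sup>+s\<in>{0..t}. ennreal ((simple_val H s \<omega>)\<^sup>2) \<partial>lborel) = ennreal (?G \<omega>)" for \<omega>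
  proof -
    have "(\<integral>\<^sup>+s\<in>{0..t}. ennreal ((simple_val H s \<omega>)\<^sup>2) \<partial>lborel) =
        (\<integral>\<^sup>+s. ennreal ((simple_val H s \<omega>)\<^sup>2 * indicator {0..t} s) \<partial>lborel)"
      by (intro nn_integral_cong) (simp add: indicator_def)
    also have "\<dots> = ennreal (\<integral>s. (simple_val H s \<omega>)\<^sup>2 * indicator {0..t} s \<partial>lborel)"
      by (intro nn_integral_eq_integral integrable.intros[OF has]) simp
    finally show ?thesis by (simp only: has_bochner_integral_integral_eq[OF has])
  qed
  have "(\<integral>\<^sup>+\<omega>. ennreal (?G \<omega>) \<partial>P x) = ennreal (\<integral>\<omega>. ?G \<omega> \<partial>P x)"
    using G0 hh by (intro nn_integral_eq_integral) (auto intro!: integral_double_sum(1))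
  also have "(\<integral>\<omega>. ?G \<omega> \<partial>P x) = (\<Sum>i\<in>?J. \<Sum>j\<in>?J. (\<integral>\<omega>. h i \<omega> * h j \<omega> \<partial>P x) * m i j)"
    using hh by (subst integral_double_sum(2)) auto
  finally show "(\<integral>\<^sup>+\<omega>. (\<integral>\<^sup>+s\<in>{0..t}. ennreal ((simple_val H s \<omega>)\<^sup>2) \<partial>lborel) \<partial>P x) =
       ennreal (\<integral>\<omega>. (simple_int B H t \<omega>)\<^sup>2 \<partial>P x)"
    by (simp add: inner E)
qed

text \<open>The martingale property in tested form. Each summand of the difference is its
  coefficient times an increment of \<open>B\<close> that starts at \<open>max (a i) s\<close>, a
  time at which both the coefficient and \<open>w\<close> are known.\<close>

lemma simple_int_orthogonal:
  assumes H: "simple_integrand F H" and st: "0 \<le> s" "s \<le> t"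
    and w: "w \<in> borel_measurable (F s)" "integrable (P x) w"
  shows "(\<integral>\<omega>. w \<omega> * (simple_int B H t \<omega> - simple_int B H s \<omega>) \<partial>P x) = 0"
proof -
  define a b h where "a i = fst (H ! i)" and "b i = fst (snd (H ! i))" and "h i = snd (snd (H ! i))" for i
  let ?D = "\<lambda>i \<omega>. h i \<omega> * (B (min (b i) t) \<omega> - B (min (a i) t) \<omega>) - h i \<omega> * (B (min (b i) s) \<omega> - B (min (a i) s) \<omega>)"
  have summand: "integrable (P x) (\<lambda>\<omega>. w \<omega> * ?D i \<omega>) \<and> (\<integral>\<omega>. w \<omega> * ?D i \<omega> \<partial>P x) = 0" if i: "i < length H" for i
  proof -
    obtain C where C: "\<And>\<omega>. \<omega> \<in> space M \<Longrightarrow> \<bar>h i \<omega>\<bar> \<le> C"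
      using simple_integrand_bound[OF H i] unfolding h_def by auto
    have ab: "0 \<le> a i" "a i \<le> b i" "h i \<in> borel_measurable (F (a i))"
      using simple_integrand_nth[OF H i] by (auto simp: a_def b_def h_def)
    have hw: "integrable (P x) (\<lambda>\<omega>. h i \<omega> * w \<omega>)"
      by (rule integrable_bounded_mult[OF measurable_F_P[OF ab(1,3)] C w(2)])
    have vanish: "integrable (P x) (\<lambda>\<omega>. w \<omega> * (h i \<omega> * (B v \<omega> - B u \<omega>))) \<and>
        (\<integral>\<omega>. w \<omega> * (h i \<omega> * (B v \<omega> - B u \<omega>)) \<partial>P x) = 0" if "a i \<le> u" "s \<le> u" "u \<le> v" for u v
      using integral_mult_increment_1[of u v "\<lambda>\<omega>. h i \<omega> * w \<omega>" x] that hw ab st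
        measurable_F_mono[OF ab(1) that(1) ab(3)] measurable_F_mono[OF st(1) that(2) w(1)]
      by (simp add: mult_ac)
    \<comment> \<open>The interval of the summand misses the time span from \<open>s\<close> to
      \<open>t\<close>, or begins within it, or begins before \<open>s\<close> and reaches past
      it.\<close>
    consider "t \<le> a i \<or> b i \<le> s" | "s \<le> a i" "a i < t" | "a i < s" "s < b i" by linarith
    then show ?thesis
    proof cases
      case 1
      then have "min (b i) t = min (b i) s \<and> min (a i) t = min (a i) s \<or>
          min (b i) t = min (a i) t \<and> min (b i) s = min (a i) s"
        using ab st by linarith
      then have "?D i \<omega> = 0" for \<omega> by auto
      then show ?thesis by (simp only: mult_zero_right integrable_zero Bochner_Integration.integral_zero simp_thms)
    next
      case 2
      then have eq: "?D i \<omega> = h i \<omega> * (B (min (b i) t) \<omega> - B (a i) \<omega>)" for \<omega>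
        using ab st by (cases "b i \<le> s"; cases "a i = s") (auto simp: min_def)
      show ?thesis unfolding eq using vanish[of "a i" "min (b i) t"] 2 ab by simp
    next
      case 3
      then have eq: "?D i \<omega> = h i \<omega> * (B (min (b i) t) \<omega> - B s \<omega>)" for \<omega>
        using ab st by (auto simp: min_def algebra_simps)
      show ?thesis unfolding eq using vanish[of s "min (b i) t"] 3 st by simp
    qed
  qed
  have "(\<integral>\<omega>. w \<omega> * (simple_int B H t \<omega> - simple_int B H s \<omega>) \<partial>P x) = (\<integral>\<omega>. (\<Sum>i<length H. w \<omega> * ?D i \<omega>) \<partial>P x)"
    by (simp add: simple_int_sum a_def b_def h_def sum_subtractf[symmetric] sum_distrib_left)
  also have "\<dots> = 0" using summand by (subst Bochner_Integration.integral_sum) auto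
  finally show ?thesis .
qed

end

text \<open>The order of limits used throughout: for fixed \<open>\<epsilon>\<close> let
  \<open>n\<close> grow, then shrink \<open>\<epsilon>\<close>. The bound is asked for from
  \<open>n = 1\<close> on because a grid with 0 steps does not reach its endpoint.\<close>

lemma tendsto_zero_epsilon:
  fixes X :: "nat \<Rightarrow> real"
  assumes "0 \<le> A" "\<And>\<epsilon>. 0 < \<epsilon> \<Longrightarrow> \<exists>Y. Y \<longlonglongrightarrow> 0 \<and> (\<forall>n\<ge>1. \<bar>X n\<bar> \<le> \<epsilon> * A + Y n)"
  shows "X \<longlonglongrightarrow> 0"
proof (rule LIMSEQ_I)
  fix r :: real assume r: "0 < r"
  define \<epsilon> where "\<epsilon> = r / (2 * (A + 1))"
  have \<epsilon>: "0 < \<epsilon>" "\<epsilon> * A \<le> r / 2" using r assms(1) by (auto simp: \<epsilon>_def field_simps)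
  obtain Y where Y: "Y \<longlonglongrightarrow> 0" "\<And>n. n \<ge> 1 \<Longrightarrow> \<bar>X n\<bar> \<le> \<epsilon> * A + Y n"
    using assms(2)[OF \<epsilon>(1)] by blast
  obtain N where N: "\<And>n. n \<ge> N \<Longrightarrow> norm (Y n - 0) < r / 2"
    using LIMSEQ_D[OF Y(1), of "r / 2"] r by auto
  have "norm (X n - 0) < r" if "n \<ge> max N 1" for n
    using N[of n] Y(2)[of n] \<epsilon>(2) that by auto
  then show "\<exists>N. \<forall>n\<ge>N. norm (X n - 0) < r" by blast
qed

section \<open>From simple integrands to Ito integrals\<close>

lemma integral_square_tendsto_0:
  fixes X :: "nat \<Rightarrow> 'a \<Rightarrow> real"
  assumes "\<And>k. X k \<in> borel_measurable N" "(\<lambda>k. \<integral>\<^sup>+\<omega>. ennreal ((X k \<omega>)\<^sup>2) \<partial>N) \<longlonglongrightarrow> 0"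
  shows "(\<lambda>k. \<integral>\<omega>. (X k \<omega>)\<^sup>2 \<partial>N) \<longlonglongrightarrow> 0"
proof -
  have "(\<integral>\<omega>. (X k \<omega>)\<^sup>2 \<partial>N) = enn2real (\<integral>\<^sup>+\<omega>. ennreal ((X k \<omega>)\<^sup>2) \<partial>N)" for k
    using assms(1)[of k] by (intro integral_eq_nn_integral) auto
  then show ?thesis using tendsto_enn2real[of _ 0, OF _ order_refl] assms(2) by simp
qed

lemma eventually_integrable_square:
  fixes X :: "nat \<Rightarrow> 'a \<Rightarrow> real"
  assumes "\<And>k. X k \<in> borel_measurable N" "(\<lambda>k. \<integral>\<^sup>+\<omega>. ennreal ((X k \<omega>)\<^sup>2) \<partial>N) \<longlonglongrightarrow> 0"
  shows "\<forall>\<^sub>F k in sequentially. integrable N (\<lambda>\<omega>. (X k \<omega>)\<^sup>2)"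
proof -
  have "\<forall>\<^sub>F k in sequentially. (\<integral>\<^sup>+\<omega>. ennreal ((X k \<omega>)\<^sup>2) \<partial>N) < \<infinity>"
    using assms(2) by (rule order_tendstoD) simp
  then show ?thesis
    by eventually_elim (use assms(1) in \<open>auto intro!: integrableI_nonneg\<close>)
qed

context brownian_family
begin

text \<open>The isometry turns the distance of two elementary integrals into a distance of
  integrands, where the triangle inequality can pass through \<open>K\<close>. It makes
  approximating sequences comparable that come from different instances of
  \<open>has_ito_integral\<close>.\<close>

lemma simple_integrand_distance:
  assumes H: "simple_integrand F H" "simple_integrand F H'" and s: "0 \<le> s"
    and K: "(\<lambda>(u, \<omega>). K u \<omega>) \<in> borel_measurable (restrict_space borel {0..s} \<Otimes>\<^sub>M F s)"
  shows "ennreal (\<integral>\<omega>. (simple_int B H s \<omega> - simple_int B H' s \<omega>)\<^sup>2 \<partial>P x) \<le>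
    2 * (\<integral>\<^sup>+\<omega>. (\<integral>\<^sup>+u\<in>{0..s}. ennreal ((simple_val H u \<omega> - K u \<omega>)\<^sup>2) \<partial>lborel) \<partial>P x) +
    2 * (\<integral>\<^sup>+\<omega>. (\<integral>\<^sup>+u\<in>{0..s}. ennreal ((simple_val H' u \<omega> - K u \<omega>)\<^sup>2) \<partial>lborel) \<partial>P x)"
proof -
  define R :: "real measure" where "R = restrict_space lborel {0..s}"
  interpret R: sigma_finite_measure R
    unfolding R_def by (rule sigma_finite_measure_restrict_space) (auto intro: lborel.sigma_finite_measure_axioms)
  have R: "(\<integral>\<^sup>+u\<in>{0..s}. \<phi> u \<partial>lborel) = (\<integral>\<^sup>+u. \<phi> u \<partial>R)" for \<phi> :: "real \<Rightarrow> ennreal"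
    unfolding R_def by (subst nn_integral_restrict_space) auto
  have sets_R: "sets R = sets (restrict_space borel {0..s})"
    unfolding R_def by (rule sets_restrict_space_cong) simp
  have id1: "(\<lambda>\<omega>. \<omega>) \<in> measurable (P x) (F s)"
    using subalgebra_F[OF s] by (auto simp: measurable_def space_P subalgebra_def sets_P)
  have id2: "(\<lambda>u. u) \<in> measurable R (restrict_space borel {0..s})"
    by (rule measurable_ident_sets[OF sets_R])
  \<comment> \<open>The joint measurability of \<open>K\<close> is stated with time first and
    relative to \<open>F s\<close>; the iterated integrals need the path first and the larger
    sigma-algebra of \<open>P x\<close>.\<close>
  have "(\<lambda>p. (snd p, fst p)) \<in> measurable (P x \<Otimes>\<^sub>M R) (restrict_space borel {0..s} \<Otimes>\<^sub>M F s)"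
    by (intro measurable_Pair measurable_compose[OF measurable_snd id2] measurable_compose[OF measurable_fst id1])
  from measurable_compose[OF this K] have Km [measurable]: "(\<lambda>(\<omega>, u). K u \<omega>) \<in> borel_measurable (P x \<Otimes>\<^sub>M R)"
    by (simp add: case_prod_beta)
  have val [measurable]: "(\<lambda>(\<omega>, u). simple_val G u \<omega>) \<in> borel_measurable (P x \<Otimes>\<^sub>M R)"
    if "simple_integrand F G" for G
  proof -
    have [measurable]: "(\<lambda>u. indicat_real {a<..b} u) \<in> borel_measurable R" for a b
      unfolding R_def by (rule measurable_restrict_space1) simp
    have [measurable]: "snd (snd (G ! i)) \<in> borel_measurable (P x)" if "i < length G" for i
      by (rule simple_integrand_measurable) fact+
    show ?thesis
      unfolding simple_val_sum case_prod_beta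
      by (intro borel_measurable_sum) (auto intro!: borel_measurable_times)
  qed
  have "ennreal (\<integral>\<omega>. (simple_int B H s \<omega> - simple_int B H' s \<omega>)\<^sup>2 \<partial>P x) =
      (\<integral>\<^sup>+\<omega>. (\<integral>\<^sup>+u. ennreal ((simple_val H u \<omega> - simple_val H' u \<omega>)\<^sup>2) \<partial>R) \<partial>P x)"
    using isometry_eq[OF simple_integrand_diff[OF H] s, of x]
    by (simp add: simple_val_diff simple_int_diff R)
  also have "\<dots> \<le> (\<integral>\<^sup>+\<omega>. (\<integral>\<^sup>+u. 2 * ennreal ((simple_val H u \<omega> - K u \<omega>)\<^sup>2) + 2 * ennreal ((simple_val H' u \<omega> - K u \<omega>)\<^sup>2) \<partial>R) \<partial>P x)"
  proof (intro nn_integral_mono)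
    fix \<omega> u
    have "(simple_val H u \<omega> - simple_val H' u \<omega>)\<^sup>2 \<le> 2 * (simple_val H u \<omega> - K u \<omega>)\<^sup>2 + 2 * (simple_val H' u \<omega> - K u \<omega>)\<^sup>2"
      using square_add_le[of "simple_val H u \<omega> - K u \<omega>" "K u \<omega> - simple_val H' u \<omega>"]
      by (simp add: power2_commute[of "K u \<omega>"])
    then show "ennreal ((simple_val H u \<omega> - simple_val H' u \<omega>)\<^sup>2) \<le>
        2 * ennreal ((simple_val H u \<omega> - K u \<omega>)\<^sup>2) + 2 * ennreal ((simple_val H' u \<omega> - K u \<omega>)\<^sup>2)"
      by (simp add: ennreal_mult'[symmetric] ennreal_plus[symmetric] ennreal_leI
          del: ennreal_plus flip: ennreal_numeral)
  qed
  also have "\<dots> = (\<integral>\<^sup>+\<omega>. 2 * (\<integral>\<^sup>+u. ennreal ((simple_val H u \<omega> - K u \<omega>)\<^sup>2) \<partial>R) +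
      2 * (\<integral>\<^sup>+u. ennreal ((simple_val H' u \<omega> - K u \<omega>)\<^sup>2) \<partial>R) \<partial>P x)"
  proof (intro nn_integral_cong)
    fix \<omega> assume \<omega>: "\<omega> \<in> space (P x)"
    have [measurable]: "(\<lambda>u. K u \<omega>) \<in> borel_measurable R"
      "(\<lambda>u. simple_val H u \<omega>) \<in> borel_measurable R" "(\<lambda>u. simple_val H' u \<omega>) \<in> borel_measurable R"
      using measurable_Pair2[OF Km \<omega>] measurable_Pair2[OF val[OF H(1)] \<omega>] measurable_Pair2[OF val[OF H(2)] \<omega>]
      by simp_all
    show "(\<integral>\<^sup>+u. 2 * ennreal ((simple_val H u \<omega> - K u \<omega>)\<^sup>2) + 2 * ennreal ((simple_val H' u \<omega> - K u \<omega>)\<^sup>2) \<partial>R) =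
      2 * (\<integral>\<^sup>+u. ennreal ((simple_val H u \<omega> - K u \<omega>)\<^sup>2) \<partial>R) +
      2 * (\<integral>\<^sup>+u. ennreal ((simple_val H' u \<omega> - K u \<omega>)\<^sup>2) \<partial>R)"
      by (subst nn_integral_add) (auto simp: nn_integral_cmult)
  qed
  also have "\<dots> = 2 * (\<integral>\<^sup>+\<omega>. (\<integral>\<^sup>+u. ennreal ((simple_val H u \<omega> - K u \<omega>)\<^sup>2) \<partial>R) \<partial>P x) +
      2 * (\<integral>\<^sup>+\<omega>. (\<integral>\<^sup>+u. ennreal ((simple_val H' u \<omega> - K u \<omega>)\<^sup>2) \<partial>R) \<partial>P x)"
  proof -
    have [measurable]: "(\<lambda>\<omega>. \<integral>\<^sup>+u. ennreal ((simple_val G u \<omega> - K u \<omega>)\<^sup>2) \<partial>R) \<in> borel_measurable (P x)"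
      if G: "simple_integrand F G" for G
    proof (rule R.borel_measurable_nn_integral)
      note [measurable] = val[OF G]
      show "(\<lambda>(\<omega>, u). ennreal ((simple_val G u \<omega> - K u \<omega>)\<^sup>2)) \<in> borel_measurable (P x \<Otimes>\<^sub>M R)"
        by measurable
    qed
    show ?thesis using H by (subst nn_integral_add) (auto simp: nn_integral_cmult)
  qed
  finally show ?thesis by (simp add: R)
qed

text \<open>Convergence to 0 in the extended nonnegative reals forces finiteness from some index on.
  A single such index suffices, as the elementary integral is itself square integrable.\<close>

lemma ito_square_integrable:
  assumes "has_ito_integral (P x) F B K t I" "0 \<le> t"
  shows "integrable (P x) (\<lambda>\<omega>. (I \<omega>)\<^sup>2)"
proof -
  from assms obtain H where I [measurable]: "I \<in> borel_measurable (P x)"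
    and H: "\<And>k. simple_integrand F (H k)"
    and lim: "(\<lambda>k. \<integral>\<^sup>+\<omega>. ennreal ((simple_int B (H k) t \<omega> - I \<omega>)\<^sup>2) \<partial>P x) \<longlonglongrightarrow> 0"
    unfolding has_ito_integral_def by blast
  have m: "simple_int B (H k) t \<in> borel_measurable (P x)" for k
    by (rule simple_int_measurable[OF H assms(2)])
  have "(\<lambda>\<omega>. simple_int B (H k) t \<omega> - I \<omega>) \<in> borel_measurable (P x)" for k using m by simp
  from eventually_happens'[OF _ eventually_integrable_square[OF this lim]] obtain k
    where k: "integrable (P x) (\<lambda>\<omega>. (simple_int B (H k) t \<omega> - I \<omega>)\<^sup>2)" by auto
  show ?thesis
    using integrable_square_add(2)[OF m[of k] _ isometry_integrable[OF H assms(2), of x k] k] m[of k] by simp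
qed

text \<open>The approximations of \<open>I\<close> and \<open>J\<close> are unrelated. Stopping at
  \<open>s\<close> the integrands that approximate \<open>K\<close> up to \<open>t\<close> gives a
  second approximation of \<open>K\<close> up to \<open>s\<close>, whose integrals are close to
  those approximating \<open>I\<close>. So \<open>J - I\<close> is, up to an \<open>L^2\<close>
  error, the increment of one simple integral, and that increment is orthogonal to
  \<open>w\<close>.\<close>

lemma ito_orthogonal:
  assumes I: "has_ito_integral (P x) F B K s I" and J: "has_ito_integral (P x) F B K t J"
    and st: "0 \<le> s" "s \<le> t"
    and w: "w \<in> borel_measurable (F s)" "integrable (P x) (\<lambda>\<omega>. (w \<omega>)\<^sup>2)"
  shows "(\<integral>\<omega>. w \<omega> * (J \<omega> - I \<omega>) \<partial>P x) = 0"
proof -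
  have t: "0 \<le> t" using st by simp
  from I obtain H' where [measurable]: "I \<in> borel_measurable (P x)"
    and K: "(\<lambda>(u, \<omega>). K u \<omega>) \<in> borel_measurable (restrict_space borel {0..s} \<Otimes>\<^sub>M F s)"
    and H': "\<And>k. simple_integrand F (H' k)"
    and val': "(\<lambda>k. \<integral>\<^sup>+\<omega>. (\<integral>\<^sup>+u\<in>{0..s}. ennreal ((simple_val (H' k) u \<omega> - K u \<omega>)\<^sup>2) \<partial>lborel) \<partial>P x) \<longlonglongrightarrow> 0"
    and int': "(\<lambda>k. \<integral>\<^sup>+\<omega>. ennreal ((simple_int B (H' k) s \<omega> - I \<omega>)\<^sup>2) \<partial>P x) \<longlonglongrightarrow> 0"
    unfolding has_ito_integral_def by blast
  from J obtain H where [measurable]: "J \<in> borel_measurable (P x)"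
    and H: "\<And>k. simple_integrand F (H k)"
    and val: "(\<lambda>k. \<integral>\<^sup>+\<omega>. (\<integral>\<^sup>+u\<in>{0..t}. ennreal ((simple_val (H k) u \<omega> - K u \<omega>)\<^sup>2) \<partial>lborel) \<partial>P x) \<longlonglongrightarrow> 0"
    and int: "(\<lambda>k. \<integral>\<^sup>+\<omega>. ennreal ((simple_int B (H k) t \<omega> - J \<omega>)\<^sup>2) \<partial>P x) \<longlonglongrightarrow> 0"
    unfolding has_ito_integral_def by blast
  have [measurable]: "w \<in> borel_measurable (P x)" by (rule measurable_F_P[OF st(1) w(1)])
  have [measurable]: "simple_int B (H k) t \<in> borel_measurable (P x)" "simple_int B (H k) s \<in> borel_measurable (P x)"
    "simple_int B (H' k) s \<in> borel_measurable (P x)" for k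
    by (auto intro!: simple_int_measurable H H' st t)
  \<comment> \<open>The three errors: approximating \<open>J\<close>, exchanging the two
    approximations at time \<open>s\<close>, and approximating \<open>I\<close>. Each is paired with
    \<open>w\<close> at weight \<open>\<epsilon>\<close>, whence the factor 3 below.\<close>
  define X1 X2 X3 where "X1 k \<omega> = simple_int B (H k) t \<omega> - J \<omega>"
    and "X2 k \<omega> = simple_int B (H k) s \<omega> - simple_int B (H' k) s \<omega>"
    and "X3 k \<omega> = simple_int B (H' k) s \<omega> - I \<omega>" for k \<omega>
  have m [measurable]: "X1 k \<in> borel_measurable (P x)" "X2 k \<in> borel_measurable (P x)" "X3 k \<in> borel_measurable (P x)" for k
    by (simp_all add: X1_def[abs_def] X2_def[abs_def] X3_def[abs_def])
  have l1: "(\<lambda>k. \<integral>\<omega>. (X1 k \<omega>)\<^sup>2 \<partial>P x) \<longlonglongrightarrow> 0" and i1: "\<forall>\<^sub>F k in sequentially. integrable (P x) (\<lambda>\<omega>. (X1 k \<omega>)\<^sup>2)"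
    using integral_square_tendsto_0[of X1, OF m(1)] eventually_integrable_square[of X1, OF m(1)] int by (simp_all add: X1_def)
  have l3: "(\<lambda>k. \<integral>\<omega>. (X3 k \<omega>)\<^sup>2 \<partial>P x) \<longlonglongrightarrow> 0" and i3: "\<forall>\<^sub>F k in sequentially. integrable (P x) (\<lambda>\<omega>. (X3 k \<omega>)\<^sup>2)"
    using integral_square_tendsto_0[of X3, OF m(3)] eventually_integrable_square[of X3, OF m(3)] int' by (simp_all add: X3_def)
  have i2: "integrable (P x) (\<lambda>\<omega>. (X2 k \<omega>)\<^sup>2)" for k
    using isometry_integrable[OF simple_integrand_diff[OF H H'] st(1), of x k k] by (simp add: simple_int_diff X2_def)
  have l2: "(\<lambda>k. \<integral>\<omega>. (X2 k \<omega>)\<^sup>2 \<partial>P x) \<longlonglongrightarrow> 0"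
  proof -
    let ?e = "\<lambda>k. \<integral>\<^sup>+\<omega>. (\<integral>\<^sup>+u\<in>{0..t}. ennreal ((simple_val (H k) u \<omega> - K u \<omega>)\<^sup>2) \<partial>lborel) \<partial>P x"
    let ?e' = "\<lambda>k. \<integral>\<^sup>+\<omega>. (\<integral>\<^sup>+u\<in>{0..s}. ennreal ((simple_val (H' k) u \<omega> - K u \<omega>)\<^sup>2) \<partial>lborel) \<partial>P x"
    have "(\<integral>\<^sup>+\<omega>. (\<integral>\<^sup>+u\<in>{0..s}. ennreal ((simple_val (H k) u \<omega> - K u \<omega>)\<^sup>2) \<partial>lborel) \<partial>P x) \<le> ?e k" for k
      using st by (intro nn_integral_mono mult_left_mono) (auto simp: indicator_def)
    then have le: "ennreal (\<integral>\<omega>. (X2 k \<omega>)\<^sup>2 \<partial>P x) \<le> 2 * ?e k + 2 * ?e' k" for k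
      unfolding X2_def by (intro order_trans[OF simple_integrand_distance[OF H H' st(1) K]] add_mono mult_left_mono) auto
    have "(\<lambda>k. 2 * ?e k + 2 * ?e' k) \<longlonglongrightarrow> 2 * 0 + 2 * 0"
      by (intro tendsto_add ennreal_tendsto_cmult val val') auto
    then have "(\<lambda>k. ennreal (\<integral>\<omega>. (X2 k \<omega>)\<^sup>2 \<partial>P x)) \<longlonglongrightarrow> ennreal 0"
      using tendsto_sandwich[of "\<lambda>_. 0" _ sequentially "\<lambda>k. 2 * ?e k + 2 * ?e' k" 0] le by simp
    then show ?thesis by (subst (asm) tendsto_ennreal_iff) auto
  qed
  have "\<forall>\<^sub>F k in sequentially. \<bar>\<integral>\<omega>. w \<omega> * (J \<omega> - I \<omega>) \<partial>P x\<bar> \<le> 3 * \<epsilon> * (\<integral>\<omega>. (w \<omega>)\<^sup>2 \<partial>P x) +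
      ((\<integral>\<omega>. (X1 k \<omega>)\<^sup>2 \<partial>P x) + (\<integral>\<omega>. (X2 k \<omega>)\<^sup>2 \<partial>P x) + (\<integral>\<omega>. (X3 k \<omega>)\<^sup>2 \<partial>P x)) / \<epsilon>" if \<epsilon>: "0 < \<epsilon>" for \<epsilon>
    using i1 i3
  proof eventually_elim
    case (elim k)
    note a1 = integrable_mult_squares[OF _ m(1) w(2) elim(1)]
    note a2 = integrable_mult_squares[OF _ m(2) w(2) i2[of k]]
    note a3 = integrable_mult_squares[OF _ m(3) w(2) elim(2)]
    have w1: "integrable (P x) w"
      using integrable_mult_squares(1)[OF _ _ w(2), of "\<lambda>_. 1"] by simp
    have Jk: "integrable (P x) (\<lambda>\<omega>. w \<omega> * (simple_int B (H k) t \<omega> - simple_int B (H k) s \<omega>))"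
      using integrable_mult_squares(1)[OF _ _ w(2) isometry_integrable[OF H t, of x k]]
        integrable_mult_squares(1)[OF _ _ w(2) isometry_integrable[OF H st(1), of x k]]
      by (simp add: right_diff_distrib)
    have eq: "w \<omega> * (J \<omega> - I \<omega>) = w \<omega> * (simple_int B (H k) t \<omega> - simple_int B (H k) s \<omega>)
        - w \<omega> * X1 k \<omega> + w \<omega> * X2 k \<omega> + w \<omega> * X3 k \<omega>" for \<omega>
      by (simp add: X1_def X2_def X3_def algebra_simps)
    have "(\<integral>\<omega>. w \<omega> * (J \<omega> - I \<omega>) \<partial>P x) =
        - (\<integral>\<omega>. w \<omega> * X1 k \<omega> \<partial>P x) + (\<integral>\<omega>. w \<omega> * X2 k \<omega> \<partial>P x) + (\<integral>\<omega>. w \<omega> * X3 k \<omega> \<partial>P x)"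
      unfolding eq using a1(1) a2(1) a3(1) Jk simple_int_orthogonal[OF H st w(1) w1, of k] by simp
    then have "\<bar>\<integral>\<omega>. w \<omega> * (J \<omega> - I \<omega>) \<partial>P x\<bar> \<le>
        \<bar>\<integral>\<omega>. w \<omega> * X1 k \<omega> \<partial>P x\<bar> + \<bar>\<integral>\<omega>. w \<omega> * X2 k \<omega> \<partial>P x\<bar> + \<bar>\<integral>\<omega>. w \<omega> * X3 k \<omega> \<partial>P x\<bar>"
      by linarith
    then show ?case
      using a1(2)[OF _ \<epsilon>] a2(2)[OF _ \<epsilon>] a3(2)[OF _ \<epsilon>] by (simp add: add_divide_distrib algebra_simps)
  qed
  moreover have "(\<lambda>k. 3 * \<epsilon> * (\<integral>\<omega>. (w \<omega>)\<^sup>2 \<partial>P x) +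
      ((\<integral>\<omega>. (X1 k \<omega>)\<^sup>2 \<partial>P x) + (\<integral>\<omega>. (X2 k \<omega>)\<^sup>2 \<partial>P x) + (\<integral>\<omega>. (X3 k \<omega>)\<^sup>2 \<partial>P x)) / \<epsilon>)
      \<longlonglongrightarrow> 3 * \<epsilon> * (\<integral>\<omega>. (w \<omega>)\<^sup>2 \<partial>P x) + (0 + 0 + 0) / \<epsilon>" if "0 < \<epsilon>" for \<epsilon>
    using that by (intro tendsto_intros l1 l2 l3) auto
  ultimately have le: "\<bar>\<integral>\<omega>. w \<omega> * (J \<omega> - I \<omega>) \<partial>P x\<bar> \<le> 3 * \<epsilon> * (\<integral>\<omega>. (w \<omega>)\<^sup>2 \<partial>P x)" if "0 < \<epsilon>" for \<epsilon>
    using tendsto_lowerbound[of _ "3 * \<epsilon> * (\<integral>\<omega>. (w \<omega>)\<^sup>2 \<partial>P x)" sequentially] that by fastforce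
  have "(\<lambda>n. \<integral>\<omega>. w \<omega> * (J \<omega> - I \<omega>) \<partial>P x) \<longlonglongrightarrow> 0"
    by (rule tendsto_zero_epsilon[of "3 * (\<integral>\<omega>. (w \<omega>)\<^sup>2 \<partial>P x)"])
      (use le in \<open>auto intro!: exI[of _ "\<lambda>_. 0"] simp: mult_ac\<close>)
  then show ?thesis using LIMSEQ_unique tendsto_const by blast
qed

end

section \<open>Tanaka's formula tested against the past\<close>

context brownian_local_time
begin

lemma L_measurable_P: "0 \<le> t \<Longrightarrow> L t \<in> borel_measurable (P x)"
  by (rule measurable_F_P[OF _ L_adapted])

lemma L_le: "\<omega> \<in> space M \<Longrightarrow> 0 \<le> s \<Longrightarrow> s \<le> t \<Longrightarrow> L s \<omega> \<le> L t \<omega>"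
  using L_mono by (auto simp: mono_on_def)

lemma L_nonneg: "\<omega> \<in> space M \<Longrightarrow> 0 \<le> s \<Longrightarrow> 0 \<le> L s \<omega>"
  using L_le[of \<omega> 0 s] L_zero by simp

text \<open>Tanaka's formula exhibits \<open>L t\<close> as a difference of two square integrable
  variables, one of them the stochastic integral.\<close>

lemma integrable_L_square:
  assumes t: "0 \<le> t"
  shows "integrable (P x) (\<lambda>\<omega>. (L t \<omega>)\<^sup>2)"
proof -
  have [measurable]: "B t \<in> borel_measurable (P x)" "B 0 \<in> borel_measurable (P x)" "L t \<in> borel_measurable (P x)"
    using t by (auto intro: B_measurable_P L_measurable_P)
  have "integrable (P x) (\<lambda>\<omega>. (\<bar>B t \<omega>\<bar> - \<bar>B 0 \<omega>\<bar>)\<^sup>2)"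
    by (intro integrable_square_add) (auto intro: integrable_B_square t)
  then have "integrable (P x) (\<lambda>\<omega>. ((\<bar>B t \<omega>\<bar> - \<bar>B 0 \<omega>\<bar>) - (\<bar>B t \<omega>\<bar> - \<bar>B 0 \<omega>\<bar> - L t \<omega>))\<^sup>2)"
    by (intro integrable_square_add(2)[OF _ _ _ ito_square_integrable[OF tanaka[OF t] t]]) auto
  then show ?thesis by simp
qed

lemma integrable_L: "0 \<le> t \<Longrightarrow> integrable (P x) (L t)"
  using integrable_mult_squares(1)[where w = "L t" and z = "\<lambda>_. 1" and M = "P x"]
    L_measurable_P integrable_L_square by simp

text \<open>All that the later sections use of Tanaka's formula: in expectation against a variable
  known at time \<open>s\<close>, increments of \<open>|B|\<close> and of \<open>L\<close> may be
  exchanged.\<close>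

lemma tanaka_increment:
  assumes st: "0 \<le> s" "s \<le> t"
    and w: "w \<in> borel_measurable (F s)" "integrable (P x) (\<lambda>\<omega>. (w \<omega>)\<^sup>2)"
  shows "integrable (P x) (\<lambda>\<omega>. w \<omega> * (\<bar>B t \<omega>\<bar> - \<bar>B s \<omega>\<bar>))"
    and "integrable (P x) (\<lambda>\<omega>. w \<omega> * (L t \<omega> - L s \<omega>))"
    and "(\<integral>\<omega>. w \<omega> * (\<bar>B t \<omega>\<bar> - \<bar>B s \<omega>\<bar>) \<partial>P x) = (\<integral>\<omega>. w \<omega> * (L t \<omega> - L s \<omega>) \<partial>P x)"
proof -
  have t: "0 \<le> t" using st by simp
  have [measurable]: "B t \<in> borel_measurable (P x)" "B s \<in> borel_measurable (P x)" "w \<in> borel_measurable (P x)"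
     "L t \<in> borel_measurable (P x)" "L s \<in> borel_measurable (P x)"
    using t st w(1) by (auto intro: B_measurable_P L_measurable_P measurable_F_P)
  show 1: "integrable (P x) (\<lambda>\<omega>. w \<omega> * (\<bar>B t \<omega>\<bar> - \<bar>B s \<omega>\<bar>))"
    using st t by (intro integrable_mult_squares(1)[OF _ _ w(2)] integrable_square_add) (auto intro: integrable_B_square)
  show 2: "integrable (P x) (\<lambda>\<omega>. w \<omega> * (L t \<omega> - L s \<omega>))"
    using st t by (intro integrable_mult_squares(1)[OF _ _ w(2)] integrable_square_add) (auto intro: integrable_L_square)
  have "w \<omega> * ((\<bar>B t \<omega>\<bar> - \<bar>B 0 \<omega>\<bar> - L t \<omega>) - (\<bar>B s \<omega>\<bar> - \<bar>B 0 \<omega>\<bar> - L s \<omega>)) =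
      w \<omega> * (\<bar>B t \<omega>\<bar> - \<bar>B s \<omega>\<bar>) - w \<omega> * (L t \<omega> - L s \<omega>)" for \<omega>
    by (simp add: algebra_simps)
  then show "(\<integral>\<omega>. w \<omega> * (\<bar>B t \<omega>\<bar> - \<bar>B s \<omega>\<bar>) \<partial>P x) = (\<integral>\<omega>. w \<omega> * (L t \<omega> - L s \<omega>) \<partial>P x)"
    using ito_orthogonal[OF tanaka[OF st(1)] tanaka[OF t] st w] 1 2 by simp
qed

end

section \<open>Sums over partitions\<close>

definition grid :: "real \<Rightarrow> nat \<Rightarrow> nat \<Rightarrow> real" where
  "grid T n i = T * real i / real n"

lemma grid_0 [simp]: "grid T n 0 = 0"
  by (simp add: grid_def)

lemma grid_end: "1 \<le> n \<Longrightarrow> grid T n n = T"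
  by (simp add: grid_def)

lemma grid_nonneg: "0 \<le> T \<Longrightarrow> 0 \<le> grid T n i"
  by (simp add: grid_def)

lemma grid_Suc: "grid T n (Suc i) = grid T n i + T / n"
  by (simp add: grid_def add_divide_distrib algebra_simps)

lemma grid_le_Suc: "0 \<le> T \<Longrightarrow> grid T n i \<le> grid T n (Suc i)"
  by (simp add: grid_Suc)

lemma grid_le: "0 \<le> T \<Longrightarrow> i \<le> n \<Longrightarrow> grid T n i \<le> T"
  by (cases "n = 0") (auto simp: grid_def field_simps mult_left_mono)

text \<open>Each term is at most \<open>2 * (sqrt (n + 1) - sqrt n)\<close>, and these
  telescope.\<close>

lemma sum_inverse_sqrt_le: "(\<Sum>i<n. 1 / sqrt (real (Suc i))) \<le> 2 * sqrt (real n)"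
proof (induction n)
  case (Suc n)
  let ?a = "sqrt (real (Suc n))" and ?b = "sqrt (real n)"
  have a: "0 < ?a" "?b \<le> ?a" by simp_all
  have "1 = (?a - ?b) * (?a + ?b)"
    by (simp add: algebra_simps)
  also have "\<dots> \<le> (?a - ?b) * (2 * ?a)"
    using a by (intro mult_left_mono) auto
  finally have "1 / ?a \<le> 2 * (?a - ?b)"
    using a by (simp add: field_simps)
  then show ?case using Suc.IH by simp
qed simp

text \<open>The left side is \<open>2 * (|y * z| - y * z)\<close>, which vanishes unless
  \<open>y\<close> and \<open>z\<close> have opposite signs. In that case
  \<open>|y| \<le> |z - y|\<close>, so either \<open>y\<close> lies within \<open>\<epsilon>\<close>
  of 0 or the increment is longer than \<open>\<epsilon>\<close>, and then its square is dominated
  by its fourth power over \<open>\<epsilon>^2\<close>.\<close>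

lemma increment_square_gap:
  fixes y z \<epsilon> :: real
  assumes "0 < \<epsilon>"
  shows "(z - y)\<^sup>2 - (\<bar>z\<bar> - \<bar>y\<bar>)\<^sup>2 \<le> indicator {-\<epsilon>..\<epsilon>} y * (z - y)\<^sup>2 + (z - y) ^ 4 / \<epsilon>\<^sup>2"
proof (cases "0 \<le> y * z")
  case True
  then have "(z - y)\<^sup>2 - (\<bar>z\<bar> - \<bar>y\<bar>)\<^sup>2 = 0"
    by (simp add: power2_diff abs_mult[symmetric] mult_ac)
  moreover have "0 \<le> (z - y) ^ 4" by (rule zero_le_even_power) simp
  ultimately show ?thesis by (simp add: zero_le_mult_iff)
next
  case False
  then have le: "\<bar>y\<bar> \<le> \<bar>z - y\<bar>" by (auto simp: not_le mult_less_0_iff)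
  show ?thesis
  proof (cases "\<bar>y\<bar> \<le> \<epsilon>")
    case True
    have "0 \<le> (z - y) ^ 4" by (rule zero_le_even_power) simp
    then have "0 \<le> (z - y) ^ 4 / \<epsilon>\<^sup>2" by simp
    moreover have "indicator {-\<epsilon>..\<epsilon>} y = (1 :: real)" using True by (auto simp: indicator_def)
    ultimately show ?thesis
      using order_trans[of "- (\<bar>z\<bar> - \<bar>y\<bar>)\<^sup>2" 0 "(z - y) ^ 4 / \<epsilon>\<^sup>2"] by simp
  next
    case False
    then have "\<epsilon>\<^sup>2 \<le> (z - y)\<^sup>2"
      using le assms by (simp add: abs_le_square_iff[symmetric])
    then have "(z - y)\<^sup>2 * \<epsilon>\<^sup>2 \<le> (z - y)\<^sup>2 * (z - y)\<^sup>2" by (intro mult_left_mono) auto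
    then have "(z - y)\<^sup>2 \<le> (z - y) ^ 4 / \<epsilon>\<^sup>2"
      using assms by (simp add: field_simps flip: power_add)
    moreover have "0 \<le> (\<bar>z\<bar> - \<bar>y\<bar>)\<^sup>2" "0 \<le> indicator {-\<epsilon>..\<epsilon>} y * (z - y)\<^sup>2" by (simp_all add: indicator_def)
    ultimately show ?thesis by linarith
  qed
qed

lemma abs_increment_square_le: "(\<bar>z\<bar> - \<bar>y\<bar>)\<^sup>2 \<le> (z - y :: real)\<^sup>2"
  by (simp add: abs_le_square_iff[symmetric] abs_triangle_ineq3)

context brownian_family
begin

lemma integrable_abs_increment_square:
  assumes "0 \<le> s" "s \<le> t" shows "integrable (P x) (\<lambda>\<omega>. (\<bar>B t \<omega>\<bar> - \<bar>B s \<omega>\<bar>)\<^sup>2)"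
proof -
  have [measurable]: "B t \<in> borel_measurable (P x)" "B s \<in> borel_measurable (P x)"
    using assms by (auto intro: B_measurable_P)
  show ?thesis
    using assms by (intro integrable_square_add) (auto intro: integrable_B_square)
qed

lemma integral_square_gap_le:
  assumes st: "0 \<le> s" "s \<le> t" and \<epsilon>: "0 < \<epsilon>"
  shows "(\<integral>\<omega>. (B t \<omega> - B s \<omega>)\<^sup>2 - (\<bar>B t \<omega>\<bar> - \<bar>B s \<omega>\<bar>)\<^sup>2 \<partial>P x)
    \<le> (\<integral>\<omega>. indicator {-\<epsilon>..\<epsilon>} (B s \<omega>) \<partial>P x) * (t - s) + 3 * (t - s)\<^sup>2 / \<epsilon>\<^sup>2"
proof -
  let ?Y = "\<lambda>\<omega>. indicat_real {-\<epsilon>..\<epsilon>} (B s \<omega>)"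
  have [measurable]: "B s \<in> borel_measurable (F s)" by (rule B_adapted[OF st(1)])
  have Y: "?Y \<in> borel_measurable (F s)" by measurable
  have Yi: "integrable (P x) ?Y"
    by (rule integrable_bounded[OF measurable_F_P[OF st(1) Y], of 1]) (auto simp: indicator_def)
  note m2 = integral_mult_increment_2[OF st Y Yi]
  have "(\<integral>\<omega>. (B t \<omega> - B s \<omega>)\<^sup>2 - (\<bar>B t \<omega>\<bar> - \<bar>B s \<omega>\<bar>)\<^sup>2 \<partial>P x) \<le>
    (\<integral>\<omega>. ?Y \<omega> * (B t \<omega> - B s \<omega>)\<^sup>2 + (B t \<omega> - B s \<omega>) ^ 4 / \<epsilon>\<^sup>2 \<partial>P x)"
    using integrable_increment_power[OF st] integrable_abs_increment_square[OF st] m2(1)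
    by (intro integral_mono increment_square_gap \<epsilon> Bochner_Integration.integrable_add
        Bochner_Integration.integrable_diff integrable_divide_zero)
  also have "\<dots> = (\<integral>\<omega>. ?Y \<omega> \<partial>P x) * (t - s) + 3 * (t - s)\<^sup>2 / \<epsilon>\<^sup>2"
    using m2 integrable_increment_power[OF st, of x 4] integral_increment_4[OF st] by simp
  finally show ?thesis .
qed

text \<open>With mesh \<open>T / n\<close> the small ball bounds
  \<open>\<epsilon> / sqrt (T * i / n)\<close> sum to at most
  \<open>2 * \<epsilon> * sqrt T\<close>, while the fourth moments \<open>3 * (T / n)^2\<close> sum
  to order \<open>1 / n\<close>. The first step starts at time 0, where \<open>B\<close> may sit at
  the origin and there is no small ball bound; estimating that probability by 1 costs
  \<open>T / n\<close>.\<close>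

lemma sum_square_gap_le:
  assumes T: "0 < T" and n: "1 \<le> n" and \<epsilon>: "0 < \<epsilon>"
  shows "(\<Sum>i<n. \<integral>\<omega>. (B (grid T n (Suc i)) \<omega> - B (grid T n i) \<omega>)\<^sup>2
      - (\<bar>B (grid T n (Suc i)) \<omega>\<bar> - \<bar>B (grid T n i) \<omega>\<bar>)\<^sup>2 \<partial>P x)
    \<le> \<epsilon> * (2 * sqrt T) + (T / n + 3 * T\<^sup>2 / \<epsilon>\<^sup>2 / n)" (is "(\<Sum>i<n. ?S i) \<le> _")
proof -
  have le: "?S i \<le> (\<integral>\<omega>. indicator {-\<epsilon>..\<epsilon>} (B (grid T n i) \<omega>) \<partial>P x) * (T / n) + 3 * (T / n)\<^sup>2 / \<epsilon>\<^sup>2" for i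
    using integral_square_gap_le[of "grid T n i" "grid T n (Suc i)" \<epsilon> x] grid_nonneg[of T n i] \<epsilon> T by (simp add: grid_Suc)
  have 0: "?S 0 \<le> T / n + 3 * (T / n)\<^sup>2 / \<epsilon>\<^sup>2"
  proof -
    have "(\<integral>\<omega>. indicator {-\<epsilon>..\<epsilon>} (B (grid T n 0) \<omega>) \<partial>P x) \<le> (\<integral>\<omega>. (1::real) \<partial>P x)"
      using B_measurable_P[of 0 x]
      by (intro integral_mono integrable_bounded[where C = 1]) (auto simp: indicator_def)
    then have "(\<integral>\<omega>. indicator {-\<epsilon>..\<epsilon>} (B (grid T n 0) \<omega>) \<partial>P x) * (T / n) \<le> 1 * (T / n)"
      using T by (intro mult_right_mono) (auto simp: prob.prob_space)
    then show ?thesis using le[of 0] by simp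
  qed
  have S: "?S (Suc i) \<le> \<epsilon> * (sqrt T / sqrt n) * (1 / sqrt (Suc i)) + 3 * (T / n)\<^sup>2 / \<epsilon>\<^sup>2" for i
  proof -
    have "0 < grid T n (Suc i)" using T n by (simp add: grid_def)
    from small_ball[OF this, of \<epsilon> x] \<epsilon>
    have "(\<integral>\<omega>. indicator {-\<epsilon>..\<epsilon>} (B (grid T n (Suc i)) \<omega>) \<partial>P x) * (T / n) \<le> \<epsilon> / sqrt (grid T n (Suc i)) * (T / n)"
      using T by (intro mult_right_mono) auto
    also have "\<dots> = \<epsilon> * (sqrt T / sqrt n) * (1 / sqrt (Suc i))"
    proof -
      have "T / n = (sqrt T * sqrt T) / (sqrt n * sqrt n)" using T by simp
      then show ?thesis using T n unfolding grid_def real_sqrt_mult real_sqrt_divide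
        by (simp add: field_simps)
    qed
    finally show ?thesis using le[of "Suc i"] by simp
  qed
  obtain m where m: "n = Suc m" using n by (cases n) auto
  have "(\<Sum>i<n. ?S i) = ?S 0 + (\<Sum>i<m. ?S (Suc i))"
    unfolding m by (rule sum.lessThan_Suc_shift)
  also have "\<dots> \<le> (T / n + 3 * (T / n)\<^sup>2 / \<epsilon>\<^sup>2) + (\<Sum>i<m. \<epsilon> * (sqrt T / sqrt n) * (1 / sqrt (Suc i)) + 3 * (T / n)\<^sup>2 / \<epsilon>\<^sup>2)"
    by (intro add_mono sum_mono 0 S)
  also have "\<dots> = T / n + n * (3 * (T / n)\<^sup>2 / \<epsilon>\<^sup>2) + \<epsilon> * (sqrt T / sqrt n) * (\<Sum>i<m. 1 / sqrt (Suc i))"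
    by (simp add: sum.distrib sum_distrib_left m algebra_simps add_divide_distrib)
  also have "\<dots> \<le> T / n + n * (3 * (T / n)\<^sup>2 / \<epsilon>\<^sup>2) + \<epsilon> * (sqrt T / sqrt n) * (2 * sqrt n)"
  proof -
    have "(\<Sum>i<m. 1 / sqrt (Suc i)) \<le> 2 * sqrt n"
      by (rule order_trans[OF sum_inverse_sqrt_le]) (simp add: m)
    then show ?thesis using \<epsilon> T by (intro add_left_mono mult_left_mono) auto
  qed
  also have "\<dots> = \<epsilon> * (2 * sqrt T) + (T / n + 3 * T\<^sup>2 / \<epsilon>\<^sup>2 / n)"
    using n by (simp add: field_simps power2_eq_square)
  finally show ?thesis .
qed

lemma square_gap_tendsto_0:
  assumes T: "0 < T"
  shows "(\<lambda>n. \<Sum>i<n. \<integral>\<omega>. (B (grid T n (Suc i)) \<omega> - B (grid T n i) \<omega>)\<^sup>2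
      - (\<bar>B (grid T n (Suc i)) \<omega>\<bar> - \<bar>B (grid T n i) \<omega>\<bar>)\<^sup>2 \<partial>P x) \<longlonglongrightarrow> 0"
proof (rule tendsto_zero_epsilon)
  fix \<epsilon> :: real assume \<epsilon>: "0 < \<epsilon>"
  have "(\<lambda>n. T / real n + 3 * T\<^sup>2 / \<epsilon>\<^sup>2 / real n) \<longlonglongrightarrow> 0"
    by (rule tendsto_add_zero; rule lim_const_over_n)
  moreover have "0 \<le> (\<Sum>i<n. \<integral>\<omega>. (B (grid T n (Suc i)) \<omega> - B (grid T n i) \<omega>)\<^sup>2
      - (\<bar>B (grid T n (Suc i)) \<omega>\<bar> - \<bar>B (grid T n i) \<omega>\<bar>)\<^sup>2 \<partial>P x)" for n
    by (intro sum_nonneg Bochner_Integration.integral_nonneg) (simp add: abs_increment_square_le)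
  ultimately show "\<exists>Y. Y \<longlonglongrightarrow> 0 \<and> (\<forall>n\<ge>1. \<bar>\<Sum>i<n. \<integral>\<omega>. (B (grid T n (Suc i)) \<omega> - B (grid T n i) \<omega>)\<^sup>2
      - (\<bar>B (grid T n (Suc i)) \<omega>\<bar> - \<bar>B (grid T n i) \<omega>\<bar>)\<^sup>2 \<partial>P x\<bar> \<le> \<epsilon> * (2 * sqrt T) + Y n)"
    using sum_square_gap_le[OF T _ \<epsilon>, of _ x]
    by (intro exI[of _ "\<lambda>n. T / real n + 3 * T\<^sup>2 / \<epsilon>\<^sup>2 / real n"]) (auto simp: abs_of_nonneg)
qed (use T in simp)

end

context brownian_local_time
begin

text \<open>This stands in for the fact that \<open>L\<close> grows only on the zeros of
  \<open>B\<close>. Tanaka's formula tested with \<open>|B s|\<close> replaces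
  \<open>L t - L s\<close> by \<open>|B t| - |B s|\<close>. The resulting product is half the gap
  between the squared increments of \<open>B\<close> and \<open>|B|\<close>, plus the mean zero term
  \<open>B s * (B t - B s)\<close>.\<close>

lemma weighted_local_time_tendsto_0:
  assumes T: "0 < T"
  shows "(\<lambda>n. \<Sum>i<n. \<integral>\<omega>. \<bar>B (grid T n i) \<omega>\<bar> * (L (grid T n (Suc i)) \<omega> - L (grid T n i) \<omega>) \<partial>P x) \<longlonglongrightarrow> 0"
proof -
  have "(\<integral>\<omega>. \<bar>B s \<omega>\<bar> * (L t \<omega> - L s \<omega>) \<partial>P x) =
     (1 / 2) * (\<integral>\<omega>. (B t \<omega> - B s \<omega>)\<^sup>2 - (\<bar>B t \<omega>\<bar> - \<bar>B s \<omega>\<bar>)\<^sup>2 \<partial>P x)" if st: "0 \<le> s" "s \<le> t" for s t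
  proof -
    have Bs: "B s \<in> borel_measurable (F s)" by (rule B_adapted[OF st(1)])
    have Bi: "integrable (P x) (B s)"
      using integrable_abs_B[OF st(1), of x] B_measurable_P[OF st(1), of x] by (simp add: integrable_abs_iff)
    note i1 = integral_mult_increment_1[OF st Bs Bi]
    have abs: "(\<lambda>\<omega>. \<bar>B s \<omega>\<bar>) \<in> borel_measurable (F s)" "integrable (P x) (\<lambda>\<omega>. \<bar>B s \<omega>\<bar>\<^sup>2)"
      using Bs integrable_B_square[OF st(1)] by auto
    note ti = tanaka_increment[OF st abs]
    have eq: "\<bar>B s \<omega>\<bar> * (\<bar>B t \<omega>\<bar> - \<bar>B s \<omega>\<bar>) =
        (1 / 2) * ((B t \<omega> - B s \<omega>)\<^sup>2 - (\<bar>B t \<omega>\<bar> - \<bar>B s \<omega>\<bar>)\<^sup>2) + B s \<omega> * (B t \<omega> - B s \<omega>)" for \<omega>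
      by (simp add: power2_eq_square field_simps)
    show ?thesis
      unfolding ti(3)[symmetric] eq
      using i1 integrable_increment_power[OF st, of x 2] integrable_abs_increment_square[OF st, of x]
      by (subst Bochner_Integration.integral_add) auto
  qed
  then have "(\<integral>\<omega>. \<bar>B (grid T n i) \<omega>\<bar> * (L (grid T n (Suc i)) \<omega> - L (grid T n i) \<omega>) \<partial>P x) =
      (1 / 2) * (\<integral>\<omega>. (B (grid T n (Suc i)) \<omega> - B (grid T n i) \<omega>)\<^sup>2
      - (\<bar>B (grid T n (Suc i)) \<omega>\<bar> - \<bar>B (grid T n i) \<omega>\<bar>)\<^sup>2 \<partial>P x)" for n i
    using grid_nonneg[of T n i] grid_le_Suc[of T n i] T by simp
  then show ?thesis
    using tendsto_mult_right_zero[OF square_gap_tendsto_0[OF T, of x], of "1 / 2"]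
    by (simp only: sum_distrib_left)
qed

end

section \<open>The discounted process\<close>

lemma grid_uniformly_continuous:
  fixes \<phi> :: "real \<Rightarrow> real"
  assumes \<phi>: "continuous_on {0..} \<phi>" and T: "0 < T" and e: "0 < e"
  shows "\<exists>N\<ge>1. \<forall>n\<ge>N. \<forall>i<n. \<forall>s\<in>{grid T n i..grid T n (Suc i)}. \<bar>\<phi> s - \<phi> (grid T n i)\<bar> < e"
proof -
  have "uniformly_continuous_on {0..T} \<phi>"
    by (intro compact_uniformly_continuous continuous_on_subset[OF \<phi>]) auto
  then obtain d where d: "0 < d" "\<And>s t. s \<in> {0..T} \<Longrightarrow> t \<in> {0..T} \<Longrightarrow> dist t s < d \<Longrightarrow> dist (\<phi> t) (\<phi> s) < e"
    unfolding uniformly_continuous_on_def using e by metis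
  obtain N where N: "T / d < real N" using reals_Archimedean2 by blast
  have "\<bar>\<phi> s - \<phi> (grid T n i)\<bar> < e"
    if n: "n \<ge> max 1 N" "i < n" "s \<in> {grid T n i..grid T n (Suc i)}" for n i s
  proof -
    have "T / d < real n" using N n by linarith
    then have "T / real n < d" using d(1) T n by (simp add: field_simps)
    then show ?thesis
      using d(2)[of "grid T n i" s] n T grid_nonneg[of T n i] grid_le[of T "Suc i" n] grid_le[of T i n]
      by (auto simp: dist_real_def grid_Suc)
  qed
  then show ?thesis by (intro exI[of _ "max 1 N"]) auto
qed

lemma sum_grid_telescope:
  fixes \<phi> :: "real \<Rightarrow> real"
  assumes "1 \<le> n"
  shows "(\<Sum>i<n. \<phi> (grid T n (Suc i)) - \<phi> (grid T n i)) = \<phi> T - \<phi> 0"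
  using sum_lessThan_telescope[of "\<lambda>i. \<phi> (grid T n i)" n] grid_end[OF assms] by simp

text \<open>The linear bound serves for domination, the quadratic one for smallness; both enter
  \<open>disc_err_le\<close>.\<close>

lemma exp_minus_second_order:
  fixes a :: real
  assumes a: "0 \<le> a"
  shows "0 \<le> exp (- a) - 1 + a" "exp (- a) - 1 + a \<le> a" "exp (- a) - 1 + a \<le> a\<^sup>2"
proof -
  show "0 \<le> exp (- a) - 1 + a" using exp_ge_add_one_self[of "- a"] by simp
  show "exp (- a) - 1 + a \<le> a" using a by simp
  have "exp (- a) \<le> 1 / (1 + a)"
    using exp_ge_add_one_self[of a] a by (simp add: exp_minus field_simps)
  also have "\<dots> \<le> 1 - a + a\<^sup>2"
  proof -
    \<comment> \<open>The product equals \<open>1 + a^3\<close>.\<close>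
    have "1 \<le> (1 - a + a\<^sup>2) * (1 + a)"
      using a by (simp add: algebra_simps power2_eq_square)
    then show ?thesis using a by (simp add: field_simps)
  qed
  finally show "exp (- a) - 1 + a \<le> a\<^sup>2" by simp
qed

text \<open>
  \<open>g\<close> plays the role of a bounded solution of \<open>g''/2 = l g - f\<close> with \<open>g'(0) = k g(0) - \<gamma> f(0)\<close>;
  \<open>g'\<close> is its derivative, and the second derivative only enters through \<open>taylor\<close>.
\<close>

locale half_line_solution =
  fixes l k \<gamma> :: real and f g g' :: "real \<Rightarrow> real" and C :: real
  assumes pos: "0 < l" "0 < k" "0 < \<gamma>"
    and bounded: "\<And>y. 0 \<le> y \<Longrightarrow> \<bar>f y\<bar> \<le> C" "\<And>y. 0 \<le> y \<Longrightarrow> \<bar>g y\<bar> \<le> C" "\<And>y. 0 \<le> y \<Longrightarrow> \<bar>g' y\<bar> \<le> C"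
    and cont: "continuous_on {0..} f" "continuous_on {0..} g" "continuous_on {0..} g'"
    and lipschitz: "\<And>y z. 0 \<le> y \<Longrightarrow> 0 \<le> z \<Longrightarrow> \<bar>g z - g y\<bar> \<le> C * \<bar>z - y\<bar>"
    and taylor: "\<And>\<epsilon>. 0 < \<epsilon> \<Longrightarrow> \<exists>D\<ge>0. \<forall>y\<ge>0. \<forall>z\<ge>0.
      \<bar>g z - g y - g' y * (z - y) - (l * g y - f y) * (z - y)\<^sup>2\<bar> \<le> \<epsilon> * (z - y)\<^sup>2 + D * (z - y) ^ 4"
    and near_0: "\<And>\<epsilon>. 0 < \<epsilon> \<Longrightarrow> \<exists>D\<ge>0. \<forall>y\<ge>0.
      \<bar>\<gamma> * (f y - f 0) - k * (g y - g 0) + (g' y - g' 0)\<bar> \<le> \<epsilon> + D * y"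
    and boundary: "g' 0 = k * g 0 - \<gamma> * f 0"
begin

lemma C_nonneg: "0 \<le> C"
  using bounded(1)[of 0] by simp

lemma measurable_abs:
  assumes "continuous_on {0..} (q :: real \<Rightarrow> real)" "Y \<in> borel_measurable N"
  shows "(\<lambda>\<omega>. q \<bar>Y \<omega>\<bar>) \<in> borel_measurable N"
proof -
  have "continuous_on UNIV (\<lambda>y. q \<bar>y\<bar>)"
    by (rule continuous_on_compose2[OF assms(1)]) (auto intro: continuous_intros)
  then show ?thesis
    using measurable_compose[OF assms(2) borel_measurable_continuous_onI] by blast
qed

end

section \<open>One-step decomposition of the discounted process\<close>

locale discounted = brownian_local_time M P F B \<theta> L + half_line_solution l k \<gamma> f g g' C
  for M :: "'a measure" and P F B \<theta> L l k \<gamma> f g g' C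
begin

definition disc :: "real \<Rightarrow> 'a \<Rightarrow> real" where
  "disc s \<omega> = exp (- (l * s) - k * L s \<omega>)"

definition rate :: "real \<Rightarrow> real \<Rightarrow> 'a \<Rightarrow> real" where
  "rate s t \<omega> = l * (t - s) + k * (L t \<omega> - L s \<omega>)"

text \<open>The part of \<open>disc t * g |B t| - disc s * g |B s|\<close> that is lost when the
  discount factor over the step is linearised to \<open>1 - rate\<close> and the rate is charged on
  the value of \<open>g\<close> at the left endpoint.\<close>

definition disc_err :: "real \<Rightarrow> real \<Rightarrow> 'a \<Rightarrow> real" where
  "disc_err s t \<omega> = disc s \<omega> *
    ((exp (- rate s t \<omega>) - 1 + rate s t \<omega>) * g \<bar>B t \<omega>\<bar> - rate s t \<omega> * (g \<bar>B t \<omega>\<bar> - g \<bar>B s \<omega>\<bar>))"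

lemma disc_pos: "0 < disc s \<omega>"
  by (simp add: disc_def)

lemma disc_le:
  assumes "\<omega> \<in> space M" "0 \<le> s" shows "disc s \<omega> \<le> exp (- (l * s))" "disc s \<omega> \<le> 1"
proof -
  have "0 \<le> l * s" "0 \<le> k * L s \<omega>" using L_nonneg[OF assms] pos assms by auto
  then show "disc s \<omega> \<le> exp (- (l * s))" "disc s \<omega> \<le> 1"
    by (auto simp: disc_def)
qed

lemma disc_measurable: "0 \<le> s \<Longrightarrow> disc s \<in> borel_measurable (F s)"
  using L_adapted[of s] by (simp add: disc_def[abs_def])

lemma disc_step: "disc t \<omega> = disc s \<omega> * exp (- rate s t \<omega>)"
  by (simp add: disc_def rate_def exp_add[symmetric] algebra_simps)

lemma rate_nonneg: "\<omega> \<in> space M \<Longrightarrow> 0 \<le> s \<Longrightarrow> s \<le> t \<Longrightarrow> 0 \<le> rate s t \<omega>"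
  using L_le[of \<omega> s t] pos by (simp add: rate_def)

text \<open>The first bound is a rate times a modulus of path continuity, small on fine grids by the
  Lipschitz property of \<open>g\<close>. The second uses only boundedness; it adds up over a grid
  to an integrable variable free of the mesh.\<close>

lemma disc_err_le:
  assumes \<omega>: "\<omega> \<in> space M" and st: "0 \<le> s" "s \<le> t"
  shows "\<bar>disc_err s t \<omega>\<bar> \<le> C * rate s t \<omega> * (rate s t \<omega> + \<bar>B t \<omega> - B s \<omega>\<bar>)"
    and "\<bar>disc_err s t \<omega>\<bar> \<le> 3 * C * rate s t \<omega>"
proof -
  define a where "a = rate s t \<omega>"
  have a: "0 \<le> a" using rate_nonneg[OF assms] by (simp add: a_def)
  note e = exp_minus_second_order[OF a]
  let ?E = "exp (- a) - 1 + a"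
  have C: "0 \<le> C" "\<bar>g \<bar>B t \<omega>\<bar>\<bar> \<le> C" "\<bar>g \<bar>B s \<omega>\<bar>\<bar> \<le> C" using bounded C_nonneg by auto
  have "\<bar>disc_err s t \<omega>\<bar> \<le> 1 * (\<bar>?E * g \<bar>B t \<omega>\<bar>\<bar> + \<bar>a * (g \<bar>B t \<omega>\<bar> - g \<bar>B s \<omega>\<bar>)\<bar>)"
    unfolding disc_err_def a_def[symmetric] abs_mult[of "disc s \<omega>"]
    using disc_pos[of s \<omega>] disc_le[OF \<omega> st(1)] by (intro mult_mono abs_triangle_ineq4) auto
  also have "\<dots> = ?E * \<bar>g \<bar>B t \<omega>\<bar>\<bar> + a * \<bar>g \<bar>B t \<omega>\<bar> - g \<bar>B s \<omega>\<bar>\<bar>"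
    using e(1) a by (simp add: abs_mult)
  finally have 1: "\<bar>disc_err s t \<omega>\<bar> \<le> ?E * \<bar>g \<bar>B t \<omega>\<bar>\<bar> + a * \<bar>g \<bar>B t \<omega>\<bar> - g \<bar>B s \<omega>\<bar>\<bar>" .
  have "?E * \<bar>g \<bar>B t \<omega>\<bar>\<bar> + a * \<bar>g \<bar>B t \<omega>\<bar> - g \<bar>B s \<omega>\<bar>\<bar> \<le> a\<^sup>2 * C + a * (C * \<bar>B t \<omega> - B s \<omega>\<bar>)"
  proof (intro add_mono mult_mono mult_left_mono)
    have "\<bar>g \<bar>B t \<omega>\<bar> - g \<bar>B s \<omega>\<bar>\<bar> \<le> C * \<bar>\<bar>B t \<omega>\<bar> - \<bar>B s \<omega>\<bar>\<bar>" by (rule lipschitz) auto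
    also have "\<dots> \<le> C * \<bar>B t \<omega> - B s \<omega>\<bar>" using C by (intro mult_left_mono abs_triangle_ineq3)
    finally show "\<bar>g \<bar>B t \<omega>\<bar> - g \<bar>B s \<omega>\<bar>\<bar> \<le> C * \<bar>B t \<omega> - B s \<omega>\<bar>" .
  qed (use e a C in auto)
  also have "\<dots> = C * a * (a + \<bar>B t \<omega> - B s \<omega>\<bar>)" by (simp add: algebra_simps power2_eq_square)
  finally show "\<bar>disc_err s t \<omega>\<bar> \<le> C * rate s t \<omega> * (rate s t \<omega> + \<bar>B t \<omega> - B s \<omega>\<bar>)"
    using 1 unfolding a_def by linarith
  have "?E * \<bar>g \<bar>B t \<omega>\<bar>\<bar> + a * \<bar>g \<bar>B t \<omega>\<bar> - g \<bar>B s \<omega>\<bar>\<bar> \<le> a * C + a * (2 * C)"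
    using e a C by (intro add_mono mult_mono) auto
  then show "\<bar>disc_err s t \<omega>\<bar> \<le> 3 * C * rate s t \<omega>"
    using 1 unfolding a_def by (simp add: algebra_simps)
qed

lemma gB_measurable:
  assumes "0 \<le> s"
  shows "(\<lambda>\<omega>. f \<bar>B s \<omega>\<bar>) \<in> borel_measurable (F s)" "(\<lambda>\<omega>. g \<bar>B s \<omega>\<bar>) \<in> borel_measurable (F s)"
    "(\<lambda>\<omega>. g' \<bar>B s \<omega>\<bar>) \<in> borel_measurable (F s)"
  using measurable_abs[OF _ B_adapted[OF assms]] cont by auto

lemma measurable_P:
  assumes "0 \<le> s"
  shows "(\<lambda>\<omega>. f \<bar>B s \<omega>\<bar>) \<in> borel_measurable (P x)" "(\<lambda>\<omega>. g \<bar>B s \<omega>\<bar>) \<in> borel_measurable (P x)"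
    "(\<lambda>\<omega>. g' \<bar>B s \<omega>\<bar>) \<in> borel_measurable (P x)" "disc s \<in> borel_measurable (P x)"
  using assms by (auto intro!: measurable_F_P[OF assms] gB_measurable disc_measurable)

lemma disc_err_integrable:
  assumes st: "0 \<le> s" "s \<le> t"
  shows "integrable (P x) (disc_err s t)"
proof (rule Bochner_Integration.integrable_bound)
  have t: "0 \<le> t" using st by simp
  note [measurable] = measurable_P[OF st(1), of x] measurable_P[OF t, of x] L_measurable_P[OF t, of x] L_measurable_P[OF st(1), of x]
  show "integrable (P x) (\<lambda>\<omega>. 3 * C * rate s t \<omega>)"
    unfolding rate_def using integrable_L[OF t] integrable_L[OF st(1)] by auto
  show "disc_err s t \<in> borel_measurable (P x)"
    unfolding disc_err_def[abs_def] rate_def by measurable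
  show "AE \<omega> in P x. norm (disc_err s t \<omega>) \<le> norm (3 * C * rate s t \<omega>)"
    using disc_err_le(2)[OF _ st] rate_nonneg[OF _ st] C_nonneg by (auto simp: space_P intro!: AE_I2)
qed

text \<open>A left-endpoint summand of the Stieltjes integral of the discounted payoff against the
  clock.\<close>

definition gain :: "real \<Rightarrow> real \<Rightarrow> 'a \<Rightarrow> real" where
  "gain s t \<omega> = disc s \<omega> * f \<bar>B s \<omega>\<bar> * (clock \<gamma> L \<omega> t - clock \<gamma> L \<omega> s)"

text \<open>Three defects: the second order Taylor error of \<open>g\<close> along
  \<open>|B|\<close> (with \<open>l * g - f\<close> as half the second derivative), the replacement
  of the squared increment of \<open>|B|\<close> by that of \<open>B\<close>, and the coefficient
  \<open>\<gamma> * f - k * g + g'\<close> of the local time increment. The last one is written as a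
  deviation from its value at 0, which is 0 by \<open>boundary\<close>.\<close>

definition remainder :: "real \<Rightarrow> real \<Rightarrow> 'a \<Rightarrow> real" where
  "remainder s t \<omega> = disc s \<omega> *
    ((g \<bar>B t \<omega>\<bar> - g \<bar>B s \<omega>\<bar> - g' \<bar>B s \<omega>\<bar> * (\<bar>B t \<omega>\<bar> - \<bar>B s \<omega>\<bar>)
        - (l * g \<bar>B s \<omega>\<bar> - f \<bar>B s \<omega>\<bar>) * (\<bar>B t \<omega>\<bar> - \<bar>B s \<omega>\<bar>)\<^sup>2)
     - (l * g \<bar>B s \<omega>\<bar> - f \<bar>B s \<omega>\<bar>) * ((B t \<omega> - B s \<omega>)\<^sup>2 - (\<bar>B t \<omega>\<bar> - \<bar>B s \<omega>\<bar>)\<^sup>2)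
     + (\<gamma> * (f \<bar>B s \<omega>\<bar> - f 0) - k * (g \<bar>B s \<omega>\<bar> - g 0) + (g' \<bar>B s \<omega>\<bar> - g' 0)) * (L t \<omega> - L s \<omega>))"

text \<open>Pure algebra, valid on every path. The right side is arranged so that its first line has
  mean zero by Tanaka's formula and its second by the variance of Brownian increments; only
  \<open>remainder\<close> survives the expectation.\<close>

lemma step_identity:
  "disc t \<omega> * g \<bar>B t \<omega>\<bar> - disc s \<omega> * g \<bar>B s \<omega>\<bar> + gain s t \<omega> - disc_err s t \<omega> =
    disc s \<omega> * g' \<bar>B s \<omega>\<bar> * (\<bar>B t \<omega>\<bar> - \<bar>B s \<omega>\<bar>) - disc s \<omega> * g' \<bar>B s \<omega>\<bar> * (L t \<omega> - L s \<omega>)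
    + (disc s \<omega> * (l * g \<bar>B s \<omega>\<bar> - f \<bar>B s \<omega>\<bar>) * (B t \<omega> - B s \<omega>)\<^sup>2
      - disc s \<omega> * (l * g \<bar>B s \<omega>\<bar> - f \<bar>B s \<omega>\<bar>) * (t - s))
    + remainder s t \<omega>"
proof -
  \<comment> \<open>The exponential cancels between \<open>disc t\<close> and
    \<open>disc_err\<close>, so it can stay an opaque symbol and the rest is ring
    arithmetic.\<close>
  define E where "E = exp (- rate s t \<omega>)"
  show ?thesis
    unfolding gain_def disc_err_def remainder_def disc_step[of t \<omega> s] E_def[symmetric]
    unfolding rate_def clock_def boundary
    by (simp add: algebra_simps power2_eq_square)
qed

text \<open>The terms carrying \<open>\<epsilon>\<close> have sums of bounded mean, and those
  carrying \<open>D\<close> or \<open>(l + 1) * C\<close> have sums whose mean tends to 0. It is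
  essential that \<open>D\<close> depends on \<open>\<epsilon>\<close> alone and not on the path or
  the time step.\<close>

lemma remainder_bound:
  assumes \<epsilon>: "0 < \<epsilon>"
  shows "\<exists>D\<ge>0. \<forall>\<omega>\<in>space M. \<forall>s t. 0 \<le> s \<longrightarrow> s \<le> t \<longrightarrow> \<bar>remainder s t \<omega>\<bar> \<le>
      \<epsilon> * (B t \<omega> - B s \<omega>)\<^sup>2 + D * (B t \<omega> - B s \<omega>) ^ 4
      + (l + 1) * C * ((B t \<omega> - B s \<omega>)\<^sup>2 - (\<bar>B t \<omega>\<bar> - \<bar>B s \<omega>\<bar>)\<^sup>2)
      + \<epsilon> * (L t \<omega> - L s \<omega>) + D * (\<bar>B s \<omega>\<bar> * (L t \<omega> - L s \<omega>))"
proof -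
  obtain D1 where D1: "0 \<le> D1" "\<And>y z. 0 \<le> y \<Longrightarrow> 0 \<le> z \<Longrightarrow>
      \<bar>g z - g y - g' y * (z - y) - (l * g y - f y) * (z - y)\<^sup>2\<bar> \<le> \<epsilon> * (z - y)\<^sup>2 + D1 * (z - y) ^ 4"
    using taylor[OF \<epsilon>] by blast
  obtain D2 where D2: "0 \<le> D2" "\<And>y. 0 \<le> y \<Longrightarrow>
      \<bar>\<gamma> * (f y - f 0) - k * (g y - g 0) + (g' y - g' 0)\<bar> \<le> \<epsilon> + D2 * y"
    using near_0[OF \<epsilon>] by blast
  define D where "D = max D1 D2"
  have D: "0 \<le> D" "D1 \<le> D" "D2 \<le> D" using D1(1) by (auto simp: D_def)
  have "\<bar>remainder s t \<omega>\<bar> \<le>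
      \<epsilon> * (B t \<omega> - B s \<omega>)\<^sup>2 + D * (B t \<omega> - B s \<omega>) ^ 4
      + (l + 1) * C * ((B t \<omega> - B s \<omega>)\<^sup>2 - (\<bar>B t \<omega>\<bar> - \<bar>B s \<omega>\<bar>)\<^sup>2)
      + \<epsilon> * (L t \<omega> - L s \<omega>) + D * (\<bar>B s \<omega>\<bar> * (L t \<omega> - L s \<omega>))"
    if \<omega>: "\<omega> \<in> space M" and st: "0 \<le> s" "s \<le> t" for \<omega> s t
  proof -
    define y z dB where "y = \<bar>B s \<omega>\<bar>" and "z = \<bar>B t \<omega>\<bar>" and "dB = B t \<omega> - B s \<omega>"
    define dL where "dL = L t \<omega> - L s \<omega>"
    have nn: "0 \<le> y" "0 \<le> z" "0 \<le> dL" using L_le[OF \<omega> st] by (auto simp: y_def z_def dL_def)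
    have sq: "(z - y)\<^sup>2 \<le> dB\<^sup>2" unfolding y_def z_def dB_def by (rule abs_increment_square_le)
    have "(z - y) ^ 4 = ((z - y)\<^sup>2)\<^sup>2" "dB ^ 4 = (dB\<^sup>2)\<^sup>2" by simp_all
    with sq have q4: "(z - y) ^ 4 \<le> dB ^ 4" by (metis power_mono zero_le_power2)
    let ?a = "g z - g y - g' y * (z - y) - (l * g y - f y) * (z - y)\<^sup>2"
    let ?b = "(l * g y - f y) * (dB\<^sup>2 - (z - y)\<^sup>2)"
    let ?c = "(\<gamma> * (f y - f 0) - k * (g y - g 0) + (g' y - g' 0)) * dL"
    have a: "\<bar>?a\<bar> \<le> \<epsilon> * dB\<^sup>2 + D * dB ^ 4"
    proof (rule order_trans[OF D1(2)[OF nn(1,2)]])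
      have "0 \<le> (z - y) ^ 4" by (rule zero_le_even_power) simp
      then show "\<epsilon> * (z - y)\<^sup>2 + D1 * (z - y) ^ 4 \<le> \<epsilon> * dB\<^sup>2 + D * dB ^ 4"
        using sq q4 D \<epsilon> by (intro add_mono mult_mono) auto
    qed
    have lg: "\<bar>l * g y - f y\<bar> \<le> (l + 1) * C"
    proof -
      have "\<bar>l * g y\<bar> \<le> l * C" using bounded(2)[OF nn(1)] pos by (simp add: abs_mult)
      then show ?thesis using bounded(1)[OF nn(1)] by (simp add: algebra_simps)
    qed
    have b: "\<bar>?b\<bar> \<le> (l + 1) * C * (dB\<^sup>2 - (z - y)\<^sup>2)"
      unfolding abs_mult using sq lg by (simp add: mult_right_mono)
    have c: "\<bar>?c\<bar> \<le> \<epsilon> * dL + D * (y * dL)"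
    proof -
      have "\<bar>?c\<bar> \<le> (\<epsilon> + D2 * y) * dL"
        unfolding abs_mult using D2(2)[OF nn(1)] nn by (simp add: mult_right_mono)
      also have "\<dots> \<le> (\<epsilon> + D * y) * dL" using D nn by (intro mult_right_mono add_left_mono) auto
      finally show ?thesis by (simp add: algebra_simps)
    qed
    have "remainder s t \<omega> = disc s \<omega> * (?a - ?b + ?c)"
      by (simp add: remainder_def y_def z_def dB_def dL_def)
    then have "\<bar>remainder s t \<omega>\<bar> = disc s \<omega> * \<bar>?a - ?b + ?c\<bar>" using disc_pos[of s \<omega>] by (simp add: abs_mult)
    also have "\<dots> \<le> \<bar>?a - ?b + ?c\<bar>"
      using disc_pos[of s \<omega>] disc_le(2)[OF \<omega> st(1)] by (intro mult_left_le_one_le) auto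
    also have "\<dots> \<le> \<bar>?a\<bar> + \<bar>?b\<bar> + \<bar>?c\<bar>" by linarith
    finally show ?thesis using a b c unfolding y_def z_def dB_def dL_def by linarith
  qed
  then show ?thesis using D(1) by (intro exI[of _ D]) auto
qed

lemma integrable_clock_diff:
  assumes "0 \<le> s" "s \<le> t" shows "integrable (P x) (\<lambda>\<omega>. clock \<gamma> L \<omega> t - clock \<gamma> L \<omega> s)"
  unfolding clock_def using integrable_L[of s x] integrable_L[of t x] assms by simp

lemma integrable_gain:
  assumes st: "0 \<le> s" "s \<le> t" shows "integrable (P x) (gain s t)"
  unfolding gain_def[abs_def]
proof (rule integrable_bounded_mult[OF _ _ integrable_clock_diff[OF st]])
  show "\<bar>disc s \<omega> * f \<bar>B s \<omega>\<bar>\<bar> \<le> 1 * C" if "\<omega> \<in> space M" for \<omega>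
    unfolding abs_mult using disc_pos[of s \<omega>] disc_le(2)[OF that st(1)] bounded(1) by (intro mult_mono) auto
qed (use measurable_P[OF st(1)] in auto)

lemma integrable_disc_g:
  assumes "0 \<le> s" shows "integrable (P x) (\<lambda>\<omega>. disc s \<omega> * g \<bar>B s \<omega>\<bar>)"
proof (rule integrable_bounded[of _ _ "1 * C"])
  show "\<bar>disc s \<omega> * g \<bar>B s \<omega>\<bar>\<bar> \<le> 1 * C" if "\<omega> \<in> space M" for \<omega>
    unfolding abs_mult using disc_pos[of s \<omega>] disc_le(2)[OF that assms] bounded(2) by (intro mult_mono) auto
qed (use measurable_P[OF assms] in auto)

text \<open>Integrability of \<open>remainder\<close> is read off \<open>step_identity\<close>, as
  all other terms there are integrable: \<open>disc * g'\<close> is tested against Tanaka's formula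
  and \<open>disc * (l * g - f)\<close> against the squared increments.\<close>

lemma remainder_expectation:
  assumes st: "0 \<le> s" "s \<le> t"
  shows "integrable (P x) (remainder s t)"
    and "(\<integral>\<omega>. disc t \<omega> * g \<bar>B t \<omega>\<bar> - disc s \<omega> * g \<bar>B s \<omega>\<bar> + gain s t \<omega> - disc_err s t \<omega> \<partial>P x)
      = (\<integral>\<omega>. remainder s t \<omega> \<partial>P x)"
proof -
  have t: "0 \<le> t" using st by simp
  let ?w = "\<lambda>\<omega>. disc s \<omega> * g' \<bar>B s \<omega>\<bar>" and ?v = "\<lambda>\<omega>. disc s \<omega> * (l * g \<bar>B s \<omega>\<bar> - f \<bar>B s \<omega>\<bar>)"
  have wm: "?w \<in> borel_measurable (F s)" and vm: "?v \<in> borel_measurable (F s)"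
    using gB_measurable[OF st(1)] disc_measurable[OF st(1)] by auto
  have wb: "\<bar>?w \<omega>\<bar> \<le> C" if "\<omega> \<in> space M" for \<omega>
    using disc_pos[of s \<omega>] disc_le(2)[OF that st(1)] bounded(3)[of "\<bar>B s \<omega>\<bar>"] C_nonneg
      mult_mono[of "disc s \<omega>" 1 "\<bar>g' \<bar>B s \<omega>\<bar>\<bar>" C] by (simp add: abs_mult)
  have "integrable (P x) (\<lambda>\<omega>. (?w \<omega>)\<^sup>2)"
  proof (rule integrable_bounded[of _ _ "C\<^sup>2"])
    show "\<bar>(?w \<omega>)\<^sup>2\<bar> \<le> C\<^sup>2" if "\<omega> \<in> space M" for \<omega>
      using wb[OF that] power_mono[OF wb[OF that], of 2] by (simp only: abs_power2 power2_abs abs_ge_zero)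
  qed (use measurable_F_P[OF st(1) wm] in simp)
  note w = tanaka_increment[OF st wm this]
  have vb: "\<bar>?v \<omega>\<bar> \<le> 1 * (l * C + C)" if "\<omega> \<in> space M" for \<omega>
    unfolding abs_mult[of "disc s \<omega>"]
  proof (intro mult_mono)
    have "\<bar>l * g \<bar>B s \<omega>\<bar>\<bar> \<le> l * C" using bounded(2)[of "\<bar>B s \<omega>\<bar>"] pos by (simp add: abs_mult)
    then show "\<bar>l * g \<bar>B s \<omega>\<bar> - f \<bar>B s \<omega>\<bar>\<bar> \<le> l * C + C" using bounded(1)[of "\<bar>B s \<omega>\<bar>"] by simp
  qed (use disc_pos[of s \<omega>] disc_le(2)[OF that st(1)] in auto)
  have vi: "integrable (P x) ?v" by (rule integrable_bounded[OF measurable_F_P[OF st(1) vm] vb])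
  note v = integral_mult_increment_2[OF st vm vi]
  have vt: "integrable (P x) (\<lambda>\<omega>. ?v \<omega> * (t - s))" using vi by (rule integrable_mult_left)
  define lhs where "lhs \<omega> = disc t \<omega> * g \<bar>B t \<omega>\<bar> - disc s \<omega> * g \<bar>B s \<omega>\<bar> + gain s t \<omega> - disc_err s t \<omega>" for \<omega>
  have lhs: "integrable (P x) lhs"
    unfolding lhs_def[abs_def] by (intro Bochner_Integration.integrable_add Bochner_Integration.integrable_diff
        integrable_disc_g integrable_gain disc_err_integrable st t)
  have eq: "remainder s t \<omega> = lhs \<omega> - (?w \<omega> * (\<bar>B t \<omega>\<bar> - \<bar>B s \<omega>\<bar>) - ?w \<omega> * (L t \<omega> - L s \<omega>))
      - (?v \<omega> * (B t \<omega> - B s \<omega>)\<^sup>2 - ?v \<omega> * (t - s))" for \<omega>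
    using step_identity[of t \<omega> s] unfolding lhs_def by linarith
  show "integrable (P x) (remainder s t)"
    unfolding eq[abs_def] by (intro Bochner_Integration.integrable_diff lhs w v vt)
  have "(\<integral>\<omega>. remainder s t \<omega> \<partial>P x) = (\<integral>\<omega>. lhs \<omega> \<partial>P x)
      - ((\<integral>\<omega>. ?w \<omega> * (\<bar>B t \<omega>\<bar> - \<bar>B s \<omega>\<bar>) \<partial>P x) - (\<integral>\<omega>. ?w \<omega> * (L t \<omega> - L s \<omega>) \<partial>P x))
      - ((\<integral>\<omega>. ?v \<omega> * (B t \<omega> - B s \<omega>)\<^sup>2 \<partial>P x) - (\<integral>\<omega>. ?v \<omega> * (t - s) \<partial>P x))"
    unfolding eq using lhs w(1,2) v(1) vt
    by (simp only: Bochner_Integration.integral_diff Bochner_Integration.integrable_diff)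
  then show "(\<integral>\<omega>. disc t \<omega> * g \<bar>B t \<omega>\<bar> - disc s \<omega> * g \<bar>B s \<omega>\<bar> + gain s t \<omega> - disc_err s t \<omega> \<partial>P x)
      = (\<integral>\<omega>. remainder s t \<omega> \<partial>P x)"
    unfolding w(3) v(2) lhs_def by simp
qed

section \<open>Limits along refining partitions\<close>

lemma sum_remainder_tendsto_0:
  assumes T: "0 < T"
  shows "(\<lambda>n. \<Sum>i<n. \<integral>\<omega>. remainder (grid T n i) (grid T n (Suc i)) \<omega> \<partial>P x) \<longlonglongrightarrow> 0"
proof (rule tendsto_zero_epsilon)
  \<comment> \<open>The factor of \<open>\<epsilon>\<close>: over a grid the squared increments of
    \<open>B\<close> have total mean \<open>T\<close>, and those of \<open>L\<close> have total mean
    \<open>E L_T\<close>.\<close>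
  show "0 \<le> T + (\<integral>\<omega>. L T \<omega> \<partial>P x)"
    using T L_nonneg by (intro add_nonneg_nonneg Bochner_Integration.integral_nonneg_AE) (auto simp: space_P intro!: AE_I2)
next
  fix \<epsilon> :: real assume \<epsilon>: "0 < \<epsilon>"
  obtain D where D: "0 \<le> D" "\<And>\<omega> s t. \<omega> \<in> space M \<Longrightarrow> 0 \<le> s \<Longrightarrow> s \<le> t \<Longrightarrow> \<bar>remainder s t \<omega>\<bar> \<le>
      \<epsilon> * (B t \<omega> - B s \<omega>)\<^sup>2 + D * (B t \<omega> - B s \<omega>) ^ 4
      + (l + 1) * C * ((B t \<omega> - B s \<omega>)\<^sup>2 - (\<bar>B t \<omega>\<bar> - \<bar>B s \<omega>\<bar>)\<^sup>2)
      + \<epsilon> * (L t \<omega> - L s \<omega>) + D * (\<bar>B s \<omega>\<bar> * (L t \<omega> - L s \<omega>))"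
    using remainder_bound[OF \<epsilon>] by blast
  define S where "S s t = (\<integral>\<omega>. (B t \<omega> - B s \<omega>)\<^sup>2 - (\<bar>B t \<omega>\<bar> - \<bar>B s \<omega>\<bar>)\<^sup>2 \<partial>P x)" for s t
  define Q where "Q s t = (\<integral>\<omega>. \<bar>B s \<omega>\<bar> * (L t \<omega> - L s \<omega>) \<partial>P x)" for s t
  have le: "\<bar>\<integral>\<omega>. remainder s t \<omega> \<partial>P x\<bar> \<le> \<epsilon> * (t - s) + D * (3 * (t - s)\<^sup>2) + (l + 1) * C * S s t
      + \<epsilon> * ((\<integral>\<omega>. L t \<omega> \<partial>P x) - (\<integral>\<omega>. L s \<omega> \<partial>P x)) + D * Q s t" if st: "0 \<le> s" "s \<le> t" for s t
  proof -
    have t: "0 \<le> t" using st by simp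
    have abs: "(\<lambda>\<omega>. \<bar>B s \<omega>\<bar>) \<in> borel_measurable (F s)" "integrable (P x) (\<lambda>\<omega>. \<bar>B s \<omega>\<bar>\<^sup>2)"
      using B_adapted[OF st(1)] integrable_B_square[OF st(1)] by auto
    have i: "integrable (P x) (\<lambda>\<omega>. (B t \<omega> - B s \<omega>)\<^sup>2)" "integrable (P x) (\<lambda>\<omega>. (B t \<omega> - B s \<omega>) ^ 4)"
      "integrable (P x) (\<lambda>\<omega>. (B t \<omega> - B s \<omega>)\<^sup>2 - (\<bar>B t \<omega>\<bar> - \<bar>B s \<omega>\<bar>)\<^sup>2)"
      "integrable (P x) (\<lambda>\<omega>. L t \<omega> - L s \<omega>)" "integrable (P x) (\<lambda>\<omega>. \<bar>B s \<omega>\<bar> * (L t \<omega> - L s \<omega>))"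
      using integrable_increment_power[OF st] integrable_abs_increment_square[OF st] integrable_L[OF t] integrable_L[OF st(1)]
        tanaka_increment(2)[OF st abs] by auto
    have "\<bar>\<integral>\<omega>. remainder s t \<omega> \<partial>P x\<bar> \<le> (\<integral>\<omega>. \<bar>remainder s t \<omega>\<bar> \<partial>P x)"
      by (rule integral_abs_bound)
    also have "\<dots> \<le> (\<integral>\<omega>. \<epsilon> * (B t \<omega> - B s \<omega>)\<^sup>2 + D * (B t \<omega> - B s \<omega>) ^ 4
      + (l + 1) * C * ((B t \<omega> - B s \<omega>)\<^sup>2 - (\<bar>B t \<omega>\<bar> - \<bar>B s \<omega>\<bar>)\<^sup>2)
      + \<epsilon> * (L t \<omega> - L s \<omega>) + D * (\<bar>B s \<omega>\<bar> * (L t \<omega> - L s \<omega>)) \<partial>P x)"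
      by (intro integral_mono Bochner_Integration.integrable_add integrable_mult_right integrable_abs
          remainder_expectation(1)[OF st] i D(2)[OF _ st]) (simp add: space_P)
    also have "\<dots> = \<epsilon> * (\<integral>\<omega>. (B t \<omega> - B s \<omega>)\<^sup>2 \<partial>P x) + D * (\<integral>\<omega>. (B t \<omega> - B s \<omega>) ^ 4 \<partial>P x)
      + (l + 1) * C * S s t + \<epsilon> * (\<integral>\<omega>. L t \<omega> - L s \<omega> \<partial>P x) + D * Q s t"
      unfolding S_def Q_def using i
      by (simp only: Bochner_Integration.integral_add Bochner_Integration.integrable_add integrable_mult_right integral_mult_right_zero)
    also have "(\<integral>\<omega>. L t \<omega> - L s \<omega> \<partial>P x) = (\<integral>\<omega>. L t \<omega> \<partial>P x) - (\<integral>\<omega>. L s \<omega> \<partial>P x)"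
      using integrable_L[OF t] integrable_L[OF st(1)] by simp
    finally show ?thesis by (simp add: integral_increment_2[OF st] integral_increment_4[OF st])
  qed
  define Y where "Y n = 3 * D * T\<^sup>2 / real n + (l + 1) * C * (\<Sum>i<n. S (grid T n i) (grid T n (Suc i)))
      + D * (\<Sum>i<n. Q (grid T n i) (grid T n (Suc i)))" for n
  have "(\<lambda>n. \<Sum>i<n. S (grid T n i) (grid T n (Suc i))) \<longlonglongrightarrow> 0" "(\<lambda>n. \<Sum>i<n. Q (grid T n i) (grid T n (Suc i))) \<longlonglongrightarrow> 0"
    unfolding S_def Q_def by (rule square_gap_tendsto_0[OF T] weighted_local_time_tendsto_0[OF T])+
  then have Y: "Y \<longlonglongrightarrow> 0"
    unfolding Y_def by (intro tendsto_add_zero tendsto_mult_right_zero lim_const_over_n)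
  have "\<bar>\<Sum>i<n. \<integral>\<omega>. remainder (grid T n i) (grid T n (Suc i)) \<omega> \<partial>P x\<bar> \<le> \<epsilon> * (T + (\<integral>\<omega>. L T \<omega> \<partial>P x)) + Y n"
    if n: "1 \<le> n" for n
  proof -
    let ?EL = "\<lambda>t. \<integral>\<omega>. L t \<omega> \<partial>P x"
    have "\<bar>\<Sum>i<n. \<integral>\<omega>. remainder (grid T n i) (grid T n (Suc i)) \<omega> \<partial>P x\<bar>
        \<le> (\<Sum>i<n. \<bar>\<integral>\<omega>. remainder (grid T n i) (grid T n (Suc i)) \<omega> \<partial>P x\<bar>)" by (rule sum_abs)
    also have "\<dots> \<le> (\<Sum>i<n. \<epsilon> * (T / n) + D * (3 * (T / n)\<^sup>2) + (l + 1) * C * S (grid T n i) (grid T n (Suc i))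
      + \<epsilon> * (?EL (grid T n (Suc i)) - ?EL (grid T n i)) + D * Q (grid T n i) (grid T n (Suc i)))"
      using le[OF grid_nonneg grid_le_Suc] T by (intro sum_mono) (simp add: grid_Suc)
    also have "\<dots> = n * (\<epsilon> * (T / n)) + n * (D * (3 * (T / n)\<^sup>2)) + (l + 1) * C * (\<Sum>i<n. S (grid T n i) (grid T n (Suc i)))
        + \<epsilon> * (\<Sum>i<n. ?EL (grid T n (Suc i)) - ?EL (grid T n i)) + D * (\<Sum>i<n. Q (grid T n i) (grid T n (Suc i)))"
      by (simp only: sum.distrib sum_distrib_left sum_constant card_lessThan)
    also have "(\<Sum>i<n. ?EL (grid T n (Suc i)) - ?EL (grid T n i)) = ?EL T"
    proof -
      have "?EL 0 = (\<integral>\<omega>. 0 \<partial>P x)"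
        by (rule Bochner_Integration.integral_cong) (auto simp: space_P L_zero)
      then show ?thesis using sum_grid_telescope[OF n, of ?EL T] by simp
    qed
    also have "n * (\<epsilon> * (T / n)) + n * (D * (3 * (T / n)\<^sup>2)) + (l + 1) * C * (\<Sum>i<n. S (grid T n i) (grid T n (Suc i)))
        + \<epsilon> * ?EL T + D * (\<Sum>i<n. Q (grid T n i) (grid T n (Suc i))) = \<epsilon> * (T + ?EL T) + Y n"
      using n by (simp add: Y_def field_simps power2_eq_square)
    finally show ?thesis .
  qed
  with Y show "\<exists>Y. Y \<longlonglongrightarrow> 0 \<and> (\<forall>n\<ge>1. \<bar>\<Sum>i<n. \<integral>\<omega>. remainder (grid T n i) (grid T n (Suc i)) \<omega> \<partial>P x\<bar>
      \<le> \<epsilon> * (T + (\<integral>\<omega>. L T \<omega> \<partial>P x)) + Y n)" by blast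
qed

lemma sum_rate:
  assumes "1 \<le> n" "\<omega> \<in> space M"
  shows "(\<Sum>i<n. rate (grid T n i) (grid T n (Suc i)) \<omega>) = l * T + k * L T \<omega>"
  using sum_grid_telescope[OF assms(1), of "\<lambda>t. l * t + k * L t \<omega>" T] L_zero[OF assms(2)]
  by (simp add: rate_def algebra_simps)

text \<open>Unlike the remainder, this error vanishes path by path: it is quadratic in increments of
  continuous paths, and the rates add up to \<open>l * T + k * L T\<close>. Dominated convergence
  then gives the means.\<close>

lemma sum_disc_err_tendsto_0:
  assumes T: "0 < T"
  shows "(\<lambda>n. \<integral>\<omega>. (\<Sum>i<n. disc_err (grid T n i) (grid T n (Suc i)) \<omega>) \<partial>P x) \<longlonglongrightarrow> 0"
proof -
  let ?X = "\<lambda>n \<omega>. \<Sum>i<n. disc_err (grid T n i) (grid T n (Suc i)) \<omega>"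
  note g = grid_nonneg[of T] grid_le_Suc[of T]
  have "(\<lambda>n. \<integral>\<omega>. ?X n \<omega> \<partial>P x) \<longlonglongrightarrow> (\<integral>\<omega>. 0 \<partial>P x)"
  proof (rule integral_dominated_convergence[where w = "\<lambda>\<omega>. 3 * C * (l * T + k * L T \<omega>)"])
    show "integrable (P x) (\<lambda>\<omega>. 3 * C * (l * T + k * L T \<omega>))"
      using integrable_L[of T x] T by simp
    show "?X n \<in> borel_measurable (P x)" for n
      using disc_err_integrable[of "grid T n i" "grid T n (Suc i)" x for i] g T by (intro borel_measurable_sum) auto
    show "AE \<omega> in P x. norm (?X n \<omega>) \<le> 3 * C * (l * T + k * L T \<omega>)" for n
    proof (cases "1 \<le> n")
      case True
      have "norm (?X n \<omega>) \<le> 3 * C * (l * T + k * L T \<omega>)" if \<omega>: "\<omega> \<in> space M" for \<omega>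
      proof -
        have "norm (?X n \<omega>) \<le> (\<Sum>i<n. 3 * C * rate (grid T n i) (grid T n (Suc i)) \<omega>)"
          using disc_err_le(2)[OF \<omega>] g T by (intro sum_norm_le) auto
        also have "\<dots> = 3 * C * (l * T + k * L T \<omega>)"
          using sum_rate[OF True \<omega>, of T] by (simp flip: sum_distrib_left)
        finally show ?thesis .
      qed
      then show ?thesis by (auto simp: space_P intro!: AE_I2)
    next
      case False
      have "0 \<le> 3 * C * (l * T + k * L T \<omega>)" if "\<omega> \<in> space M" for \<omega>
        using L_nonneg[OF that, of T] T pos C_nonneg by simp
      then have "AE \<omega> in P x. 0 \<le> 3 * C * (l * T + k * L T \<omega>)"
        by (intro AE_I2) (simp only: space_P)
      moreover have "n = 0" using False by simp
      ultimately show ?thesis by simp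
    qed
    have "(\<lambda>n. ?X n \<omega>) \<longlonglongrightarrow> 0" if \<omega>: "\<omega> \<in> space M" for \<omega>
    proof (rule tendsto_zero_epsilon)
      show "0 \<le> 2 * C * (l * T + k * L T \<omega>)" using L_nonneg[OF \<omega>, of T] T pos C_nonneg by simp
      fix \<epsilon> :: real assume \<epsilon>: "0 < \<epsilon>"
      have "continuous_on {0..} (\<lambda>s. l * s + k * L s \<omega>)"
        by (intro continuous_intros L_continuous \<omega>)
      from grid_uniformly_continuous[OF this T \<epsilon>] obtain N1 where N1: "N1 \<ge> 1"
        "\<And>n i s. n \<ge> N1 \<Longrightarrow> i < n \<Longrightarrow> s \<in> {grid T n i..grid T n (Suc i)}
           \<Longrightarrow> \<bar>(l * s + k * L s \<omega>) - (l * grid T n i + k * L (grid T n i) \<omega>)\<bar> < \<epsilon>" by blast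
      from grid_uniformly_continuous[OF B_continuous[OF \<omega>] T \<epsilon>] obtain N2 where N2: "N2 \<ge> 1"
        "\<And>n i s. n \<ge> N2 \<Longrightarrow> i < n \<Longrightarrow> s \<in> {grid T n i..grid T n (Suc i)}
           \<Longrightarrow> \<bar>B s \<omega> - B (grid T n i) \<omega>\<bar> < \<epsilon>" by blast
      have le: "\<bar>?X n \<omega>\<bar> \<le> \<epsilon> * (2 * C * (l * T + k * L T \<omega>))" if n: "n \<ge> max N1 N2" for n
      proof -
        have "\<bar>?X n \<omega>\<bar> \<le> (\<Sum>i<n. \<bar>disc_err (grid T n i) (grid T n (Suc i)) \<omega>\<bar>)" by (rule sum_abs)
        also have "\<dots> \<le> (\<Sum>i<n. 2 * C * \<epsilon> * rate (grid T n i) (grid T n (Suc i)) \<omega>)"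
        proof (rule sum_mono)
          fix i assume "i \<in> {..<n}"
          then have i: "i < n" by simp
          let ?s = "grid T n i" and ?t = "grid T n (Suc i)"
          have st: "0 \<le> ?s" "?s \<le> ?t" using g T by auto
          have "rate ?s ?t \<omega> < \<epsilon>" using N1(2)[of n i ?t] n i st by (simp add: rate_def algebra_simps)
          moreover have "\<bar>B ?t \<omega> - B ?s \<omega>\<bar> < \<epsilon>" using N2(2)[of n i ?t] n i st by simp
          ultimately have "C * rate ?s ?t \<omega> * (rate ?s ?t \<omega> + \<bar>B ?t \<omega> - B ?s \<omega>\<bar>) \<le> C * rate ?s ?t \<omega> * (2 * \<epsilon>)"
            using rate_nonneg[OF \<omega> st] C_nonneg by (intro mult_left_mono) auto
          then show "\<bar>disc_err ?s ?t \<omega>\<bar> \<le> 2 * C * \<epsilon> * rate ?s ?t \<omega>"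
            using disc_err_le(1)[OF \<omega> st] by (simp add: mult_ac)
        qed
        also have "\<dots> = 2 * C * \<epsilon> * (l * T + k * L T \<omega>)"
          using sum_rate[of n \<omega> T] n N1(1) \<omega> by (simp flip: sum_distrib_left)
        finally show ?thesis by (simp add: mult_ac)
      qed
      \<comment> \<open>Uniform continuity says nothing about coarse grids; this null sequence
        absorbs the finitely many of them.\<close>
      let ?Y = "\<lambda>n. if n < max N1 N2 then \<bar>?X n \<omega>\<bar> else 0"
      have "?Y \<longlonglongrightarrow> 0"
        by (rule tendsto_eventually) (auto simp: eventually_sequentially intro!: exI[of _ "max N1 N2"])
      moreover have "\<bar>?X n \<omega>\<bar> \<le> \<epsilon> * (2 * C * (l * T + k * L T \<omega>)) + ?Y n" for n
      proof (cases "n < max N1 N2")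
        case True
        have "0 \<le> \<epsilon> * (2 * C * (l * T + k * L T \<omega>))"
          by (rule mult_nonneg_nonneg[OF less_imp_le[OF \<epsilon>] \<open>0 \<le> 2 * C * (l * T + k * L T \<omega>)\<close>])
        then show ?thesis unfolding if_P[OF True] by linarith
      next
        case False
        then show ?thesis using le[of n] unfolding if_not_P[OF False] by linarith
      qed
      ultimately show "\<exists>Y. Y \<longlonglongrightarrow> 0 \<and> (\<forall>n\<ge>1. \<bar>?X n \<omega>\<bar> \<le> \<epsilon> * (2 * C * (l * T + k * L T \<omega>)) + Y n)"
        by blast
    qed
    then show "AE \<omega> in P x. (\<lambda>n. ?X n \<omega>) \<longlonglongrightarrow> 0" by (auto simp: space_P intro!: AE_I2)
  qed simp
  then show ?thesis by simp
qed

text \<open>A discrete Dynkin formula: in the summed expectations of \<open>step_identity\<close>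
  the means of \<open>disc * g |B|\<close> telescope, and both error sums tend to 0.\<close>

lemma sum_gain_tendsto:
  assumes T: "0 < T"
  shows "(\<lambda>n. \<integral>\<omega>. (\<Sum>i<n. gain (grid T n i) (grid T n (Suc i)) \<omega>) \<partial>P x)
    \<longlonglongrightarrow> g \<bar>x\<bar> - (\<integral>\<omega>. disc T \<omega> * g \<bar>B T \<omega>\<bar> \<partial>P x)"
proof -
  note gr = grid_nonneg[of T] grid_le_Suc[of T]
  let ?G = "\<lambda>t. \<integral>\<omega>. disc t \<omega> * g \<bar>B t \<omega>\<bar> \<partial>P x"
  have G0: "?G 0 = g \<bar>x\<bar>"
  proof -
    have "?G 0 = (\<integral>\<omega>. g \<bar>x\<bar> \<partial>P x)"
    proof (rule integral_cong_AE)
      show "AE \<omega> in P x. disc 0 \<omega> * g \<bar>B 0 \<omega>\<bar> = g \<bar>x\<bar>"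
        using B_start_AE[of x] AE_space by eventually_elim (simp add: disc_def L_zero space_P)
    qed (use measurable_P[of 0 x] in auto)
    then show ?thesis by (simp add: prob.prob_space)
  qed
  have eq: "(\<integral>\<omega>. (\<Sum>i<n. gain (grid T n i) (grid T n (Suc i)) \<omega>) \<partial>P x) =
      (g \<bar>x\<bar> - ?G T) + (\<integral>\<omega>. (\<Sum>i<n. disc_err (grid T n i) (grid T n (Suc i)) \<omega>) \<partial>P x)
      + (\<Sum>i<n. \<integral>\<omega>. remainder (grid T n i) (grid T n (Suc i)) \<omega> \<partial>P x)" if n: "1 \<le> n" for n
  proof -
    have e: "(\<integral>\<omega>. gain s t \<omega> \<partial>P x) = - (?G t - ?G s) + (\<integral>\<omega>. disc_err s t \<omega> \<partial>P x) + (\<integral>\<omega>. remainder s t \<omega> \<partial>P x)"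
      if st: "0 \<le> s" "s \<le> t" for s t
      using remainder_expectation(2)[OF st, of x] integrable_disc_g[OF st(1), of x] integrable_disc_g[of t x]
        integrable_gain[OF st, of x] disc_err_integrable[OF st, of x] st by simp
    have "(\<integral>\<omega>. (\<Sum>i<n. gain (grid T n i) (grid T n (Suc i)) \<omega>) \<partial>P x) = (\<Sum>i<n. \<integral>\<omega>. gain (grid T n i) (grid T n (Suc i)) \<omega> \<partial>P x)"
      using gr T by (intro Bochner_Integration.integral_sum integrable_gain) auto
    also have "\<dots> = (\<Sum>i<n. - (?G (grid T n (Suc i)) - ?G (grid T n i)) + (\<integral>\<omega>. disc_err (grid T n i) (grid T n (Suc i)) \<omega> \<partial>P x)
        + (\<integral>\<omega>. remainder (grid T n i) (grid T n (Suc i)) \<omega> \<partial>P x))"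
      using gr T by (intro sum.cong refl e) auto
    also have "\<dots> = - (\<Sum>i<n. ?G (grid T n (Suc i)) - ?G (grid T n i)) + (\<Sum>i<n. \<integral>\<omega>. disc_err (grid T n i) (grid T n (Suc i)) \<omega> \<partial>P x)
        + (\<Sum>i<n. \<integral>\<omega>. remainder (grid T n i) (grid T n (Suc i)) \<omega> \<partial>P x)"
      by (simp only: sum.distrib sum_negf)
    also have "(\<Sum>i<n. ?G (grid T n (Suc i)) - ?G (grid T n i)) = ?G T - g \<bar>x\<bar>"
      using sum_grid_telescope[OF n, of ?G T] G0 by simp
    also have "(\<Sum>i<n. \<integral>\<omega>. disc_err (grid T n i) (grid T n (Suc i)) \<omega> \<partial>P x) =
        (\<integral>\<omega>. (\<Sum>i<n. disc_err (grid T n i) (grid T n (Suc i)) \<omega>) \<partial>P x)"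
      using gr T by (intro Bochner_Integration.integral_sum[symmetric] disc_err_integrable) auto
    finally show ?thesis by simp
  qed
  have "(\<lambda>n. (g \<bar>x\<bar> - ?G T) + (\<integral>\<omega>. (\<Sum>i<n. disc_err (grid T n i) (grid T n (Suc i)) \<omega>) \<partial>P x)
      + (\<Sum>i<n. \<integral>\<omega>. remainder (grid T n i) (grid T n (Suc i)) \<omega> \<partial>P x)) \<longlonglongrightarrow> (g \<bar>x\<bar> - ?G T) + 0 + 0"
    by (intro tendsto_add tendsto_const sum_disc_err_tendsto_0 sum_remainder_tendsto_0 T)
  then show ?thesis
    by (rule Lim_transform_eventually[THEN tendsto_eq_rhs]) (auto simp: eventually_sequentially eq intro!: exI[of _ 1])
qed

end

section \<open>The time change\<close>

text \<open>Rounding time down to a multiple of \<open>1 / (n + 1)\<close> leaves countably many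
  sampling times, so the sampled process is jointly measurable, and path continuity passes this to
  the limit. The \<open>max 0 t\<close> freezes the path at negative times, about which nothing is
  assumed.\<close>

lemma measurable_continuous_paths:
  fixes X :: "real \<Rightarrow> 'a \<Rightarrow> real"
  assumes meas: "\<And>t. 0 \<le> t \<Longrightarrow> X t \<in> borel_measurable N"
    and cont: "\<And>\<omega>. \<omega> \<in> space N \<Longrightarrow> continuous_on {0..} (\<lambda>t. X t \<omega>)"
  shows "(\<lambda>(\<omega>, t). X (max 0 t) \<omega>) \<in> borel_measurable (N \<Otimes>\<^sub>M borel)"
proof (rule borel_measurable_LIMSEQ_real)
  let ?r = "\<lambda>n t. real (nat \<lfloor>real (Suc n) * max 0 t\<rfloor>) / real (Suc n)"
  show "(\<lambda>(\<omega>, t). X (?r n t) \<omega>) \<in> borel_measurable (N \<Otimes>\<^sub>M borel)" for n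
  proof -
    have 1: "(\<lambda>p. X (real j / real (Suc n)) (fst p)) \<in> borel_measurable (N \<Otimes>\<^sub>M borel)" for j :: nat
      by (rule measurable_compose[OF measurable_fst meas]) simp
    have 2: "(\<lambda>p. nat \<lfloor>real (Suc n) * max 0 (snd p)\<rfloor>) \<in> measurable (N \<Otimes>\<^sub>M (borel :: real measure)) (count_space UNIV)"
      by measurable
    show ?thesis
      using measurable_compose_countable[where f = "\<lambda>j p. X (real j / real (Suc n)) (fst p)", OF 1 2]
      by (simp only: case_prod_unfold)
  qed
  fix p :: "'a \<times> real" assume "p \<in> space (N \<Otimes>\<^sub>M borel)"
  then obtain \<omega> t where p: "p = (\<omega>, t)" "\<omega> \<in> space N" by (cases p) (auto simp: space_pair_measure)
  have "(\<lambda>n. ?r n t) \<longlonglongrightarrow> max 0 t"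
  proof (rule tendsto_sandwich)
    have b: "real (Suc n) * max 0 t - 1 \<le> real (nat \<lfloor>real (Suc n) * max 0 t\<rfloor>)"
      "real (nat \<lfloor>real (Suc n) * max 0 t\<rfloor>) \<le> real (Suc n) * max 0 t" for n
    proof -
      have "0 \<le> real (Suc n) * max 0 t" by simp
      then have "real (nat \<lfloor>real (Suc n) * max 0 t\<rfloor>) = of_int \<lfloor>real (Suc n) * max 0 t\<rfloor>" by simp
      then show "real (Suc n) * max 0 t - 1 \<le> real (nat \<lfloor>real (Suc n) * max 0 t\<rfloor>)"
        "real (nat \<lfloor>real (Suc n) * max 0 t\<rfloor>) \<le> real (Suc n) * max 0 t" by linarith+
    qed
    have eq: "max 0 t = (real (Suc n) * max 0 t) / real (Suc n)" for n
      by (simp del: of_nat_Suc)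
    have "max 0 t - 1 / real (Suc n) \<le> ?r n t" for n
    proof -
      have "max 0 t - 1 / real (Suc n) = (real (Suc n) * max 0 t - 1) / real (Suc n)"
        by (simp add: diff_divide_distrib del: of_nat_Suc)
      also have "\<dots> \<le> ?r n t" by (rule divide_right_mono[OF b(1)]) simp
      finally show ?thesis .
    qed
    then show "\<forall>\<^sub>F n in sequentially. max 0 t - 1 / real (Suc n) \<le> ?r n t" by simp
    have "?r n t \<le> max 0 t" for n
      by (subst eq[of n]) (rule divide_right_mono[OF b(2)], simp)
    then show "\<forall>\<^sub>F n in sequentially. ?r n t \<le> max 0 t" by simp
    show "(\<lambda>n. max 0 t - 1 / real (Suc n)) \<longlonglongrightarrow> max 0 t"
      using tendsto_diff[OF tendsto_const LIMSEQ_inverse_real_of_nat, of "max 0 t"] by (simp add: inverse_eq_divide)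
  qed simp
  then have "(\<lambda>n. X (?r n t) \<omega>) \<longlonglongrightarrow> X (max 0 t) \<omega>"
    by (rule continuous_on_tendsto_compose[OF cont[OF p(2)]]) auto
  then show "(\<lambda>n. case p of (\<omega>, t) \<Rightarrow> X (?r n t) \<omega>) \<longlonglongrightarrow> (case p of (\<omega>, t) \<Rightarrow> X (max 0 t) \<omega>)"
    by (simp add: p)
qed

lemma set_integrable_exp_minus:
  assumes "0 < (l :: real)"
  shows "set_integrable lborel {0..} (\<lambda>t. exp (- l * t))" "(LBINT t:{0..}. exp (- l * t)) = 1 / l"
proof -
  have has: "((\<lambda>t. exp (- l * t)) has_integral 1 / l) {0..}"
    using has_integral_exp_minus_to_infinity[OF assms, of 0] by simp
  then have "(\<lambda>t. exp (- l * t)) absolutely_integrable_on {0..}"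
    by (intro nonnegative_absolutely_integrable_1) auto
  then show 1: "set_integrable lborel {0..} (\<lambda>t. exp (- l * t))"
    unfolding set_integrable_def by (subst (asm) integrable_completion) auto
  show "(LBINT t:{0..}. exp (- l * t)) = 1 / l"
    using set_borel_integral_eq_integral(2)[OF 1] has by (simp add: integral_unique)
qed

section \<open>The inverse clock along a fixed path, and its measurability\<close>

context brownian_local_time
begin

context
  fixes \<gamma> :: real and \<omega> :: 'a
  assumes \<gamma>: "0 < \<gamma>" and \<omega>: "\<omega> \<in> space M"
begin

text \<open>The clock expands time because \<open>L\<close> increases. Hence its inverse is
  1-Lipschitz, which yields the continuity of all time-changed paths.\<close>

lemma clock_diff_ge: "0 \<le> s \<Longrightarrow> s \<le> t \<Longrightarrow> t - s \<le> clock \<gamma> L \<omega> t - clock \<gamma> L \<omega> s"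
  using mult_left_mono[OF L_le[OF \<omega>, of s t], of \<gamma>] \<gamma> by (simp add: clock_def)

lemma clock_0 [simp]: "clock \<gamma> L \<omega> 0 = 0"
  using L_zero[OF \<omega>] by (simp add: clock_def)

lemma clock_ge: "0 \<le> t \<Longrightarrow> t \<le> clock \<gamma> L \<omega> t"
  using clock_diff_ge[of 0 t] by simp

lemma time_change_nonneg: "0 \<le> t \<Longrightarrow> 0 \<le> time_change \<gamma> L \<omega> t"
  using the_inv_into_into[of "clock \<gamma> L \<omega>" "{0..}" t "{0..}"] bij_betw_clock[OF \<gamma> \<omega>]
  by (auto simp: time_change_def bij_betw_def)

lemma clock_time_change: "0 \<le> t \<Longrightarrow> clock \<gamma> L \<omega> (time_change \<gamma> L \<omega> t) = t"
  using f_the_inv_into_f_bij_betw[OF bij_betw_clock[OF \<gamma> \<omega>]] by (simp add: time_change_def)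

lemma time_change_clock: "0 \<le> t \<Longrightarrow> time_change \<gamma> L \<omega> (clock \<gamma> L \<omega> t) = t"
  using the_inv_into_f_f[of "clock \<gamma> L \<omega>" "{0..}" t] bij_betw_clock[OF \<gamma> \<omega>]
  by (auto simp: time_change_def bij_betw_def)

text \<open>Translates an event about the random time into one about \<open>L\<close> at the fixed
  time \<open>u\<close>, from which measurability of the time change follows.\<close>

lemma time_change_le_iff:
  assumes "0 \<le> t" "0 \<le> u" shows "time_change \<gamma> L \<omega> t \<le> u \<longleftrightarrow> t \<le> clock \<gamma> L \<omega> u"
  using clock_diff_ge[of "time_change \<gamma> L \<omega> t" u] clock_diff_ge[of u "time_change \<gamma> L \<omega> t"]
    clock_time_change[OF assms(1)] time_change_nonneg[OF assms(1)] assms by fastforce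

lemma time_change_mono: "0 \<le> s \<Longrightarrow> s \<le> t \<Longrightarrow> time_change \<gamma> L \<omega> s \<le> time_change \<gamma> L \<omega> t"
  using time_change_nonneg[of t] clock_time_change[of t] by (subst time_change_le_iff) auto

lemma time_change_diff_le:
  assumes "0 \<le> s" "s \<le> t"
  shows "time_change \<gamma> L \<omega> t - time_change \<gamma> L \<omega> s \<le> t - s"
  using clock_diff_ge[OF time_change_nonneg[OF assms(1)] time_change_mono[OF assms]] assms
  by (simp add: clock_time_change)

lemma time_change_continuous: "continuous_on {0..} (time_change \<gamma> L \<omega>)"
  unfolding continuous_on_iff
proof (intro ballI allI impI)
  fix s e :: real assume s: "s \<in> {0..}" and e: "0 < e"
  have "\<bar>time_change \<gamma> L \<omega> t - time_change \<gamma> L \<omega> s\<bar> \<le> \<bar>t - s\<bar>" if "0 \<le> t" for t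
    using time_change_diff_le[of s t] time_change_mono[of s t] time_change_diff_le[of t s] time_change_mono[of t s] s that
    by (cases "s \<le> t") auto
  then show "\<exists>d>0. \<forall>t\<in>{0..}. dist t s < d \<longrightarrow> dist (time_change \<gamma> L \<omega> t) (time_change \<gamma> L \<omega> s) < e"
    using e by (intro exI[of _ e]) (fastforce simp: dist_real_def)
qed

lemma compose_time_change_continuous:
  "continuous_on {0..} \<phi> \<Longrightarrow> continuous_on {0..} (\<lambda>t. \<phi> (time_change \<gamma> L \<omega> t))"
  by (erule continuous_on_compose2[OF _ time_change_continuous]) (auto intro: time_change_nonneg)

text \<open>Change of variables in a Stieltjes integral, done directly on Riemann sums. The clock
  maps a grid cell onto an interval whose length is the clock increment; on that interval the
  inverse clock stays in the cell, so the transported integrand differs from its left-endpoint value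
  by less than \<open>e\<close>.\<close>

lemma clock_grid_integral:
  fixes \<phi> :: "real \<Rightarrow> real"
  assumes \<phi>: "continuous_on {0..} \<phi>" and T: "0 < T"
  shows "(\<lambda>n. \<Sum>i<n. \<phi> (grid T n i) * (clock \<gamma> L \<omega> (grid T n (Suc i)) - clock \<gamma> L \<omega> (grid T n i)))
    \<longlonglongrightarrow> integral {0..clock \<gamma> L \<omega> T} (\<lambda>t. \<phi> (time_change \<gamma> L \<omega> t))"
proof -
  let ?c = "clock \<gamma> L \<omega>" and ?\<psi> = "\<lambda>t. \<phi> (time_change \<gamma> L \<omega> t)"
  note \<psi> = compose_time_change_continuous[OF \<phi>]
  have c: "0 \<le> ?c s" "?c s \<le> ?c t" if "0 \<le> s" "s \<le> t" for s t
    using clock_ge[of s] clock_diff_ge[OF that] that by auto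
  have int: "?\<psi> integrable_on {a..b}" if "0 \<le> a" for a b
    by (rule integrable_continuous_interval[OF continuous_on_subset[OF \<psi>]]) (use that in auto)
  have split: "integral {0..?c (grid T n m)} ?\<psi> = (\<Sum>i<m. integral {?c (grid T n i)..?c (grid T n (Suc i))} ?\<psi>)" for n m
  proof (induction m)
    case (Suc m)
    have "integral {0..?c (grid T n m)} ?\<psi> + integral {?c (grid T n m)..?c (grid T n (Suc m))} ?\<psi> =
        integral {0..?c (grid T n (Suc m))} ?\<psi>"
      using c[OF grid_nonneg grid_le_Suc, of T n m] T int[of 0]
      by (intro Henstock_Kurzweil_Integration.integral_combine) auto
    then show ?case using Suc.IH by simp
  qed simp
  let ?R = "\<lambda>n. \<Sum>i<n. \<phi> (grid T n i) * (?c (grid T n (Suc i)) - ?c (grid T n i))"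
  have "\<exists>N. \<forall>n\<ge>N. norm (?R n - integral {0..?c T} ?\<psi>) < r" if r: "0 < r" for r
  proof -
    define e where "e = r / (?c T + 1)"
    have cT: "0 \<le> ?c T" using c[of T T] T by simp
    have e: "0 < e" "e * ?c T < r" using r cT by (auto simp: e_def field_simps)
    obtain N where N: "N \<ge> 1" "\<And>n i s. n \<ge> N \<Longrightarrow> i < n \<Longrightarrow> s \<in> {grid T n i..grid T n (Suc i)} \<Longrightarrow> \<bar>\<phi> s - \<phi> (grid T n i)\<bar> < e"
      using grid_uniformly_continuous[OF \<phi> T e(1)] by blast
    have "norm (?R n - integral {0..?c T} ?\<psi>) < r" if n: "n \<ge> N" for n
    proof -
      have n1: "1 \<le> n" using N(1) n by simp
      have eq: "?R n - integral {0..?c T} ?\<psi> = (\<Sum>i<n. \<phi> (grid T n i) * (?c (grid T n (Suc i)) - ?c (grid T n i))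
          - integral {?c (grid T n i)..?c (grid T n (Suc i))} ?\<psi>)"
        using split[of n n] grid_end[OF n1, of T] by (simp add: sum_subtractf)
      have "norm (?R n - integral {0..?c T} ?\<psi>) \<le> (\<Sum>i<n. e * (?c (grid T n (Suc i)) - ?c (grid T n i)))"
        unfolding eq
      proof (rule sum_norm_le)
        fix i assume "i \<in> {..<n}"
        then have i: "i < n" by simp
        let ?s = "grid T n i" and ?t = "grid T n (Suc i)"
        have st: "0 \<le> ?s" "?s \<le> ?t" using grid_nonneg[of T n i] grid_le_Suc[of T n i] T by auto
        note cst = c[OF st]
        have eq': "\<phi> ?s * (?c ?t - ?c ?s) - integral {?c ?s..?c ?t} ?\<psi> = integral {?c ?s..?c ?t} (\<lambda>u. \<phi> ?s - ?\<psi> u)"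
          using cst int[OF cst(1)] by (subst Henstock_Kurzweil_Integration.integral_diff) auto
        show "norm (\<phi> ?s * (?c ?t - ?c ?s) - integral {?c ?s..?c ?t} ?\<psi>) \<le> e * (?c ?t - ?c ?s)"
          unfolding eq'
        proof (rule integral_bound[OF cst(2)])
          show "continuous_on {?c ?s..?c ?t} (\<lambda>u. \<phi> ?s - ?\<psi> u)"
            using cst by (intro continuous_intros continuous_on_subset[OF \<psi>]) auto
          fix u assume u: "u \<in> {?c ?s..?c ?t}"
          have "time_change \<gamma> L \<omega> u \<in> {?s..?t}"
            using u cst st time_change_mono[of "?c ?s" u] time_change_mono[of u "?c ?t"] time_change_clock[of ?s] time_change_clock[of ?t]
            by auto
          from N(2)[OF n i this] show "norm (\<phi> ?s - ?\<psi> u) \<le> e" by (simp add: abs_minus_commute)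
        qed
      qed
      also have "\<dots> = e * ?c T"
        unfolding sum_distrib_left[symmetric] sum_grid_telescope[OF n1, of ?c T] by simp
      finally show ?thesis using e(2) by linarith
    qed
    then show ?thesis by blast
  qed
  then show ?thesis by (intro LIMSEQ_I)
qed

text \<open>By monotonicity of \<open>Ls\<close>, survival at time \<open>t\<close> and
  \<open>Ls \<gamma> L t \<omega> \<le> s\<close> can differ only when \<open>t\<close> is the
  lifetime itself, a single time that Lebesgue measure ignores.\<close>

lemma lifetime_bounds:
  assumes "0 \<le> t"
  shows "ereal t < lifetime \<gamma> L (\<omega>, s) \<Longrightarrow> Ls \<gamma> L t \<omega> \<le> s"
    and "Ls \<gamma> L t \<omega> \<le> s \<Longrightarrow> ereal t \<le> lifetime \<gamma> L (\<omega>, s)"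
proof -
  assume "ereal t < lifetime \<gamma> L (\<omega>, s)"
  then show "Ls \<gamma> L t \<omega> \<le> s"
    using assms Inf_lower[of "ereal t" "{ereal t |t. 0 \<le> t \<and> s < Ls \<gamma> L t \<omega>}"]
    by (fastforce simp: lifetime_def not_le[symmetric])
next
  assume le: "Ls \<gamma> L t \<omega> \<le> s"
  have "t \<le> u" if "0 \<le> u" "s < Ls \<gamma> L u \<omega>" for u
  proof (rule ccontr)
    assume "\<not> t \<le> u"
    then have "Ls \<gamma> L u \<omega> \<le> Ls \<gamma> L t \<omega>"
      unfolding Ls_def using that by (intro L_le[OF \<omega>] time_change_nonneg time_change_mono) auto
    then show False using le that by simp
  qed
  then show "ereal t \<le> lifetime \<gamma> L (\<omega>, s)"
    by (auto simp: lifetime_def intro!: Inf_greatest)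
qed

end

lemma time_change_measurable:
  assumes "0 < \<gamma>" "0 \<le> t"
  shows "(\<lambda>\<omega>. time_change \<gamma> L \<omega> t) \<in> borel_measurable (P x)"
proof (rule borel_measurable_iff_le[THEN iffD2], intro allI)
  fix u :: real
  show "{\<omega> \<in> space (P x). time_change \<gamma> L \<omega> t \<le> u} \<in> sets (P x)"
  proof (cases "0 \<le> u")
    case True
    have "{\<omega> \<in> space (P x). time_change \<gamma> L \<omega> t \<le> u} = {\<omega> \<in> space (P x). t \<le> clock \<gamma> L \<omega> u}"
      using time_change_le_iff[OF assms(1) _ assms(2) True] by (auto simp: space_P)
    also have "\<dots> \<in> sets (P x)"
      using L_measurable_P[OF True, of x] unfolding clock_def by measurable
    finally show ?thesis .
  next
    case False
    then have "{\<omega> \<in> space (P x). time_change \<gamma> L \<omega> t \<le> u} = {}"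
      using time_change_nonneg[OF assms(1) _ assms(2)] by (force simp: space_P)
    then show ?thesis by (simp only: sets.empty_sets)
  qed
qed

lemma time_changed_measurable:
  assumes \<gamma>: "0 < \<gamma>"
  shows "(\<lambda>(\<omega>, t). Ls \<gamma> L (max 0 t) \<omega>) \<in> borel_measurable (P x \<Otimes>\<^sub>M borel)"
    and "(\<lambda>(\<omega>, t). Bs \<gamma> B L (max 0 t) \<omega>) \<in> borel_measurable (P x \<Otimes>\<^sub>M borel)"
proof -
  have \<tau>: "(\<lambda>(\<omega>, t). time_change \<gamma> L \<omega> (max 0 t)) \<in> borel_measurable (P x \<Otimes>\<^sub>M borel)"
    by (rule measurable_continuous_paths[where X = "\<lambda>t \<omega>. time_change \<gamma> L \<omega> t"])
       (auto intro: time_change_measurable time_change_continuous \<gamma> simp: space_P)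
  have joint: "(\<lambda>p. (fst p, time_change \<gamma> L (fst p) (max 0 (snd p)))) \<in> measurable (P x \<Otimes>\<^sub>M borel) (P x \<Otimes>\<^sub>M borel)"
    using \<tau> by (intro measurable_Pair measurable_fst) (simp add: case_prod_beta)
  \<comment> \<open>Joint measurability is available for \<open>L\<close> and \<open>B\<close>
    evaluated at \<open>max 0\<close> of a time; the inverse clock is nonnegative, so this
    truncation disappears.\<close>
  have nn: "max 0 (time_change \<gamma> L (fst p) (max 0 (snd p))) = time_change \<gamma> L (fst p) (max 0 (snd p))"
    if "p \<in> space (P x \<Otimes>\<^sub>M borel)" for p
    using that time_change_nonneg[OF \<gamma>, of "fst p" "max 0 (snd p)"] by (auto simp: space_pair_measure space_P)
  have "(\<lambda>(\<omega>, t). L (max 0 t) \<omega>) \<in> borel_measurable (P x \<Otimes>\<^sub>M borel)"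
    by (rule measurable_continuous_paths) (auto intro: L_measurable_P L_continuous simp: space_P)
  from measurable_compose[OF joint this]
  show "(\<lambda>(\<omega>, t). Ls \<gamma> L (max 0 t) \<omega>) \<in> borel_measurable (P x \<Otimes>\<^sub>M borel)"
    by (subst measurable_cong) (auto simp: Ls_def nn case_prod_beta)
  have "(\<lambda>(\<omega>, t). B (max 0 t) \<omega>) \<in> borel_measurable (P x \<Otimes>\<^sub>M borel)"
    by (rule measurable_continuous_paths) (auto intro: B_measurable_P B_continuous simp: space_P)
  from borel_measurable_abs[OF measurable_compose[OF joint this]]
  show "(\<lambda>(\<omega>, t). Bs \<gamma> B L (max 0 t) \<omega>) \<in> borel_measurable (P x \<Otimes>\<^sub>M borel)"
    by (subst measurable_cong) (auto simp: Bs_def nn case_prod_beta)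
qed

end

section \<open>Resolvents as expectations\<close>

lemma prob_space_exp_law:
  assumes "0 < \<beta>" shows "prob_space (exp_law \<beta>)"
  and exp_law_tail: "\<And>a. 0 \<le> a \<Longrightarrow> (\<integral>s. (if a \<le> s then 1 else 0 :: real) \<partial>exp_law \<beta>) = exp (- \<beta> * a)"
proof -
  let ?E = "density lborel (exponential_density \<beta>)"
  interpret E: prob_space ?E by (rule prob_space_exponential_density[OF assms])
  have D: "distributed ?E lborel (\<lambda>x. x) (exponential_density \<beta>)"
    unfolding distributed_def by (auto simp: distr_id2 erlang_density_nonneg assms less_imp_le)
  have tail: "measure ?E {a..} = exp (- \<beta> * a)" if "0 \<le> a" for a
  proof -
    have "measure ?E {a<..} = exp (- a * \<beta>)"
      using E.exponential_distributedD_gt[OF D that assms] by (simp add: greaterThan_def)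
    \<comment> \<open>The law has no atoms, so the strict tail may be replaced by the weak one, the
      form that \<open>lifetime_bounds\<close> leads to.\<close>
    moreover have "measure ?E {a..} = measure ?E {a<..}"
    proof (rule measure_eq_AE)
      have "AE x in lborel. x \<noteq> a" by (rule AE_lborel_singleton)
      then show "AE x in ?E. (x \<in> {a..}) = (x \<in> {a<..})"
        by (subst AE_density) auto
    qed auto
    ultimately show ?thesis by (simp add: mult.commute)
  qed
  \<comment> \<open>The tail at 0 says that the half line carries the full mass, so the restriction
    is still a probability.\<close>
  show "prob_space (exp_law \<beta>)"
    unfolding exp_law_def using tail[of 0] by (intro prob_space_restrict_space) (auto simp: E.emeasure_eq_measure)
  show "(\<integral>s. (if a \<le> s then 1 else 0 :: real) \<partial>exp_law \<beta>) = exp (- \<beta> * a)" if a: "0 \<le> a" for a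
  proof -
    have "(\<integral>s. (if a \<le> s then 1 else 0 :: real) \<partial>exp_law \<beta>) = (\<integral>s. indicator {a..} s \<partial>?E)"
      unfolding exp_law_def using a
      by (subst integral_restrict_space, simp, intro Bochner_Integration.integral_cong refl) (auto simp: indicator_def)
    then show ?thesis using tail[OF a] by simp
  qed
qed

lemma integral_swap_prob:
  fixes \<Phi> :: "'a \<Rightarrow> real \<Rightarrow> real"
  assumes N: "prob_space N"
    and \<Phi> [measurable]: "(\<lambda>(s, t). \<Phi> s t) \<in> borel_measurable (N \<Otimes>\<^sub>M lborel)"
    and e: "integrable lborel e" "\<And>s t. s \<in> space N \<Longrightarrow> \<bar>\<Phi> s t\<bar> \<le> e t"
  shows "(\<integral>s. (\<integral>t. \<Phi> s t \<partial>lborel) \<partial>N) = (\<integral>t. (\<integral>s. \<Phi> s t \<partial>N) \<partial>lborel)"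
    and "integrable N (\<lambda>s. \<integral>t. \<Phi> s t \<partial>lborel)"
proof -
  interpret N: prob_space N by fact
  interpret pair_sigma_finite N lborel ..
  have norm: "(\<integral>t. norm (\<Phi> s t) \<partial>lborel) \<le> (\<integral>t. e t \<partial>lborel)" and int: "integrable lborel (\<Phi> s)" if s: "s \<in> space N" for s
  proof -
    have [measurable]: "\<Phi> s \<in> borel_measurable lborel" using measurable_Pair2[OF \<Phi> s] by simp
    show int: "integrable lborel (\<Phi> s)"
      by (rule Bochner_Integration.integrable_bound[OF e(1)]) (use e(2)[OF s] in \<open>auto intro: order_trans abs_ge_self\<close>)
    show "(\<integral>t. norm (\<Phi> s t) \<partial>lborel) \<le> (\<integral>t. e t \<partial>lborel)"
      using int e s by (intro integral_mono) auto
  qed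
  have i: "integrable (N \<Otimes>\<^sub>M lborel) (\<lambda>(s, t). \<Phi> s t)"
  proof (rule Fubini_integrable)
    show "integrable N (\<lambda>s. \<integral>t. norm (case (s, t) of (s, t) \<Rightarrow> \<Phi> s t) \<partial>lborel)"
    proof (rule N.integrable_const_bound[of _ "\<integral>t. e t \<partial>lborel"])
      show "AE s in N. norm (\<integral>t. norm (case (s, t) of (s, t) \<Rightarrow> \<Phi> s t) \<partial>lborel) \<le> (\<integral>t. e t \<partial>lborel)"
        using norm by (intro AE_I2) (simp add: abs_of_nonneg)
    qed simp
  qed (use int in auto)
  from integrable_fst[OF i] show "integrable N (\<lambda>s. \<integral>t. \<Phi> s t \<partial>lborel)" by simp
  show "(\<integral>s. (\<integral>t. \<Phi> s t \<partial>lborel) \<partial>N) = (\<integral>t. (\<integral>s. \<Phi> s t \<partial>N) \<partial>lborel)"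
    using Fubini_integral[OF i] by simp
qed

section \<open>Expected discounted payoff in the new clock\<close>

context discounted
begin

text \<open>This dictates the choice of \<open>k\<close>. If \<open>u + \<gamma> * v = t\<close> is
  the clock equation for real time \<open>u\<close> and local time \<open>v\<close>, then
  \<open>l * u + (\<beta> + \<gamma> * l) * v = l * t + \<beta> * v\<close>.\<close>

lemma disc_time_change:
  assumes k: "k = \<beta> + \<gamma> * l" and \<omega>: "\<omega> \<in> space M" and t: "0 \<le> t"
  shows "disc (time_change \<gamma> L \<omega> t) \<omega> * f \<bar>B (time_change \<gamma> L \<omega> t) \<omega>\<bar> =
    exp (- l * t) * (exp (- \<beta> * Ls \<gamma> L t \<omega>) * f (Bs \<gamma> B L t \<omega>))"
proof -
  have "time_change \<gamma> L \<omega> t + \<gamma> * L (time_change \<gamma> L \<omega> t) \<omega> = t"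
    using clock_time_change[OF pos(3) \<omega> t] by (simp add: clock_def)
  moreover have "- (l * u) - k * v = - l * t + - \<beta> * v" if "u + \<gamma> * v = t" for u v
    by (simp add: that[symmetric] k algebra_simps)
  ultimately have "- (l * time_change \<gamma> L \<omega> t) - k * L (time_change \<gamma> L \<omega> t) \<omega> = - l * t + - \<beta> * L (time_change \<gamma> L \<omega> t) \<omega>"
    by blast
  then show ?thesis
    by (simp add: disc_def Ls_def Bs_def exp_add[symmetric])
qed

definition payoff :: "'a \<Rightarrow> real \<Rightarrow> real" where
  "payoff \<omega> t = disc (time_change \<gamma> L \<omega> t) \<omega> * f \<bar>B (time_change \<gamma> L \<omega> t) \<omega>\<bar>"

lemma payoff_continuous:
  assumes \<omega>: "\<omega> \<in> space M"
  shows "continuous_on {0..} (\<lambda>u. disc u \<omega> * f \<bar>B u \<omega>\<bar>)" "continuous_on {0..} (payoff \<omega>)"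
proof -
  have "continuous_on {0..} (\<lambda>u. f \<bar>B u \<omega>\<bar>)"
    by (rule continuous_on_compose2[OF cont(1)]) (auto intro!: continuous_intros B_continuous \<omega>)
  then show 1: "continuous_on {0..} (\<lambda>u. disc u \<omega> * f \<bar>B u \<omega>\<bar>)"
    unfolding disc_def by (intro continuous_intros L_continuous \<omega>)
  show "continuous_on {0..} (payoff \<omega>)"
    unfolding payoff_def[abs_def] by (rule compose_time_change_continuous[OF pos(3) \<omega> 1])
qed

context
  fixes \<beta> :: real
  assumes \<beta>: "0 < \<beta>" and k: "k = \<beta> + \<gamma> * l"
begin

lemma payoff_le:
  assumes \<omega>: "\<omega> \<in> space M" and t: "0 \<le> t"
  shows "\<bar>payoff \<omega> t\<bar> \<le> exp (- l * t) * C"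
proof -
  have "0 \<le> Ls \<gamma> L t \<omega>" unfolding Ls_def by (intro L_nonneg time_change_nonneg pos \<omega> t)
  then have "\<bar>exp (- \<beta> * Ls \<gamma> L t \<omega>) * f (Bs \<gamma> B L t \<omega>)\<bar> \<le> 1 * C"
    unfolding abs_mult using bounded(1) \<beta> by (intro mult_mono) (auto simp: Bs_def)
  then show ?thesis
    unfolding payoff_def disc_time_change[OF k \<omega> t] abs_mult[of "exp (- l * t)"] by (intro mult_mono) auto
qed

lemma payoff_integrable:
  assumes \<omega>: "\<omega> \<in> space M"
  shows "set_integrable lborel {0..} (payoff \<omega>)"
  unfolding set_integrable_def
proof (rule Bochner_Integration.integrable_bound)
  show "integrable lborel (\<lambda>t. indicator {0..} t *\<^sub>R exp (- l * t) * C)"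
    using set_integrable_exp_minus(1)[OF pos(1)] unfolding set_integrable_def by (rule integrable_mult_left)
  show "(\<lambda>t. indicat_real {0..} t *\<^sub>R payoff \<omega> t) \<in> borel_measurable lborel"
    using borel_measurable_continuous_on_indicator[OF _ payoff_continuous(2)[OF \<omega>]] by simp
  show "AE t in lborel. norm (indicat_real {0..} t *\<^sub>R payoff \<omega> t) \<le> norm (indicator {0..} t *\<^sub>R exp (- l * t) * C)"
    using payoff_le[OF \<omega>] C_nonneg by (auto simp: indicator_def)
qed

lemma payoff_interval_le:
  assumes \<omega>: "\<omega> \<in> space M" and S: "S \<subseteq> {0..}" "S \<in> sets borel"
  shows "\<bar>LBINT t:S. payoff \<omega> t\<bar> \<le> C / l"
proof -
  have int: "set_integrable lborel S (payoff \<omega>)"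
    by (rule set_integrable_subset[OF payoff_integrable[OF \<omega>]]) (use S in auto)
  have "\<bar>LBINT t:S. payoff \<omega> t\<bar> \<le> (\<integral>t. \<bar>indicator S t *\<^sub>R payoff \<omega> t\<bar> \<partial>lborel)"
    unfolding set_lebesgue_integral_def by (rule integral_abs_bound)
  also have "\<dots> \<le> (\<integral>t. (indicator {0..} t *\<^sub>R exp (- l * t)) * C \<partial>lborel)"
  proof (rule integral_mono)
    show "integrable lborel (\<lambda>t. \<bar>indicator S t *\<^sub>R payoff \<omega> t\<bar>)"
      using int unfolding set_integrable_def by (rule integrable_abs)
    show "integrable lborel (\<lambda>t. (indicator {0..} t *\<^sub>R exp (- l * t)) * C)"
      using set_integrable_exp_minus(1)[OF pos(1)] unfolding set_integrable_def by (rule integrable_mult_left)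
    show "\<bar>indicator S t *\<^sub>R payoff \<omega> t\<bar> \<le> (indicator {0..} t *\<^sub>R exp (- l * t)) * C" for t
      using payoff_le[OF \<omega>, of t] S C_nonneg by (auto simp: indicator_def)
  qed
  also have "\<dots> = C / l"
    using set_integrable_exp_minus(2)[OF pos(1)] unfolding set_lebesgue_integral_def by simp
  finally show ?thesis .
qed

text \<open>The same Riemann sums are evaluated in two ways: path by path they tend to the integral
  up to the random time \<open>clock \<gamma> L \<omega> T\<close>, and their means are known from
  \<open>sum_gain_tendsto\<close>. The clock at \<open>T\<close>, integrable like
  \<open>L T\<close>, dominates them.\<close>

lemma payoff_expectation_interval:
  assumes T: "0 < T"
  shows "(\<lambda>\<omega>. LBINT t:{0..clock \<gamma> L \<omega> T}. payoff \<omega> t) \<in> borel_measurable (P x)"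
    and "(\<integral>\<omega>. (LBINT t:{0..clock \<gamma> L \<omega> T}. payoff \<omega> t) \<partial>P x) = g \<bar>x\<bar> - (\<integral>\<omega>. disc T \<omega> * g \<bar>B T \<omega>\<bar> \<partial>P x)"
proof -
  note gr = grid_nonneg[of T] grid_le_Suc[of T]
  let ?J = "\<lambda>\<omega>. LBINT t:{0..clock \<gamma> L \<omega> T}. payoff \<omega> t"
  let ?X = "\<lambda>n \<omega>. \<Sum>i<n. gain (grid T n i) (grid T n (Suc i)) \<omega>"
  have lim: "(\<lambda>n. ?X n \<omega>) \<longlonglongrightarrow> ?J \<omega>" if \<omega>: "\<omega> \<in> space M" for \<omega>
  proof -
    have "set_integrable lborel {0..clock \<gamma> L \<omega> T} (payoff \<omega>)"
      by (rule set_integrable_subset[OF payoff_integrable[OF \<omega>]]) auto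
    from set_borel_integral_eq_integral(2)[OF this]
    show ?thesis
      using clock_grid_integral[OF pos(3) \<omega> payoff_continuous(1)[OF \<omega>] T] by (simp add: gain_def payoff_def[abs_def])
  qed
  have Xm: "?X n \<in> borel_measurable (P x)" for n
    using integrable_gain[of "grid T n i" "grid T n (Suc i)" x for i] gr T by (intro borel_measurable_sum) auto
  show Jm: "?J \<in> borel_measurable (P x)"
    by (rule borel_measurable_LIMSEQ_real[OF _ Xm]) (auto simp: space_P intro: lim)
  have "(\<lambda>n. \<integral>\<omega>. ?X n \<omega> \<partial>P x) \<longlonglongrightarrow> (\<integral>\<omega>. ?J \<omega> \<partial>P x)"
  proof (rule integral_dominated_convergence[where w = "\<lambda>\<omega>. C * clock \<gamma> L \<omega> T"])
    show "integrable (P x) (\<lambda>\<omega>. C * clock \<gamma> L \<omega> T)"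
      unfolding clock_def using integrable_L[of T x] T by simp
    show "AE \<omega> in P x. (\<lambda>n. ?X n \<omega>) \<longlonglongrightarrow> ?J \<omega>"
      using lim by (intro AE_I2) (auto simp: space_P)
    have "norm (?X n \<omega>) \<le> C * clock \<gamma> L \<omega> T" if \<omega>: "\<omega> \<in> space M" for n \<omega>
    proof (cases "1 \<le> n")
      case True
      have "norm (?X n \<omega>) \<le> (\<Sum>i<n. C * (clock \<gamma> L \<omega> (grid T n (Suc i)) - clock \<gamma> L \<omega> (grid T n i)))"
      proof (rule sum_norm_le)
        fix i assume "i \<in> {..<n}"
        let ?s = "grid T n i" and ?t = "grid T n (Suc i)"
        have st: "0 \<le> ?s" "?s \<le> ?t" using gr T by auto
        have "0 \<le> clock \<gamma> L \<omega> ?t - clock \<gamma> L \<omega> ?s"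
          using clock_diff_ge[OF pos(3) \<omega> st] st by linarith
        moreover have "\<bar>disc ?s \<omega> * f \<bar>B ?s \<omega>\<bar>\<bar> \<le> 1 * C"
          unfolding abs_mult using disc_pos[of ?s \<omega>] disc_le(2)[OF \<omega> st(1)] bounded(1) by (intro mult_mono) auto
        ultimately show "norm (gain ?s ?t \<omega>) \<le> C * (clock \<gamma> L \<omega> ?t - clock \<gamma> L \<omega> ?s)"
          unfolding gain_def real_norm_def abs_mult[of _ "clock \<gamma> L \<omega> ?t - clock \<gamma> L \<omega> ?s"]
          by (intro mult_mono) auto
      qed
      also have "\<dots> = C * clock \<gamma> L \<omega> T"
        unfolding sum_distrib_left[symmetric] sum_grid_telescope[OF True, of "clock \<gamma> L \<omega>"] clock_0[OF pos(3) \<omega>] by simp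
      finally show ?thesis .
    next
      case False
      then have "n = 0" by simp
      then show ?thesis using C_nonneg clock_ge[OF pos(3) \<omega>, of T] T by simp
    qed
    then show "AE \<omega> in P x. norm (?X n \<omega>) \<le> C * clock \<gamma> L \<omega> T" for n
      by (intro AE_I2) (simp only: space_P)
  qed (use Jm Xm in auto)
  then show "(\<integral>\<omega>. ?J \<omega> \<partial>P x) = g \<bar>x\<bar> - (\<integral>\<omega>. disc T \<omega> * g \<bar>B T \<omega>\<bar> \<partial>P x)"
    using sum_gain_tendsto[OF T, of x] LIMSEQ_unique by blast
qed

text \<open>As \<open>T\<close> grows, the clock grows at least as fast, the boundary term is at
  most \<open>exp (- (l * T)) * C\<close>, and the integrals are dominated by the constant
  \<open>C / l\<close>.\<close>

lemma payoff_expectation: "(\<integral>\<omega>. (LBINT t:{0..}. payoff \<omega> t) \<partial>P x) = g \<bar>x\<bar>"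
proof -
  let ?J = "\<lambda>n \<omega>. LBINT t:{0..clock \<gamma> L \<omega> (real (Suc n))}. payoff \<omega> t"
  let ?I = "\<lambda>\<omega>. LBINT t:{0..}. payoff \<omega> t"
  have Jm: "?J n \<in> borel_measurable (P x)" for n by (rule payoff_expectation_interval) simp
  have lim: "(\<lambda>n. ?J n \<omega>) \<longlonglongrightarrow> ?I \<omega>" if \<omega>: "\<omega> \<in> space M" for \<omega>
  proof -
    have "((\<lambda>y. LBINT t:{0..y}. payoff \<omega> t) \<longlongrightarrow> ?I \<omega>) at_top"
      by (rule tendsto_set_lebesgue_integral_at_top[OF _ payoff_integrable[OF \<omega>]]) simp
    moreover have "filterlim (\<lambda>n. clock \<gamma> L \<omega> (real (Suc n))) at_top sequentially"
    proof (rule filterlim_at_top_mono)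
      show "filterlim (\<lambda>n. real (Suc n)) at_top sequentially"
        by (rule filterlim_compose[OF filterlim_real_sequentially filterlim_Suc])
      show "\<forall>\<^sub>F n in sequentially. real (Suc n) \<le> clock \<gamma> L \<omega> (real (Suc n))"
        by (intro always_eventually allI clock_ge[OF pos(3) \<omega>]) simp
    qed
    ultimately show ?thesis by (rule filterlim_compose)
  qed
  have Im: "?I \<in> borel_measurable (P x)"
    by (rule borel_measurable_LIMSEQ_real[where u = ?J, OF lim Jm]) (simp add: space_P)
  have "(\<lambda>n. \<integral>\<omega>. ?J n \<omega> \<partial>P x) \<longlonglongrightarrow> (\<integral>\<omega>. ?I \<omega> \<partial>P x)"
  proof (rule integral_dominated_convergence[where w = "\<lambda>_. C / l"])
    show "AE \<omega> in P x. (\<lambda>n. ?J n \<omega>) \<longlonglongrightarrow> ?I \<omega>" using lim by (intro AE_I2) (auto simp: space_P)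
    show "AE \<omega> in P x. norm (?J n \<omega>) \<le> C / l" for n
      using payoff_interval_le by (intro AE_I2) (auto simp: space_P)
  qed (use Jm Im in auto)
  moreover have "(\<lambda>n. \<integral>\<omega>. ?J n \<omega> \<partial>P x) \<longlonglongrightarrow> g \<bar>x\<bar> - 0"
  proof -
    have le: "\<bar>\<integral>\<omega>. disc t \<omega> * g \<bar>B t \<omega>\<bar> \<partial>P x\<bar> \<le> exp (- (l * t)) * C" if t: "0 \<le> t" for t
    proof -
      have "\<bar>\<integral>\<omega>. disc t \<omega> * g \<bar>B t \<omega>\<bar> \<partial>P x\<bar> \<le> (\<integral>\<omega>. \<bar>disc t \<omega> * g \<bar>B t \<omega>\<bar>\<bar> \<partial>P x)"
        by (rule integral_abs_bound)
      also have "\<dots> \<le> (\<integral>\<omega>. exp (- (l * t)) * C \<partial>P x)"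
      proof (rule integral_mono)
        fix \<omega> assume "\<omega> \<in> space (P x)"
        then have \<omega>: "\<omega> \<in> space M" by (simp add: space_P)
        show "\<bar>disc t \<omega> * g \<bar>B t \<omega>\<bar>\<bar> \<le> exp (- (l * t)) * C"
          unfolding abs_mult using disc_pos[of t \<omega>] disc_le(1)[OF \<omega> t] bounded(2) by (intro mult_mono) auto
      qed (use integrable_disc_g[OF t] in auto)
      finally show ?thesis by (simp add: prob.prob_space)
    qed
    have "(\<lambda>n. exp (- l) ^ Suc n * C) \<longlonglongrightarrow> 0"
      using pos(1) by (intro tendsto_mult_left_zero LIMSEQ_Suc LIMSEQ_power_zero) simp
    moreover have "exp (- l) ^ Suc n = exp (- (l * real (Suc n)))" for n
      by (simp only: exp_of_nat_mult[symmetric] mult_minus_left mult_minus_right mult.commute)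
    ultimately have "(\<lambda>n. exp (- (l * real (Suc n))) * C) \<longlonglongrightarrow> 0" by simp
    then have "(\<lambda>n. \<integral>\<omega>. disc (real (Suc n)) \<omega> * g \<bar>B (real (Suc n)) \<omega>\<bar> \<partial>P x) \<longlonglongrightarrow> 0"
      by (rule Lim_null_comparison[rotated]) (use le[of "real (Suc n)" for n] in \<open>auto simp del: of_nat_Suc\<close>)
    then have "(\<lambda>n. g \<bar>x\<bar> - (\<integral>\<omega>. disc (real (Suc n)) \<omega> * g \<bar>B (real (Suc n)) \<omega>\<bar> \<partial>P x)) \<longlonglongrightarrow> g \<bar>x\<bar> - 0"
      by (intro tendsto_diff tendsto_const)
    then show ?thesis
      by (subst payoff_expectation_interval(2)) (auto simp del: of_nat_Suc)
  qed
  ultimately show ?thesis using LIMSEQ_unique by fastforce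
qed

text \<open>Killing is integrated out: for almost every \<open>t\<close> survival means
  \<open>Ls \<le> s\<close>, so integrating over \<open>S\<close> before time turns the indicator
  into \<open>exp (- \<beta> * Ls)\<close>, and what remains is the expected payoff.\<close>

lemma Rg_eq: "Rg P B L \<beta> \<gamma> l f x = g \<bar>x\<bar>"
proof -
  interpret E: prob_space "exp_law \<beta>" by (rule prob_space_exp_law[OF \<beta>])
  interpret PE: pair_prob_space "P x" "exp_law \<beta>" ..
  note tm = time_changed_measurable[OF pos(3), of x]
  \<comment> \<open>\<open>f\<close> is controlled only on the half line and paths only at
    nonnegative times. The absolute value, harmless since \<open>Bs\<close> is nonnegative, and the
    \<open>max 0 t\<close> keep \<open>\<Phi>\<close> measurable and bounded on the whole product
    space.\<close>
  define \<Phi> where "\<Phi> \<omega> s t = indicator {0..} t * (exp (- l * t) *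
      ((if Ls \<gamma> L (max 0 t) \<omega> \<le> s then 1 else 0) * f \<bar>Bs \<gamma> B L (max 0 t) \<omega>\<bar>))" for \<omega> s and t :: real
  let ?e = "\<lambda>t. (indicat_real {0..} t *\<^sub>R exp (- l * t)) * C"
  have e: "integrable lborel ?e"
    using set_integrable_exp_minus(1)[OF pos(1)] unfolding set_integrable_def by (rule integrable_mult_left)
  have \<Phi>_le: "\<bar>\<Phi> \<omega> s t\<bar> \<le> ?e t" for \<omega> s t
    using bounded(1)[of "\<bar>Bs \<gamma> B L (max 0 t) \<omega>\<bar>"] C_nonneg by (auto simp: \<Phi>_def indicator_def abs_mult)
  have fB: "(\<lambda>(\<omega>, t). f \<bar>Bs \<gamma> B L (max 0 t) \<omega>\<bar>) \<in> borel_measurable (P x \<Otimes>\<^sub>M borel)"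
    using measurable_abs[OF cont(1) tm(2)] by (simp add: case_prod_unfold)
  have sE: "(\<lambda>s. s) \<in> borel_measurable (exp_law \<beta>)"
    unfolding exp_law_def by (rule measurable_restrict_space1) simp
  have \<Phi>m: "(\<lambda>p. \<Phi> (fst (fst p)) (snd (fst p)) (snd p)) \<in> borel_measurable ((P x \<Otimes>\<^sub>M exp_law \<beta>) \<Otimes>\<^sub>M lborel)"
  proof -
    have j: "(\<lambda>p. (fst (fst p), snd p)) \<in> measurable ((P x \<Otimes>\<^sub>M exp_law \<beta>) \<Otimes>\<^sub>M lborel) (P x \<Otimes>\<^sub>M borel)"
      by measurable
    have [measurable]: "(\<lambda>p. Ls \<gamma> L (max 0 (snd p)) (fst (fst p))) \<in> borel_measurable ((P x \<Otimes>\<^sub>M exp_law \<beta>) \<Otimes>\<^sub>M lborel)"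
      "(\<lambda>p. f \<bar>Bs \<gamma> B L (max 0 (snd p)) (fst (fst p))\<bar>) \<in> borel_measurable ((P x \<Otimes>\<^sub>M exp_law \<beta>) \<Otimes>\<^sub>M lborel)"
      using measurable_compose[OF j tm(1)] measurable_compose[OF j fB] by (simp_all add: case_prod_unfold)
    have [measurable]: "(\<lambda>p. snd (fst p)) \<in> borel_measurable ((P x \<Otimes>\<^sub>M exp_law \<beta>) \<Otimes>\<^sub>M (lborel :: real measure))"
      by (rule measurable_compose[OF measurable_fst measurable_compose[OF measurable_snd sE]])
    show ?thesis unfolding \<Phi>_def by measurable
  qed
  have inner: "(LBINT t:{0..}. exp (- l * t) * ext_cemetery f (Bg \<gamma> B L t (\<omega>, s))) = (\<integral>t. \<Phi> \<omega> s t \<partial>lborel)"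
    if \<omega>: "\<omega> \<in> space M" for \<omega> s
    unfolding set_lebesgue_integral_def
  proof (rule integral_cong_AE)
    \<comment> \<open>The only time to discard is the lifetime. If it is infinite,
      \<open>real_of_ereal\<close> yields 0, and discarding that point is harmless as well.\<close>
    have "AE t in lborel. t \<noteq> real_of_ereal (lifetime \<gamma> L (\<omega>, s))" by (rule AE_lborel_singleton)
    then show "AE t in lborel. indicator {0..} t *\<^sub>R (exp (- l * t) * ext_cemetery f (Bg \<gamma> B L t (\<omega>, s))) = \<Phi> \<omega> s t"
    proof eventually_elim
      case (elim t)
      show ?case
      proof (cases "0 \<le> t")
        case True
        have "ereal t \<noteq> lifetime \<gamma> L (\<omega>, s)"
          using elim by (metis real_of_ereal.simps(1))
        then have "ereal t < lifetime \<gamma> L (\<omega>, s) \<longleftrightarrow> Ls \<gamma> L t \<omega> \<le> s"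
          using lifetime_bounds[OF pos(3) \<omega> True, of s] elim by (auto simp: le_less)
        then show ?thesis using True by (simp add: \<Phi>_def Bg_def ext_cemetery_def Bs_def)
      qed (simp add: \<Phi>_def)
    qed
    have p2: "(\<lambda>t. (\<omega>, t)) \<in> measurable lborel (P x \<Otimes>\<^sub>M borel)"
      using \<omega> by (intro measurable_Pair) (auto simp: space_P)
    have [measurable]: "(\<lambda>t. Ls \<gamma> L (max 0 t) \<omega>) \<in> borel_measurable lborel" "(\<lambda>t. f \<bar>Bs \<gamma> B L (max 0 t) \<omega>\<bar>) \<in> borel_measurable lborel"
      using measurable_compose[OF p2 tm(1)] measurable_compose[OF p2 fB] by simp_all
    show "\<Phi> \<omega> s \<in> borel_measurable lborel" unfolding \<Phi>_def[abs_def] by measurable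
    have "(\<lambda>t. indicat_real {0..} t *\<^sub>R (exp (- l * t) * ext_cemetery f (Bg \<gamma> B L t (\<omega>, s)))) =
       (\<lambda>t. indicat_real {0..} t * (exp (- l * t) * ((if ereal t < lifetime \<gamma> L (\<omega>, s) then 1 else 0) * f \<bar>Bs \<gamma> B L (max 0 t) \<omega>\<bar>)))"
      by (auto simp: fun_eq_iff Bg_def ext_cemetery_def Bs_def indicator_def)
    then show "(\<lambda>t. indicat_real {0..} t *\<^sub>R (exp (- l * t) * ext_cemetery f (Bg \<gamma> B L t (\<omega>, s)))) \<in> borel_measurable lborel"
      by simp
  qed
  have "Rg P B L \<beta> \<gamma> l f x = (\<integral>w. (\<integral>t. \<Phi> (fst w) (snd w) t \<partial>lborel) \<partial>(P x \<Otimes>\<^sub>M exp_law \<beta>))"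
    unfolding Rg_def
    by (rule Bochner_Integration.integral_cong) (auto simp: space_pair_measure space_P inner[simplified])
  also have "\<dots> = (\<integral>\<omega>. (\<integral>s. (\<integral>t. \<Phi> \<omega> s t \<partial>lborel) \<partial>exp_law \<beta>) \<partial>P x)"
    using integral_swap_prob(2)[OF PE.P.prob_space_axioms _ e, of "\<lambda>w. \<Phi> (fst w) (snd w)"] \<Phi>m \<Phi>_le
    by (subst PE.integral_fst'[symmetric]) (auto simp: case_prod_unfold)
  also have "\<dots> = (\<integral>\<omega>. (LBINT t:{0..}. payoff \<omega> t) \<partial>P x)"
  proof (rule Bochner_Integration.integral_cong[OF refl])
    fix \<omega> assume \<omega>P: "\<omega> \<in> space (P x)"
    then have \<omega>: "\<omega> \<in> space M" by (simp add: space_P)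
    have j: "(\<lambda>p. ((\<omega>, fst p), snd p)) \<in> measurable (exp_law \<beta> \<Otimes>\<^sub>M lborel) ((P x \<Otimes>\<^sub>M exp_law \<beta>) \<Otimes>\<^sub>M lborel)"
      using \<omega>P by (intro measurable_Pair) auto
    have m: "(\<lambda>(s, t). \<Phi> \<omega> s t) \<in> borel_measurable (exp_law \<beta> \<Otimes>\<^sub>M lborel)"
      using measurable_compose[OF j \<Phi>m] by (simp add: case_prod_unfold)
    have "(\<integral>s. (\<integral>t. \<Phi> \<omega> s t \<partial>lborel) \<partial>exp_law \<beta>) = (\<integral>t. (\<integral>s. \<Phi> \<omega> s t \<partial>exp_law \<beta>) \<partial>lborel)"
      by (rule integral_swap_prob(1)[OF E.prob_space_axioms m e \<Phi>_le])
    also have "\<dots> = (LBINT t:{0..}. payoff \<omega> t)"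
      unfolding set_lebesgue_integral_def
    proof (rule Bochner_Integration.integral_cong[OF refl])
      fix t :: real
      show "(\<integral>s. \<Phi> \<omega> s t \<partial>exp_law \<beta>) = indicator {0..} t *\<^sub>R payoff \<omega> t"
      proof (cases "0 \<le> t")
        case True
        have "0 \<le> Ls \<gamma> L t \<omega>" unfolding Ls_def by (intro L_nonneg time_change_nonneg pos \<omega> True)
        then show ?thesis
          unfolding payoff_def disc_time_change[OF k \<omega> True] \<Phi>_def
          using True exp_law_tail[OF \<beta>, of "Ls \<gamma> L t \<omega>"] by (simp add: Bs_def)
      qed (simp add: \<Phi>_def)
    qed
    finally show "(\<integral>s. (\<integral>t. \<Phi> \<omega> s t \<partial>lborel) \<partial>exp_law \<beta>) = (LBINT t:{0..}. payoff \<omega> t)" .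
  qed
  also have "\<dots> = g \<bar>x\<bar>" by (rule payoff_expectation)
  finally show ?thesis .
qed

end

end

section \<open>The resolvent equation on the half line\<close>

lemma C0_half_bounded:
  assumes "f \<in> C0_half"
  obtains K where "0 < K" "\<And>y. 0 \<le> y \<Longrightarrow> \<bar>f y\<bar> \<le> K"
proof -
  have f: "continuous_on {0..} f" "(f \<longlongrightarrow> 0) at_top" using assms by (auto simp: C0_half_def)
  obtain R where R: "\<And>y. R \<le> y \<Longrightarrow> \<bar>f y\<bar> < 1"
    using order_tendstoD(2)[OF tendsto_rabs_zero[OF f(2)], of 1] by (auto simp: eventually_at_top_linorder)
  have "bounded (f ` {0..R})"
    by (intro compact_imp_bounded compact_continuous_image continuous_on_subset[OF f(1)]) auto
  then obtain K where "\<forall>z\<in>f ` {0..R}. norm z \<le> K"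
    unfolding bounded_iff by blast
  then have K: "\<And>y. y \<in> {0..R} \<Longrightarrow> \<bar>f y\<bar> \<le> K" by auto
  have "\<bar>f y\<bar> \<le> \<bar>K\<bar> + 1" if "0 \<le> y" for y
    using K[of y] R[of y] that by (cases "y \<le> R") auto
  then show thesis by (intro that[of "\<bar>K\<bar> + 1"]) auto
qed

text \<open>Uniform continuity without a restriction on \<open>z - y\<close>: beyond the modulus
  \<open>r\<close> the trivial bound \<open>2 * K\<close> is below
  \<open>2 * K / r^2 * (z - y)^2\<close>. The quadratic form is chosen so that two integrations
  produce the fourth power, whose Brownian mean is negligible.\<close>

lemma C0_half_modulus:
  assumes "f \<in> C0_half" and \<epsilon>: "0 < \<epsilon>"
  shows "\<exists>D\<ge>0. \<forall>y\<ge>0. \<forall>z\<ge>0. \<bar>f z - f y\<bar> \<le> \<epsilon> + D * (z - y)\<^sup>2"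
proof -
  have f: "continuous_on {0..} f" "(f \<longlongrightarrow> 0) at_top" using assms by (auto simp: C0_half_def)
  obtain K where K: "0 < K" "\<And>y. 0 \<le> y \<Longrightarrow> \<bar>f y\<bar> \<le> K" using C0_half_bounded[OF assms(1)] by metis
  obtain R where R: "\<And>y. R \<le> y \<Longrightarrow> \<bar>f y\<bar> < \<epsilon> / 2"
    using order_tendstoD(2)[OF tendsto_rabs_zero[OF f(2)], of "\<epsilon> / 2"] \<epsilon> by (auto simp: eventually_at_top_linorder)
  have "uniformly_continuous_on {0..R + 1} f"
    by (intro compact_uniformly_continuous continuous_on_subset[OF f(1)]) auto
  then obtain d where d: "0 < d" "\<And>y z. y \<in> {0..R + 1} \<Longrightarrow> z \<in> {0..R + 1} \<Longrightarrow> dist z y < d \<Longrightarrow> dist (f z) (f y) < \<epsilon>"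
    unfolding uniformly_continuous_on_def using \<epsilon> by metis
  \<comment> \<open>With \<open>r \<le> 1\<close>, two points closer than \<open>r\<close> lie
    either both in \<open>{0..R + 1}\<close>, where \<open>f\<close> is uniformly continuous, or
    both beyond \<open>R\<close>, where \<open>f\<close> is small.\<close>
  define r where "r = min d 1"
  have r: "0 < r" "r \<le> d" "r \<le> 1" using d(1) by (auto simp: r_def)
  have "\<bar>f z - f y\<bar> \<le> \<epsilon> + 2 * K / r\<^sup>2 * (z - y)\<^sup>2" if yz: "0 \<le> y" "0 \<le> z" for y z
  proof (cases "\<bar>z - y\<bar> < r")
    case True
    have "\<bar>f z - f y\<bar> \<le> \<epsilon>"
    proof (cases "y \<le> R + 1 \<and> z \<le> R + 1")
      case 1: True
      have "dist (f z) (f y) < \<epsilon>" using d(2)[of y z] 1 yz True r by (auto simp: dist_real_def)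
      then show ?thesis by (simp add: dist_real_def)
    next
      case False
      then have "R \<le> y" "R \<le> z" using True r by auto
      then show ?thesis using R[of y] R[of z] by linarith
    qed
    moreover have "0 \<le> 2 * K / r\<^sup>2 * (z - y)\<^sup>2" using K(1) by simp
    ultimately show ?thesis by linarith
  next
    case False
    then have "r\<^sup>2 \<le> (z - y)\<^sup>2" using r by (simp add: abs_le_square_iff[symmetric])
    then have "2 * K * r\<^sup>2 \<le> 2 * K * (z - y)\<^sup>2" using K(1) by (intro mult_left_mono) auto
    then have "2 * K \<le> 2 * K / r\<^sup>2 * (z - y)\<^sup>2" using r by (simp add: field_simps)
    then show ?thesis using K(2)[OF yz(1)] K(2)[OF yz(2)] \<epsilon> by linarith
  qed
  then show ?thesis using K(1) by (intro exI[of _ "2 * K / r\<^sup>2"]) auto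
qed

text \<open>Derivatives are given within every \<open>{0..b}\<close>, since they stem from the
  fundamental theorem on compact intervals and are one-sided at 0. Taking \<open>b = max y z\<close>
  and restricting further gives the usual mean value bound.\<close>

lemma half_line_mean_value:
  fixes \<phi> \<phi>' :: "real \<Rightarrow> real"
  assumes "\<And>b x. x \<in> {0..b} \<Longrightarrow> (\<phi> has_real_derivative \<phi>' x) (at x within {0..b})"
    and yz: "0 \<le> y" "0 \<le> z" and le: "\<And>w. min y z \<le> w \<Longrightarrow> w \<le> max y z \<Longrightarrow> \<bar>\<phi>' w\<bar> \<le> K"
  shows "\<bar>\<phi> z - \<phi> y\<bar> \<le> K * \<bar>z - y\<bar>"
proof -
  have "norm (\<phi> z - \<phi> y) \<le> K * norm (z - y)"
  proof (rule field_differentiable_bound[of "{min y z..max y z}" \<phi> \<phi>'])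
    show "(\<phi> has_real_derivative \<phi>' w) (at w within {min y z..max y z})" if "w \<in> {min y z..max y z}" for w
      using that yz by (intro has_field_derivative_subset[OF assms(1)[of w "max y z"]]) auto
  qed (use le in auto)
  then show ?thesis by simp
qed

lemma has_real_derivative_half_line_continuous:
  fixes \<phi> \<phi>' :: "real \<Rightarrow> real"
  assumes "\<And>b x. x \<in> {0..b} \<Longrightarrow> (\<phi> has_real_derivative \<phi>' x) (at x within {0..b})"
  shows "continuous_on {0..} \<phi>"
  unfolding continuous_on_eq_continuous_within
proof
  fix x :: real assume x: "x \<in> {0..}"
  have "continuous (at x within {0..x + 1}) \<phi>"
    using assms[of x "x + 1"] x by (intro DERIV_continuous) auto
  moreover have "at x within {0..} = at x within {0..x + 1}"
    by (rule at_within_nhd[of _ "{..<x + 1}"]) auto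
  ultimately show "continuous (at x within {0..}) \<phi>" by simp
qed

text \<open>\<open>m\<close> is half the second derivative. The mean value bound is applied twice:
  first to the linear Taylor error of \<open>g'\<close>, then to the quadratic error of
  \<open>g\<close>, whose derivative is the former.\<close>

lemma half_line_taylor:
  fixes g g' m :: "real \<Rightarrow> real"
  assumes g: "\<And>b x. x \<in> {0..b} \<Longrightarrow> (g has_real_derivative g' x) (at x within {0..b})"
    and g': "\<And>b x. x \<in> {0..b} \<Longrightarrow> (g' has_real_derivative 2 * m x) (at x within {0..b})"
    and m: "\<And>y z. 0 \<le> y \<Longrightarrow> 0 \<le> z \<Longrightarrow> \<bar>m z - m y\<bar> \<le> \<epsilon> + D * (z - y)\<^sup>2" and D: "0 \<le> D"
    and yz: "0 \<le> y" "0 \<le> z"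
  shows "\<bar>g z - g y - g' y * (z - y) - m y * (z - y)\<^sup>2\<bar> \<le> 2 * \<epsilon> * (z - y)\<^sup>2 + 2 * D * (z - y) ^ 4"
proof -
  define R where "R = \<epsilon> + D * (z - y)\<^sup>2"
  have mR: "\<bar>m w - m y\<bar> \<le> R" if "min y z \<le> w" "w \<le> max y z" for w
  proof -
    have "\<bar>w - y\<bar> \<le> \<bar>z - y\<bar>" using that by auto
    then have "(w - y)\<^sup>2 \<le> (z - y)\<^sup>2" by (simp add: abs_le_square_iff[symmetric])
    then have "D * (w - y)\<^sup>2 \<le> D * (z - y)\<^sup>2" using D by (rule mult_left_mono)
    then show ?thesis using m[OF yz(1), of w] yz that unfolding R_def by (auto simp: min_def split: if_splits)
  qed
  have R0: "0 \<le> R" using mR[of y] by auto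
  define \<eta> where "\<eta> w = g' w - g' y - 2 * m y * (w - y)" for w
  have \<eta>: "\<bar>\<eta> w\<bar> \<le> 2 * R * \<bar>z - y\<bar>" if w: "min y z \<le> w" "w \<le> max y z" for w
  proof -
    have "\<bar>\<eta> w - \<eta> y\<bar> \<le> 2 * R * \<bar>w - y\<bar>"
    proof (rule half_line_mean_value[of \<eta> "\<lambda>v. 2 * m v - 2 * m y"])
      show "(\<eta> has_real_derivative 2 * m v - 2 * m y) (at v within {0..b})" if "v \<in> {0..b}" for b v
        unfolding \<eta>_def[abs_def] by (rule derivative_eq_intros refl g' that | simp)+
      show "\<bar>2 * m v - 2 * m y\<bar> \<le> 2 * R" if "min y w \<le> v" "v \<le> max y w" for v
      proof -
        have "min y z \<le> v" "v \<le> max y z" using that w by (auto simp: min_def max_def split: if_splits)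
        from mR[OF this] show ?thesis by linarith
      qed
    qed (use w yz in auto)
    also have "\<dots> \<le> 2 * R * \<bar>z - y\<bar>" using w R0 by (intro mult_left_mono) auto
    finally show ?thesis by (simp add: \<eta>_def)
  qed
  define \<phi> where "\<phi> w = g w - g y - g' y * (w - y) - m y * (w - y)\<^sup>2" for w
  have "(\<phi> has_real_derivative \<eta> v) (at v within {0..b})" if "v \<in> {0..b}" for b v
    unfolding \<phi>_def[abs_def] \<eta>_def by (rule derivative_eq_intros refl g that | simp)+
  from half_line_mean_value[of \<phi>, OF this yz \<eta>]
  have "\<bar>\<phi> z - \<phi> y\<bar> \<le> 2 * R * \<bar>z - y\<bar> * \<bar>z - y\<bar>" by simp
  also have "\<dots> = 2 * R * (z - y)\<^sup>2" by (simp add: power2_eq_square abs_mult_self_eq mult.assoc)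
  also have "\<dots> = 2 * \<epsilon> * (z - y)\<^sup>2 + 2 * D * (z - y) ^ 4"
    by (simp add: R_def algebra_simps flip: power_add)
  finally show ?thesis by (simp add: \<phi>_def)
qed

section \<open>Explicit solution by variation of constants\<close>

locale half_line_resolvent =
  fixes l a :: real and f :: "real \<Rightarrow> real" and K c :: real
  assumes l: "0 < l" and a: "a = sqrt (2 * l)" and C0: "f \<in> C0_half"
    and K: "0 < K" "\<And>y. 0 \<le> y \<Longrightarrow> \<bar>f y\<bar> \<le> K"
begin

lemma a_pos: "0 < a" and a_square: "a * a = 2 * l"
  using l by (auto simp: a)

lemma f_cont: "continuous_on {0..} f"
  using C0 by (simp add: C0_half_def)

lemma set_integrable_exp_bound:
  assumes \<phi>: "continuous_on {0..} \<phi>" and le: "\<And>y. 0 \<le> y \<Longrightarrow> \<bar>\<phi> y\<bar> \<le> R * exp (- a * y)"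
  shows "set_integrable lborel {0..} (\<phi> :: real \<Rightarrow> real)"
  unfolding set_integrable_def
proof (rule Bochner_Integration.integrable_bound)
  show "integrable lborel (\<lambda>y. R * (indicator {0..} y *\<^sub>R exp (- a * y)))"
    using set_integrable_exp_minus(1)[OF a_pos] unfolding set_integrable_def by (rule integrable_mult_right)
  show "(\<lambda>t. indicat_real {0..} t *\<^sub>R \<phi> t) \<in> borel_measurable lborel"
    using borel_measurable_continuous_on_indicator[OF _ \<phi>] by simp
  have "\<bar>\<phi> y\<bar> \<le> \<bar>R\<bar> * exp (- a * y)" if "0 \<le> y" for y
    using le[OF that] by (rule order_trans) (intro mult_right_mono, auto)
  then show "AE y in lborel. norm (indicat_real {0..} y *\<^sub>R \<phi> y) \<le> norm (R * (indicator {0..} y *\<^sub>R exp (- a * y)))"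
    by (auto simp: indicator_def abs_mult)
qed

text \<open>Splitting the integral of \<open>exp (- a * |x - y|) * f y\<close> at
  \<open>y = x\<close> gives \<open>exp (- a * x) * U x\<close> from below and
  \<open>exp (a * x) * (E - W x)\<close> from above.\<close>

definition U :: "real \<Rightarrow> real" where "U x = integral {0..x} (\<lambda>y. exp (a * y) * f y)"
definition W :: "real \<Rightarrow> real" where "W x = integral {0..x} (\<lambda>y. exp (- a * y) * f y)"
definition E :: real where "E = pairing (e_fun l) f"

lemma E_eq: "E = (LBINT y:{0..}. exp (- a * y) * f y)"
  by (simp add: E_def pairing_def e_fun_def a)

lemma exp_f_cont: "continuous_on {0..} (\<lambda>y. exp (r * y) * f y)" for r
  by (intro continuous_intros f_cont)

lemma U_deriv: "x \<in> {0..b} \<Longrightarrow> (U has_real_derivative exp (a * x) * f x) (at x within {0..b})"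
  unfolding U_def[abs_def]
  by (rule integral_has_real_derivative) (auto intro: continuous_on_subset[OF exp_f_cont])

lemma W_deriv: "x \<in> {0..b} \<Longrightarrow> (W has_real_derivative exp (- a * x) * f x) (at x within {0..b})"
  unfolding W_def[abs_def]
  by (rule integral_has_real_derivative[OF continuous_on_subset[OF exp_f_cont[of "- a"]]]) auto

lemma exp_integral_bound:
  assumes "r \<noteq> 0" "0 \<le> x" "x \<le> z"
  shows "(\<lambda>y. exp (r * y) * f y) integrable_on {x..z}"
    and "\<bar>integral {x..z} (\<lambda>y. exp (r * y) * f y)\<bar> \<le> K * ((exp (r * z) - exp (r * x)) / r)"
proof -
  show i: "(\<lambda>y. exp (r * y) * f y) integrable_on {x..z}"
    using assms by (intro integrable_continuous_interval continuous_on_subset[OF exp_f_cont]) auto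
  have "((\<lambda>y. exp (r * y)) has_integral exp (r * z) / r - exp (r * x) / r) {x..z}"
    using assms by (intro fundamental_theorem_of_calculus)
      (auto intro!: derivative_eq_intros simp: has_real_derivative_iff_has_vector_derivative[symmetric])
  from has_integral_mult_right[OF this, of K]
  have h: "((\<lambda>y. K * exp (r * y)) has_integral K * ((exp (r * z) - exp (r * x)) / r)) {x..z}"
    by (simp add: diff_divide_distrib)
  have "norm (integral {x..z} (\<lambda>y. exp (r * y) * f y)) \<le> integral {x..z} (\<lambda>y. K * exp (r * y))"
    using assms K(2) by (intro integral_norm_bound_integral i has_integral_integrable[OF h]) (auto simp: abs_mult mult.commute)
  then show "\<bar>integral {x..z} (\<lambda>y. exp (r * y) * f y)\<bar> \<le> K * ((exp (r * z) - exp (r * x)) / r)"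
    by (simp only: integral_unique[OF h] real_norm_def)
qed

lemma W_diff: "0 \<le> x \<Longrightarrow> x \<le> z \<Longrightarrow> W z - W x = integral {x..z} (\<lambda>y. exp (- a * y) * f y)"
  using Henstock_Kurzweil_Integration.integral_combine[of 0 x z "\<lambda>y. exp (- a * y) * f y"]
    exp_integral_bound(1)[of "- a" 0 z] a_pos by (simp add: W_def)

lemma W_lim: "(W \<longlongrightarrow> E) at_top"
proof -
  have int: "set_integrable lborel {0..} (\<lambda>y. exp (- a * y) * f y)"
    by (rule set_integrable_exp_bound[OF exp_f_cont[of "- a"], of K]) (use K in \<open>auto simp: abs_mult mult.commute\<close>)
  have "((\<lambda>z. LBINT y:{0..z}. exp (- a * y) * f y) \<longlongrightarrow> E) at_top"
    unfolding E_eq by (rule tendsto_set_lebesgue_integral_at_top[OF _ int]) simp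
  moreover have "(LBINT y:{0..z}. exp (- a * y) * f y) = W z" for z
    unfolding W_def
    by (rule set_borel_integral_eq_integral(2)[OF set_integrable_subset[OF int]]) auto
  ultimately show ?thesis by simp
qed

lemma U_bound:
  assumes "0 \<le> x" shows "\<bar>exp (- a * x) * U x\<bar> \<le> K / a"
proof -
  have "\<bar>U x\<bar> \<le> K * ((exp (a * x) - exp (a * 0)) / a)"
    unfolding U_def using exp_integral_bound(2)[of a 0 x] a_pos assms by simp
  also have "\<dots> \<le> K * (exp (a * x) / a)"
    using K(1) a_pos by (intro mult_left_mono divide_right_mono) auto
  finally have "exp (- a * x) * \<bar>U x\<bar> \<le> exp (- a * x) * (K * (exp (a * x) / a))"
    by (intro mult_left_mono) auto
  also have "\<dots> = K / a" by (simp add: exp_minus)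
  finally show ?thesis by (simp add: abs_mult)
qed

text \<open>\<open>E - W x\<close> is the tail of a convergent integral and decays like
  \<open>exp (- a * x)\<close>, which offsets the growing factor. The estimate is proved for finite
  tails \<open>W z - W x\<close> and passed to the limit.\<close>

lemma W_bound:
  assumes x: "0 \<le> x" shows "\<bar>exp (a * x) * (E - W x)\<bar> \<le> K / a"
proof -
  have "((\<lambda>z. \<bar>W z - W x\<bar>) \<longlongrightarrow> \<bar>E - W x\<bar>) at_top"
    by (intro tendsto_intros W_lim)
  moreover have "\<forall>\<^sub>F z in at_top. \<bar>W z - W x\<bar> \<le> K * (exp (- a * x) / a)"
  proof (rule eventually_at_top_linorderI[of x])
    fix z assume z: "x \<le> z"
    have "\<bar>W z - W x\<bar> \<le> K * ((exp (- a * z) - exp (- a * x)) / (- a))"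
      unfolding W_diff[OF x z] using exp_integral_bound(2)[of "- a" x z] a_pos x z by simp
    also have "\<dots> = K * ((exp (- a * x) - exp (- a * z)) / a)"
      using a_pos by (simp add: field_simps)
    also have "\<dots> \<le> K * (exp (- a * x) / a)"
      using K(1) a_pos by (intro mult_left_mono divide_right_mono) auto
    finally show "\<bar>W z - W x\<bar> \<le> K * (exp (- a * x) / a)" .
  qed
  ultimately have "\<bar>E - W x\<bar> \<le> K * (exp (- a * x) / a)"
    using tendsto_upperbound trivial_limit_at_top_linorder by blast
  then have "exp (a * x) * \<bar>E - W x\<bar> \<le> exp (a * x) * (K * (exp (- a * x) / a))"
    by (intro mult_left_mono) auto
  also have "\<dots> = K / a" by (simp add: exp_minus)
  finally show ?thesis by (simp add: abs_mult)
qed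

lemma E_bound: "\<bar>E\<bar> \<le> K / a"
  using W_bound[of 0] by (simp add: W_def)

lemma rD_bound:
  assumes "0 \<le> x" "0 \<le> y" shows "\<bar>rD l x y * f y\<bar> \<le> (2 * exp (a * x) / a * K) * exp (- a * y)"
proof -
  have e1: "exp (- a * \<bar>x - y\<bar>) \<le> exp (a * x) * exp (- a * y)"
  proof -
    have "a * (y - x) \<le> a * \<bar>x - y\<bar>" using a_pos by (intro mult_left_mono) auto
    then show ?thesis unfolding exp_add[symmetric] by (simp add: algebra_simps)
  qed
  have e2: "exp (- a * (x + y)) \<le> exp (a * x) * exp (- a * y)"
  proof -
    have "0 \<le> a * x" using a_pos assms by simp
    then show ?thesis unfolding exp_add[symmetric] by (simp add: algebra_simps)
  qed
  have "\<bar>rD l x y\<bar> = 1 / a * \<bar>exp (- a * \<bar>x - y\<bar>) - exp (- a * (x + y))\<bar>"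
    unfolding rD_def a[symmetric] abs_mult using a_pos by simp
  also have "\<dots> \<le> 1 / a * (2 * (exp (a * x) * exp (- a * y)))"
  proof (intro mult_left_mono)
    have "0 < exp (- a * \<bar>x - y\<bar>)" "0 < exp (- a * (x + y))" by simp_all
    then show "\<bar>exp (- a * \<bar>x - y\<bar>) - exp (- a * (x + y))\<bar> \<le> 2 * (exp (a * x) * exp (- a * y))"
      using e1 e2 by linarith
  qed (use a_pos in simp)
  finally have "\<bar>rD l x y\<bar> * \<bar>f y\<bar> \<le> (1 / a * (2 * (exp (a * x) * exp (- a * y)))) * K"
    using K(2)[OF assms(2)] a_pos by (intro mult_mono) auto
  then show ?thesis by (simp add: abs_mult mult_ac)
qed

lemma rD_f_cont: "continuous_on {0..} (\<lambda>y. rD l x y * f y)"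
  unfolding rD_def by (intro continuous_intros f_cont)

lemma rD_f_integrable: "0 \<le> x \<Longrightarrow> set_integrable lborel {0..} (\<lambda>y. rD l x y * f y)"
  by (rule set_integrable_exp_bound[OF rD_f_cont rD_bound])

text \<open>The kernel factors into exponentials on each side of \<open>y = x\<close>. The range is
  cut at a finite \<open>z\<close> so that interval integrals can be split and rewritten, and then
  \<open>z\<close> is sent to infinity with \<open>W_lim\<close>.\<close>

lemma RD_eq:
  assumes x: "0 \<le> x"
  shows "RD l f x = 1 / a * (exp (- a * x) * (U x - E) + exp (a * x) * (E - W x))"
proof -
  let ?k = "\<lambda>y. rD l x y * f y"
  have ai: "?k integrable_on {u..v}" if "0 \<le> u" for u v
    using that by (intro integrable_continuous_interval continuous_on_subset[OF rD_f_cont]) auto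
  have split: "integral {0..z} ?k = 1 / a * (exp (- a * x) * U x - exp (- a * x) * W x
      + (exp (a * x) - exp (- a * x)) * (W z - W x))" if z: "x \<le> z" for z
  proof -
    have "integral {0..z} ?k = integral {0..x} ?k + integral {x..z} ?k"
      using Henstock_Kurzweil_Integration.integral_combine[of 0 x z ?k] x z ai[of 0] by simp
    also have "integral {0..x} ?k = integral {0..x} (\<lambda>y. exp (- a * x) / a * (exp (a * y) * f y) - exp (- a * x) / a * (exp (- a * y) * f y))"
    proof (rule Henstock_Kurzweil_Integration.integral_cong)
      fix y assume "y \<in> {0..x}"
      then have 1: "exp (- a * \<bar>x - y\<bar>) = exp (- a * x) * exp (a * y)"
        by (simp add: exp_add[symmetric] algebra_simps)
      have 2: "exp (- a * (x + y)) = exp (- a * x) * exp (- a * y)" by (simp add: exp_add[symmetric] algebra_simps)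
      show "?k y = exp (- a * x) / a * (exp (a * y) * f y) - exp (- a * x) / a * (exp (- a * y) * f y)"
        unfolding rD_def a[symmetric] 1 2 by (simp add: algebra_simps diff_divide_distrib)
    qed
    also have "\<dots> = exp (- a * x) / a * U x - exp (- a * x) / a * W x"
      unfolding U_def W_def using exp_integral_bound(1)[of a 0 x] exp_integral_bound(1)[of "- a" 0 x] a_pos x
      by (subst Henstock_Kurzweil_Integration.integral_diff) auto
    also have "integral {x..z} ?k = integral {x..z} (\<lambda>y. (exp (a * x) - exp (- a * x)) / a * (exp (- a * y) * f y))"
    proof (rule Henstock_Kurzweil_Integration.integral_cong)
      fix y assume "y \<in> {x..z}"
      then have 1: "exp (- a * \<bar>x - y\<bar>) = exp (a * x) * exp (- a * y)"
        by (simp add: exp_add[symmetric] algebra_simps)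
      have 2: "exp (- a * (x + y)) = exp (- a * x) * exp (- a * y)" by (simp add: exp_add[symmetric] algebra_simps)
      show "?k y = (exp (a * x) - exp (- a * x)) / a * (exp (- a * y) * f y)"
        unfolding rD_def a[symmetric] 1 2 by (simp add: algebra_simps diff_divide_distrib)
    qed
    also have "\<dots> = (exp (a * x) - exp (- a * x)) / a * (W z - W x)"
      unfolding W_diff[OF x z] by simp
    finally show ?thesis by (simp add: diff_divide_distrib add_divide_distrib algebra_simps)
  qed
  have "((\<lambda>z. LBINT y:{0..z}. ?k y) \<longlongrightarrow> RD l f x) at_top"
    unfolding RD_def by (rule tendsto_set_lebesgue_integral_at_top[OF _ rD_f_integrable[OF x]]) simp
  moreover have "(LBINT y:{0..z}. ?k y) = integral {0..z} ?k" for z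
    by (rule set_borel_integral_eq_integral(2)[OF set_integrable_subset[OF rD_f_integrable[OF x]]]) auto
  ultimately have "((\<lambda>z. integral {0..z} ?k) \<longlongrightarrow> RD l f x) at_top" by simp
  moreover have "((\<lambda>z. 1 / a * (exp (- a * x) * U x - exp (- a * x) * W x
      + (exp (a * x) - exp (- a * x)) * (W z - W x))) \<longlongrightarrow> 1 / a * (exp (- a * x) * U x - exp (- a * x) * W x
      + (exp (a * x) - exp (- a * x)) * (E - W x))) at_top"
    by (intro tendsto_intros W_lim)
  then have "((\<lambda>z. integral {0..z} ?k) \<longlongrightarrow> 1 / a * (exp (- a * x) * U x - exp (- a * x) * W x
      + (exp (a * x) - exp (- a * x)) * (E - W x))) at_top"
    by (rule Lim_transform_eventually) (auto simp: split intro!: eventually_at_top_linorderI[of x])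
  ultimately have "RD l f x = 1 / a * (exp (- a * x) * U x - exp (- a * x) * W x
      + (exp (a * x) - exp (- a * x)) * (E - W x))"
    by (rule tendsto_unique[OF trivial_limit_at_top_linorder])
  then show ?thesis by (simp add: algebra_simps)
qed

text \<open>For nonnegative arguments, the Dirichlet resolvent in the form of \<open>RD_eq\<close>
  plus a multiple of the decaying homogeneous solution. The coefficient \<open>c\<close> stays free
  until the boundary condition fixes it.\<close>

definition sol :: "real \<Rightarrow> real" where
  "sol x = 1 / a * (exp (- a * x) * (U x - E) + exp (a * x) * (E - W x)) + c * exp (- a * x)"

definition sol' :: "real \<Rightarrow> real" where
  "sol' x = - (exp (- a * x) * (U x - E)) + exp (a * x) * (E - W x) - a * c * exp (- a * x)"

text \<open>The contributions of the derivatives of \<open>U\<close> and \<open>W\<close> are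
  \<open>f\<close> and \<open>- f\<close> and cancel here. One derivative later they add up to
  \<open>- 2 * f\<close>, the jump of the kernel's slope on the diagonal.\<close>

lemma sol_deriv:
  assumes "x \<in> {0..b}" shows "(sol has_real_derivative sol' x) (at x within {0..b})"
proof -
  have d: "(sol has_real_derivative 1 / a * ((exp (- a * x) * (exp (a * x) * f x) + (- a * exp (- a * x)) * (U x - E))
      + (a * exp (a * x) * (E - W x) - exp (a * x) * (exp (- a * x) * f x))) - a * c * exp (- a * x)) (at x within {0..b})"
    unfolding sol_def[abs_def]
    by (rule derivative_eq_intros refl U_deriv[OF assms] W_deriv[OF assms] | simp add: algebra_simps)+
  have "exp (- a * x) * (exp (a * x) * f x) = f x" "exp (a * x) * (exp (- a * x) * f x) = f x"
    by (simp_all add: exp_minus)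
  then have "1 / a * ((exp (- a * x) * (exp (a * x) * f x) + (- a * exp (- a * x)) * (U x - E))
      + (a * exp (a * x) * (E - W x) - exp (a * x) * (exp (- a * x) * f x))) - a * c * exp (- a * x) = sol' x"
    using a_pos by (simp add: sol'_def field_simps)
  with d show ?thesis by simp
qed

lemma sol'_deriv:
  assumes "x \<in> {0..b}" shows "(sol' has_real_derivative 2 * (l * sol x - f x)) (at x within {0..b})"
proof -
  have d: "(sol' has_real_derivative - (exp (- a * x) * (exp (a * x) * f x) + (- a * exp (- a * x)) * (U x - E))
      + (a * exp (a * x) * (E - W x) - exp (a * x) * (exp (- a * x) * f x)) + a * a * c * exp (- a * x)) (at x within {0..b})"
    unfolding sol'_def[abs_def]
    by (rule derivative_eq_intros refl U_deriv[OF assms] W_deriv[OF assms] | simp add: algebra_simps)+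
  have e: "exp (- a * x) * (exp (a * x) * f x) = f x" "exp (a * x) * (exp (- a * x) * f x) = f x"
    by (simp_all add: exp_minus)
  have "2 * l * sol x = a * (exp (- a * x) * (U x - E)) + a * (exp (a * x) * (E - W x)) + a * a * c * exp (- a * x)"
    unfolding a_square[symmetric] sol_def using a_pos by (simp add: field_simps)
  then have "- (exp (- a * x) * (exp (a * x) * f x) + (- a * exp (- a * x)) * (U x - E))
      + (a * exp (a * x) * (E - W x) - exp (a * x) * (exp (- a * x) * f x)) + a * a * c * exp (- a * x) = 2 * (l * sol x - f x)"
    unfolding e by (simp add: algebra_simps)
  with d show ?thesis by simp
qed

lemma sol_0: "sol 0 = c" "sol' 0 = 2 * E - a * c"
  by (simp_all add: sol_def sol'_def U_def W_def)

text \<open>A common bound for \<open>f\<close>, \<open>sol\<close> and \<open>sol'\<close>. The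
  terms with \<open>U - E\<close> and \<open>E - W\<close> contribute \<open>2 * K / a\<close> and
  \<open>K / a\<close>, with prefactor \<open>1 / a\<close> in \<open>sol\<close> and 1 in
  \<open>sol'\<close>; the homogeneous term contributes \<open>|c|\<close> and
  \<open>a * |c|\<close>.\<close>

definition bnd :: real where
  "bnd = K + (1 + 1 / a) * (3 * (K / a)) + (1 + a) * \<bar>c\<bar>"

lemma sol_bounds:
  assumes x: "0 \<le> x"
  shows "\<bar>f x\<bar> \<le> bnd" "\<bar>sol x\<bar> \<le> bnd" "\<bar>sol' x\<bar> \<le> bnd"
proof -
  have ex: "exp (- a * x) \<le> 1" using a_pos x by simp
  have Ka: "0 < K / a" using K(1) a_pos by simp
  have "exp (- a * x) * \<bar>E\<bar> \<le> 1 * (K / a)" using ex E_bound by (intro mult_mono) auto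
  then have "\<bar>exp (- a * x) * E\<bar> \<le> K / a" by (simp add: abs_mult)
  then have p: "\<bar>exp (- a * x) * (U x - E)\<bar> \<le> 2 * (K / a)"
    using U_bound[OF x] unfolding right_diff_distrib by linarith
  note q = W_bound[OF x]
  have ec: "\<bar>c * exp (- a * x)\<bar> \<le> \<bar>c\<bar>" using mult_left_mono[OF ex, of "\<bar>c\<bar>"] by (simp add: abs_mult)
  have nn: "0 \<le> 1 / a * (3 * (K / a))" "0 \<le> a * \<bar>c\<bar>" using K(1) a_pos by auto
  show "\<bar>f x\<bar> \<le> bnd"
    using K(2)[OF x] nn Ka unfolding bnd_def distrib_right by linarith
  have "\<bar>exp (- a * x) * (U x - E) + exp (a * x) * (E - W x)\<bar> \<le> 3 * (K / a)" using p q by linarith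
  then have "\<bar>1 / a * (exp (- a * x) * (U x - E) + exp (a * x) * (E - W x))\<bar> \<le> 1 / a * (3 * (K / a))"
    unfolding abs_mult[of "1 / a"] using a_pos by (intro mult_mono) auto
  then show "\<bar>sol x\<bar> \<le> bnd"
    using ec nn Ka K(1) unfolding sol_def bnd_def distrib_right by linarith
  have "\<bar>a * (c * exp (- a * x))\<bar> \<le> a * \<bar>c\<bar>"
    unfolding abs_mult[of a] using ec a_pos by (intro mult_mono) auto
  then show "\<bar>sol' x\<bar> \<le> bnd"
    using p q nn Ka K(1) unfolding sol'_def bnd_def distrib_right mult.assoc by linarith
qed

text \<open>The value of \<open>c\<close> is obtained by solving the boundary condition with
  \<open>sol 0 = c\<close> and \<open>sol' 0 = 2 * E - a * c\<close>.\<close>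

lemma half_line_solution:
  assumes k: "0 < k" and \<gamma>: "0 < \<gamma>" and c: "c = (2 * E + \<gamma> * f 0) / (k + a)"
  shows "half_line_solution l k \<gamma> f sol sol' bnd"
proof
  show "0 < l" "0 < k" "0 < \<gamma>" by (fact l k \<gamma>)+
  show "\<bar>f y\<bar> \<le> bnd" "\<bar>sol y\<bar> \<le> bnd" "\<bar>sol' y\<bar> \<le> bnd" if "0 \<le> y" for y
    using sol_bounds[OF that] by auto
  show "continuous_on {0..} f" "continuous_on {0..} sol" "continuous_on {0..} sol'"
    using f_cont has_real_derivative_half_line_continuous[OF sol_deriv] has_real_derivative_half_line_continuous[OF sol'_deriv]
    by auto
  show lip: "\<bar>sol z - sol y\<bar> \<le> bnd * \<bar>z - y\<bar>" if "0 \<le> y" "0 \<le> z" for y z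
    by (rule half_line_mean_value[OF sol_deriv that]) (use sol_bounds(3) that in auto)
  have bnd0: "0 \<le> bnd" using sol_bounds(1)[of 0] by simp
  show "sol' 0 = k * sol 0 - \<gamma> * f 0"
    using k a_pos c unfolding sol_0 by (simp add: field_simps)
  \<comment> \<open>Half the second derivative inherits the modulus of \<open>f\<close>: the
    Lipschitz part \<open>l * bnd * |z - y|\<close> is split by \<open>abs_mult_le_squares\<close>
    into \<open>\<epsilon> / 2\<close> and a multiple of the square.\<close>
  have m: "\<exists>D\<ge>0. \<forall>y\<ge>0. \<forall>z\<ge>0. \<bar>(l * sol z - f z) - (l * sol y - f y)\<bar> \<le> \<epsilon> + D * (z - y)\<^sup>2" if \<epsilon>: "0 < \<epsilon>" for \<epsilon>
  proof -
    obtain D where D: "0 \<le> D" "\<And>y z. 0 \<le> y \<Longrightarrow> 0 \<le> z \<Longrightarrow> \<bar>f z - f y\<bar> \<le> \<epsilon> / 2 + D * (z - y)\<^sup>2"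
      using C0_half_modulus[OF C0, of "\<epsilon> / 2"] \<epsilon> by auto
    have "\<bar>(l * sol z - f z) - (l * sol y - f y)\<bar> \<le> \<epsilon> + (D + (l * bnd)\<^sup>2 / (\<epsilon> / 2)) * (z - y)\<^sup>2" if yz: "0 \<le> y" "0 \<le> z" for y z
    proof -
      have "\<bar>l * (sol z - sol y)\<bar> \<le> l * (bnd * \<bar>z - y\<bar>)"
        unfolding abs_mult[of l] using lip[OF yz] l by (intro mult_mono) auto
      also have "\<dots> \<le> \<bar>1 * (l * bnd * (z - y))\<bar>" using l bnd0 by (simp add: abs_mult)
      also have "\<dots> \<le> \<epsilon> / 2 * 1\<^sup>2 + (l * bnd * (z - y))\<^sup>2 / (\<epsilon> / 2)"
        using \<epsilon> by (intro abs_mult_le_squares) simp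
      also have "\<dots> = \<epsilon> / 2 + (l * bnd)\<^sup>2 / (\<epsilon> / 2) * (z - y)\<^sup>2"
        by (simp add: power_mult_distrib)
      finally show ?thesis using D(2)[OF yz] unfolding distrib_right right_diff_distrib by linarith
    qed
    then show ?thesis using D(1) \<epsilon> by (intro exI[of _ "D + (l * bnd)\<^sup>2 / (\<epsilon> / 2)"]) auto
  qed
  show "\<exists>D\<ge>0. \<forall>y\<ge>0. \<forall>z\<ge>0. \<bar>sol z - sol y - sol' y * (z - y) - (l * sol y - f y) * (z - y)\<^sup>2\<bar>
      \<le> \<epsilon> * (z - y)\<^sup>2 + D * (z - y) ^ 4" if \<epsilon>: "0 < \<epsilon>" for \<epsilon>
  proof -
    \<comment> \<open>\<open>half_line_taylor\<close> doubles both constants, hence the modulus for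
      \<open>\<epsilon> / 2\<close> and the witness \<open>2 * D\<close>.\<close>
    obtain D where D: "0 \<le> D" "\<And>y z. 0 \<le> y \<Longrightarrow> 0 \<le> z \<Longrightarrow>
        \<bar>(l * sol z - f z) - (l * sol y - f y)\<bar> \<le> \<epsilon> / 2 + D * (z - y)\<^sup>2"
      using m[of "\<epsilon> / 2"] \<epsilon> by auto
    show ?thesis
      using half_line_taylor[OF sol_deriv sol'_deriv D(2) D(1)] D(1) by (intro exI[of _ "2 * D"]) simp
  qed
  show "\<exists>D\<ge>0. \<forall>y\<ge>0. \<bar>\<gamma> * (f y - f 0) - k * (sol y - sol 0) + (sol' y - sol' 0)\<bar> \<le> \<epsilon> + D * y" if \<epsilon>: "0 < \<epsilon>" for \<epsilon>
  proof -
    obtain D where D: "0 \<le> D" "\<And>y z. 0 \<le> y \<Longrightarrow> 0 \<le> z \<Longrightarrow> \<bar>f z - f y\<bar> \<le> \<epsilon> / \<gamma> + D * (z - y)\<^sup>2"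
      using C0_half_modulus[OF C0, of "\<epsilon> / \<gamma>"] \<epsilon> \<gamma> by auto
    define m where "m = 2 * (l * bnd + bnd)"
    have "\<bar>\<gamma> * (f y - f 0) - k * (sol y - sol 0) + (sol' y - sol' 0)\<bar> \<le> \<epsilon> + (\<gamma> * (D + 2 * K) + k * bnd + m) * y" if y: "0 \<le> y" for y
    proof -
      \<comment> \<open>The quadratic modulus is traded for a linear one, as needed against
        \<open>|B s| * (L t - L s)\<close>: for \<open>y \<le> 1\<close> use
        \<open>y^2 \<le> y\<close>, beyond that the trivial bound
        \<open>2 * K \<le> 2 * K * y\<close>.\<close>
      have "\<bar>f y - f 0\<bar> \<le> \<epsilon> / \<gamma> + (D + 2 * K) * y"
      proof (cases "y \<le> 1")
        case True
        then have "D * y\<^sup>2 \<le> D * y" using D(1) y by (intro mult_left_mono) (auto simp: power2_eq_square mult_left_le)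
        moreover have "0 \<le> 2 * K * y" using K(1) y by simp
        ultimately show ?thesis using D(2)[of 0 y] y unfolding distrib_right by simp
      next
        case False
        then have "2 * K * 1 \<le> 2 * K * y" using K(1) by (intro mult_left_mono) auto
        moreover have "0 \<le> D * y" "0 \<le> \<epsilon> / \<gamma>" using D(1) y \<epsilon> \<gamma> by auto
        ultimately show ?thesis using K(2)[OF y] K(2)[of 0] unfolding distrib_right by simp
      qed
      then have "\<bar>\<gamma> * (f y - f 0)\<bar> \<le> \<gamma> * (\<epsilon> / \<gamma> + (D + 2 * K) * y)"
        unfolding abs_mult[of \<gamma>] using \<gamma> by (intro mult_mono) auto
      also have "\<dots> = \<epsilon> + \<gamma> * (D + 2 * K) * y" using \<gamma> by (simp add: field_simps)
      finally have 1: "\<bar>\<gamma> * (f y - f 0)\<bar> \<le> \<epsilon> + \<gamma> * (D + 2 * K) * y" .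
      have 2: "\<bar>k * (sol y - sol 0)\<bar> \<le> k * bnd * y"
        unfolding abs_mult[of k] using lip[of 0 y] k y by (simp add: mult.assoc)
      have 3: "\<bar>sol' y - sol' 0\<bar> \<le> m * \<bar>y - 0\<bar>"
      proof (rule half_line_mean_value[OF sol'_deriv order_refl y])
        fix w assume "min 0 y \<le> w" then have w: "0 \<le> w" using y by simp
        have "\<bar>l * sol w\<bar> \<le> l * bnd" unfolding abs_mult[of l] using sol_bounds(2)[OF w] l by simp
        then have "\<bar>l * sol w - f w\<bar> \<le> l * bnd + bnd"
          using sol_bounds(1)[OF w] abs_triangle_ineq4[of "l * sol w" "f w"] by linarith
        then show "\<bar>2 * (l * sol w - f w)\<bar> \<le> m" unfolding m_def abs_mult[of 2] by simp
      qed
      show ?thesis using 1 2 3 y unfolding distrib_right by simp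
    qed
    moreover have "0 \<le> \<gamma> * (D + 2 * K) + k * bnd + m"
      unfolding m_def using \<gamma> D(1) K(1) k bnd0 l by (intro add_nonneg_nonneg mult_nonneg_nonneg) auto
    ultimately show ?thesis by blast
  qed
qed

end

section \<open>The resolvent kernel\<close>

lemma nn_integral_add_measure:
  assumes N: "sets N = sets M" and h: "h \<in> borel_measurable M"
  shows "(\<integral>\<^sup>+x. h x \<partial>add_measure M N) = (\<integral>\<^sup>+x. h x \<partial>M) + (\<integral>\<^sup>+x. h x \<partial>N)"
proof -
  have sp: "space N = space M" by (rule sets_eq_imp_space_eq[OF N])
  have mN: "u \<in> borel_measurable N" "u \<in> borel_measurable (add_measure M N)"
    if "u \<in> borel_measurable M" for u :: "_ \<Rightarrow> ennreal"
    using that measurable_cong_sets[OF N refl] measurable_cong_sets[OF sets_add_measure refl] by auto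
  show ?thesis
    using h
  proof (induction rule: borel_measurable_induct)
    case (cong f g)
    then show ?case
      using nn_integral_cong[of M f g] nn_integral_cong[of N f g] nn_integral_cong[of "add_measure M N" f g] sp by simp
  next
    case (set A)
    then show ?case using N by (simp add: emeasure_add_measure)
  next
    case (mult u c)
    then have u: "u \<in> borel_measurable M" by simp
    show ?case
      unfolding nn_integral_cmult[OF u] nn_integral_cmult[OF mN(1)[OF u]] nn_integral_cmult[OF mN(2)[OF u]] mult.IH
      by (rule distrib_left)
  next
    case (add u v)
    then have uv: "u \<in> borel_measurable M" "v \<in> borel_measurable M" by simp_all
    note m = mN[OF uv(1)] mN[OF uv(2)]
    show ?case
      unfolding nn_integral_add[OF uv(2,1)] nn_integral_add[OF m(3,1)] nn_integral_add[OF m(4,2)] add.IH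
      by (simp only: ac_simps)
  next
    case (seq U)
    then have U: "U i \<in> borel_measurable M" and inc: "incseq U" for i by simp_all
    have mono_conv: "(\<integral>\<^sup>+x. (SUP i. U i) x \<partial>K) = (SUP i. \<integral>\<^sup>+x. U i x \<partial>K)" if "\<And>i. U i \<in> borel_measurable K" for K
      unfolding SUP_apply by (rule nn_integral_monotone_convergence_SUP[OF inc that])
    have incI: "incseq (\<lambda>i. \<integral>\<^sup>+x. U i x \<partial>K)" for K
      using inc by (auto simp: incseq_def le_fun_def intro!: nn_integral_mono)
    show ?case
      unfolding mono_conv[OF U] mono_conv[OF mN(1)[OF U]] mono_conv[OF mN(2)[OF U]] seq.IH
      by (rule ennreal_SUP_add[OF incI incI])
  qed
qed

lemma integral_add_measure:
  fixes f :: "'a \<Rightarrow> real"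
  assumes N: "sets N = sets M" and f: "integrable M f" "integrable N f"
  shows "integrable (add_measure M N) f"
    and "(\<integral>x. f x \<partial>add_measure M N) = (\<integral>x. f x \<partial>M) + (\<integral>x. f x \<partial>N)"
proof -
  have m [measurable]: "f \<in> borel_measurable M" using f by simp
  have "f \<in> borel_measurable (add_measure M N)"
    using m measurable_cong_sets[OF sets_add_measure refl] by blast
  moreover have fin: "(\<integral>\<^sup>+x. ennreal (norm (f x)) \<partial>M) < \<infinity>" "(\<integral>\<^sup>+x. ennreal (norm (f x)) \<partial>N) < \<infinity>"
    using f by (auto simp: integrable_iff_bounded)
  ultimately show i: "integrable (add_measure M N) f"
    by (simp add: integrable_iff_bounded nn_integral_add_measure[OF N])
  have part: "(\<integral>\<^sup>+x. ennreal (f x) \<partial>M) < top" "(\<integral>\<^sup>+x. ennreal (f x) \<partial>N) < top"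
    "(\<integral>\<^sup>+x. ennreal (- f x) \<partial>M) < top" "(\<integral>\<^sup>+x. ennreal (- f x) \<partial>N) < top"
    using le_less_trans[OF nn_integral_mono fin(1)] le_less_trans[OF nn_integral_mono fin(2)]
    by (auto intro!: ennreal_leI)
  show "(\<integral>x. f x \<partial>add_measure M N) = (\<integral>x. f x \<partial>M) + (\<integral>x. f x \<partial>N)"
    unfolding real_lebesgue_integral_def[OF i] real_lebesgue_integral_def[OF f(1)] real_lebesgue_integral_def[OF f(2)]
    using part by (simp add: nn_integral_add_measure[OF N] enn2real_plus)
qed

lemma scale_measure_eq_density: "scale_measure r M = density M (\<lambda>_. r)"
  by (rule measure_eqI) (auto simp: emeasure_density_const)

section \<open>Integration against the three components of the kernel\<close>

context half_line_resolvent
begin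

lemma rho_pos: "0 < \<beta> \<Longrightarrow> 0 < \<gamma> \<Longrightarrow> 0 < rho \<beta> \<gamma> l"
  using l by (auto simp: rho_def intro!: add_pos_pos)

lemma rg_kernel_integral:
  assumes x: "0 \<le> x" and \<beta>: "0 < \<beta>" and \<gamma>: "0 < \<gamma>"
  shows "integrable (rg_kernel \<beta> \<gamma> l x) f"
    and "(\<integral>y. f y \<partial>rg_kernel \<beta> \<gamma> l x) = RD l f x + rho \<beta> \<gamma> l * (2 * pairing (e_fun l) f + \<gamma> * f 0) * e_fun l x"
proof -
  let ?R = "restrict_space lborel {0::real..}"
  let ?B = "restrict_space borel {0::real..}"
  let ?r = "rho \<beta> \<gamma> l"
  have r: "0 \<le> ?r" using rho_pos[OF \<beta> \<gamma>] by simp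
  have e0: "0 \<le> e_fun l y" for y by (simp add: e_fun_def)
  have sets: "sets ?R = sets ?B" by (rule sets_restrict_space_cong) simp
  have fB: "f \<in> borel_measurable ?B"
    by (rule borel_measurable_continuous_on_restrict[OF f_cont])
  then have fR: "f \<in> borel_measurable ?R" using measurable_cong_sets[OF sets refl] by blast
  have rDm: "(\<lambda>y. rD l x y) \<in> borel_measurable ?R" and em: "(\<lambda>y. 2 * ?r * e_fun l (x + y)) \<in> borel_measurable ?R"
    unfolding rD_def e_fun_def by (auto intro!: measurable_restrict_space1)
  \<comment> \<open>The density is cut off at 0 by \<open>ennreal\<close>, so its integral formula
    requires \<open>rD\<close> to be nonnegative, which follows from
    \<open>|x - y| \<le> x + y\<close>.\<close>
  have rD0: "AE y in ?R. 0 \<le> rD l x y"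
  proof (rule AE_I2)
    fix y assume "y \<in> space ?R"
    then have "a * \<bar>x - y\<bar> \<le> a * (x + y)" using x a_pos by (intro mult_left_mono) (auto simp: space_restrict_space)
    then show "0 \<le> rD l x y" using a_pos by (simp add: rD_def a[symmetric])
  qed
  have A: "integrable (density ?R (\<lambda>y. ennreal (rD l x y))) f" "(\<integral>y. f y \<partial>density ?R (\<lambda>y. ennreal (rD l x y))) = RD l f x"
    using rD_f_integrable[OF x]
    by (auto simp: integrable_density[OF fR rDm rD0] integral_density[OF fR rDm rD0]
        integrable_restrict_space integral_restrict_space set_integrable_def RD_def set_lebesgue_integral_def)
  have e_split: "e_fun l (x + y) = e_fun l x * exp (- a * y)" for y
    unfolding e_fun_def a[symmetric] exp_add[symmetric] by (simp add: algebra_simps)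
  have int: "set_integrable lborel {0..} (\<lambda>y. exp (- a * y) * f y)"
    by (rule set_integrable_exp_bound[OF exp_f_cont[of "- a"], of K]) (use K in \<open>auto simp: abs_mult mult.commute\<close>)
  have e1: "AE y in ?R. 0 \<le> 2 * ?r * e_fun l (x + y)" using r e0 by simp
  have eq: "indicator {0..} y *\<^sub>R ((2 * ?r * e_fun l (x + y)) *\<^sub>R f y) =
      (2 * ?r * e_fun l x) * (indicator {0..} y *\<^sub>R (exp (- a * y) * f y))" for y
    by (simp add: e_split)
  have B: "integrable (density ?R (\<lambda>y. ennreal (2 * ?r * e_fun l (x + y)))) f"
      "(\<integral>y. f y \<partial>density ?R (\<lambda>y. ennreal (2 * ?r * e_fun l (x + y)))) = 2 * ?r * e_fun l x * pairing (e_fun l) f"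
  proof -
    show "integrable (density ?R (\<lambda>y. ennreal (2 * ?r * e_fun l (x + y)))) f"
      using int unfolding integrable_density[OF fR em e1] set_integrable_def
      by (subst integrable_restrict_space) (simp, simp only: eq, rule integrable_mult_right)
    have "(\<integral>y. f y \<partial>density ?R (\<lambda>y. ennreal (2 * ?r * e_fun l (x + y)))) =
        (\<integral>y. (2 * ?r * e_fun l x) * (indicator {0..} y *\<^sub>R (exp (- a * y) * f y)) \<partial>lborel)"
      unfolding integral_density[OF fR em e1] by (subst integral_restrict_space) (simp, simp only: eq)
    also have "\<dots> = 2 * ?r * e_fun l x * E"
      unfolding E_eq set_lebesgue_integral_def by (rule integral_mult_right_zero)
    finally show "(\<integral>y. f y \<partial>density ?R (\<lambda>y. ennreal (2 * ?r * e_fun l (x + y)))) = 2 * ?r * e_fun l x * pairing (e_fun l) f"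
      by (simp add: E_def)
  qed
  let ?c = "\<gamma> * ?r * e_fun l x"
  have c0: "0 \<le> ?c" using \<gamma> r e0 by simp
  have z: "0 \<in> space ?B" by (simp add: space_restrict_space)
  have fret: "f \<in> borel_measurable (return ?B 0)" using fB by simp
  interpret ret: prob_space "return ?B 0" by (rule prob_space_return[OF z])
  have ri: "integrable (return ?B 0) f"
  proof (rule ret.integrable_const_bound[of _ "\<bar>f 0\<bar>"])
    have "{y \<in> space ?B. norm (f y) \<le> \<bar>f 0\<bar>} \<in> sets ?B" using fB by measurable
    then show "AE y in return ?B 0. norm (f y) \<le> \<bar>f 0\<bar>"
      by (subst AE_return[OF z]) (auto simp: pred_def)
  qed (rule fret)
  have C: "integrable (scale_measure (ennreal ?c) (return ?B 0)) f"
    "(\<integral>y. f y \<partial>scale_measure (ennreal ?c) (return ?B 0)) = ?c * f 0"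
    unfolding scale_measure_eq_density using c0 ri fret integral_return[OF z fB]
    by (simp_all add: integrable_density integral_density)
  have s1: "sets (density ?R (\<lambda>y. ennreal (2 * ?r * e_fun l (x + y)))) = sets (density ?R (\<lambda>y. ennreal (rD l x y)))" by simp
  have s2: "sets (scale_measure (ennreal ?c) (return ?B 0)) = sets (add_measure (density ?R (\<lambda>y. ennreal (rD l x y)))
        (density ?R (\<lambda>y. ennreal (2 * ?r * e_fun l (x + y)))))"
    using sets by simp
  note AB = integral_add_measure[OF s1 A(1) B(1)]
  note ABC = integral_add_measure[OF s2 AB(1) C(1)]
  show "integrable (rg_kernel \<beta> \<gamma> l x) f" unfolding rg_kernel_def by (rule ABC(1))
  show "(\<integral>y. f y \<partial>rg_kernel \<beta> \<gamma> l x) = RD l f x + ?r * (2 * pairing (e_fun l) f + \<gamma> * f 0) * e_fun l x"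
    unfolding rg_kernel_def ABC(2) AB(2) A(2) B(2) C(2) by (simp add: algebra_simps)
qed

end

theorem corollary4p5:
  fixes M :: "'a measure" and P F :: "real \<Rightarrow> 'a measure"
    and B L :: "real \<Rightarrow> 'a \<Rightarrow> real" and \<theta> :: "real \<Rightarrow> 'a \<Rightarrow> 'a" and \<beta> \<gamma> :: real
  assumes "brownian_local_time M P F B \<theta> L"
    and "\<beta> > 0" and "\<gamma> > 0"
  shows "\<forall>l>0. \<forall>f\<in>C0_half. \<forall>x\<ge>0.
      Rg P B L \<beta> \<gamma> l f x =
        RD l f x + rho \<beta> \<gamma> l * (2 * pairing (e_fun l) f + \<gamma> * f 0) * e_fun l x
    \<and> integrable (rg_kernel \<beta> \<gamma> l x) f
    \<and> Rg P B L \<beta> \<gamma> l f x = (\<integral>y. f y \<partial>rg_kernel \<beta> \<gamma> l x)"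
proof (intro allI impI ballI)
  fix l x :: real and f :: "real \<Rightarrow> real"
  assume l: "0 < l" and f: "f \<in> C0_half" and x: "0 \<le> x"
  obtain K where K: "0 < K" "\<And>y. 0 \<le> y \<Longrightarrow> \<bar>f y\<bar> \<le> K" using C0_half_bounded[OF f] by metis
  define a k c where "a = sqrt (2 * l)" and "k = \<beta> + \<gamma> * l"
    and "c = rho \<beta> \<gamma> l * (2 * pairing (e_fun l) f + \<gamma> * f 0)"
  interpret half_line_resolvent l a f K c
    by unfold_locales (use l f K a_def in auto)
  have k: "0 < k" using assms l by (simp add: k_def add_pos_pos)
  \<comment> \<open>\<open>rho \<beta> \<gamma> l\<close> is the reciprocal of \<open>k + a\<close>,
    so the coefficient in the theorem is the one singled out by the boundary condition.\<close>
  have c: "c = (2 * E + \<gamma> * f 0) / (k + a)"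
    by (simp add: c_def rho_def E_def a_def k_def field_simps)
  interpret discounted M P F B \<theta> L l k \<gamma> f sol sol' bnd
    by (intro discounted.intro assms half_line_solution k c)
  have "Rg P B L \<beta> \<gamma> l f x = sol x"
    using Rg_eq[OF assms(2) k_def, of x] x by simp
  also have "sol x = RD l f x + c * e_fun l x"
    unfolding sol_def RD_eq[OF x] e_fun_def a_def[symmetric] by simp
  finally have "Rg P B L \<beta> \<gamma> l f x =
      RD l f x + rho \<beta> \<gamma> l * (2 * pairing (e_fun l) f + \<gamma> * f 0) * e_fun l x"
    by (simp add: c_def)
  then show "Rg P B L \<beta> \<gamma> l f x =
        RD l f x + rho \<beta> \<gamma> l * (2 * pairing (e_fun l) f + \<gamma> * f 0) * e_fun l x
    \<and> integrable (rg_kernel \<beta> \<gamma> l x) f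
    \<and> Rg P B L \<beta> \<gamma> l f x = (\<integral>y. f y \<partial>rg_kernel \<beta> \<gamma> l x)"
    using rg_kernel_integral[OF x assms(2,3)] by simp
qed

end
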